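(* Consider a multilayer perceptron with $L$ fully connected layers of constant layer size $d$ (each weight matrix is $d\times d$), with $N=d^2L$ weights and $n$ data points, and let $H\in\mathbb{R}^{N\times N}$ be its Gauss-Newton Hessian matrix, with associated vectors $v_k(i)\in\mathbb{R}^d$ (as defined in the context). Given the precomputed data described in the context, it requires $\mathcal{O}(nN)$ work to compute $\|v_k(i)\|$ for all $i\in\{1,\dots,n\}$ and $k\in\{1,\dots,N\}$ (the input of the Monte Carlo sampling algorithm described in the context), and it then requires $\mathcal{O}(n+d/\epsilon^2)$ work to compute every estimator $\tilde H_{km}$ with that algorithm, where $\epsilon$ is a prescribed accuracy that does not depend on $n$.
   Context: Network: given data pairs $(x_i^0,y_i)$, $i=1,\dots,n$, with $x_i^0\in\mathbb{R}^d$, and weight matrices $W_\ell\in\mathbb{R}^{d\times d}$, $\ell=1,\dots,L$, the forward pass is $x_i^\ell=s(W_\ell x_i^{\ell-1})\in\mathbb{R}^d$ for $\ell=1,\dots,L$, where $s$ is a (differentiable) scalar activation function applied to every entry of its argument, with derivative $\dot s$. The weight vector is $w=[\mathrm{vec}(W_1),\dots,\mathrm{vec}(W_L)]\in\mathbb{R}^N$, where $N=d^2L$ and $\mathrm{vec}$ is column-major vectorization. Gauss-Newton Hessian (GNH): $f(x_i^L,y_i)$ is the loss function, $Q_i=\frac1n\,\partial^2_{xx}f(x_i^L,y_i)\in\mathbb{R}^{d\times d}$, $J_i=\partial_w x_i^L\in\mathbb{R}^{d\times N}$ is the Jacobian of the network output with respect to the weights, and $H=\sum_{i=1}^n J_i^TQ_iJ_i\in\mathbb{R}^{N\times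 N}$. Each $Q_i$ is symmetric positive semi-definite, with a fixed symmetric factorization $Q_i=R_i^TR_i$, $R_i\in\mathbb{R}^{d\times d}$. With $e_k$ the $k$-th canonical basis vector of $\mathbb{R}^N$, set $v_k(i)=R_iJ_ie_k\in\mathbb{R}^d$ and $v_k=[v_k(1),\dots,v_k(n)]\in\mathbb{R}^{dn}$, so that $H_{km}=\sum_{i=1}^n v_k(i)^Tv_m(i)=v_k^Tv_m$. $\|\cdot\|$ is the Euclidean norm. Precomputed data: let $M_i^\ell=\mathrm{diag}(\dot s(W_\ell x_i^{\ell-1}))\in\mathbb{R}^{d\times d}$ (with $\dot s$ applied entrywise). The vectors $x_i^{\ell-1}$ and the $d\times d$ matrices $$C_i^\ell=R_iM_i^LW_LM_i^{L-1}W_{L-1}\cdots W_{\ell+1}M_i^\ell,\qquad i=1,\dots,n,\ \ell=1,\dots,L$$ (so $C_i^L=R_iM_i^L$ and $C_i^{\ell-1}=C_i^\ell W_\ell M_i^{\ell-1}$), have been computed and stored. Monte Carlo sampling algorithm (for fixed $k,m$ and number of samples $c$; input: the norms $\|v_k(i)\|$, $\|v_m(i)\|$, $i=1,\dots,n$): compute the probabilities $$P_{km}(t)=\frac{\|v_k(t)\|\,\|v_m(t)\|}{\sum_{j=1}^n\|v_k(j)\|\,\|v_m(j)\|},\qquad t=1,\dots,n$$ (denominator assumed nonzero), draw $c$ independent samples $t_1,\dots,t_c$ from $\{1,\dots,n\}$ with replacement according to $P_{km}$, and output $$\tilde H_{km}=\frac1c\sum_{j=1}^c\frac{v_k(t_j)^Tv_m(t_j)}{P_{km}(t_j)}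 .$$ Accuracy: for a prescribed accuracy $\epsilon\in(0,1)$ the number of samples is $c=\mathcal{O}(1/\epsilon^2)$: $c\ge 1/\epsilon^2$ gives root-mean-square error at most $\epsilon\|v_k\|\|v_m\|$, and $c\ge\eta^2/\epsilon^2$ with $\eta=1+\sqrt{8\log(1/\delta)}$ gives absolute error at most $\epsilon\|v_k\|\|v_m\|$ with probability at least $1-\delta$, for a fixed $\delta\in(0,1)$ (treated as a constant). Cost model: work is the number of unit-cost operations on real numbers (arithmetic, square roots, comparisons, floor, drawing a uniform random number in $[0,1]$, and array access). The implied constants in $\mathcal{O}(\cdot)$ are independent of $d,L,n,N,\epsilon$. *)

theory Defs
  imports "HOL-Probability.Probability" "Jordan_Normal_Form.Matrix"
begin

unbundle no inner_syntax
unbundle no vec_syntax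

text \<open>
  Vectors and matrices are those of Jordan_Normal_Form, whose dimensions are numbers, because the
  complexity constants have to be chosen before the sizes.  Data points and coordinates are
  numbered from 0, layers from 1 (layer 0 being the input).
  The weight matrices are given through the weight vector, of which they are the slices.
  \<open>loss\<close> is a function of a network output and a label; \<open>factor i\<close> is the matrix \<open>R\<^sub>i\<close>.
\<close>

record 'y network =
  width :: nat
  depth :: nat
  ndata :: nat
  act :: "real \<Rightarrow> real"
  weights :: "real vec"
  input :: "nat \<Rightarrow> real vec"
  label :: "nat \<Rightarrow> 'y"
  loss :: "real vec \<Rightarrow> 'y \<Rightarrow> real"
  factor :: "nat \<Rightarrow> real mat"

definition num_weights :: "'y network \<Rightarrow> nat" where
  "num_weights S = (width S)\<^sup>2 * depth S"

text \<open>Inverse of \<open>w = [vec W\<^sub>1, \<dots>, vec W\<^sub>L]\<close>, each block being stored column by column.\<close>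

definition weight_mat :: "nat \<Rightarrow> real vec \<Rightarrow> nat \<Rightarrow> real mat" where
  "weight_mat d w l = Matrix.mat d d (\<lambda>(a, b). w $ ((l - 1) * d\<^sup>2 + b * d + a))"

primrec forward :: "'y network \<Rightarrow> real vec \<Rightarrow> nat \<Rightarrow> nat \<Rightarrow> real vec" where
  "forward S w i 0 = input S i"
| "forward S w i (Suc l) =
     map_vec (act S) (weight_mat (width S) w (Suc l) *\<^sub>v forward S w i l)"

abbreviation W_mat :: "'y network \<Rightarrow> nat \<Rightarrow> real mat" where
  "W_mat S l \<equiv> weight_mat (width S) (weights S) l"

abbreviation x_vec :: "'y network \<Rightarrow> nat \<Rightarrow> nat \<Rightarrow> real vec" where
  "x_vec S i l \<equiv> forward S (weights S) i l"

definition shift :: "real vec \<Rightarrow> nat \<Rightarrow> real \<Rightarrow> real vec" where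
  "shift z k t = z + t \<cdot>\<^sub>v unit_vec (dim_vec z) k"

definition partial_deriv :: "nat \<Rightarrow> (real vec \<Rightarrow> real) \<Rightarrow> real vec \<Rightarrow> real" where
  "partial_deriv k g z = deriv (\<lambda>t. g (shift z k t)) 0"

definition hessian :: "(real vec \<Rightarrow> real) \<Rightarrow> real vec \<Rightarrow> real mat" where
  "hessian g z = Matrix.mat (dim_vec z) (dim_vec z)
     (\<lambda>(a, b). partial_deriv b (partial_deriv a g) z)"

text \<open>Existence of all the derivatives that occur in \<^const>\<open>hessian\<close>
  (implied by twice differentiability at \<open>z\<close>).\<close>

definition twice_partially_differentiable :: "(real vec \<Rightarrow> real) \<Rightarrow> real vec \<Rightarrow> bool" where
  "twice_partially_differentiable g z \<longleftrightarrow> (\<forall>a < dim_vec z. \<forall>b < dim_vec z.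
     (\<forall>\<^sub>F t in nhds 0. (\<lambda>u. g (shift (shift z b t) a u)) field_differentiable (at 0)) \<and>
     (\<lambda>t. partial_deriv a g (shift z b t)) field_differentiable (at 0))"

definition Q_mat :: "'y network \<Rightarrow> nat \<Rightarrow> real mat" where
  "Q_mat S i = (1 / real (ndata S)) \<cdot>\<^sub>m
     hessian (\<lambda>z. loss S z (label S i)) (x_vec S i (depth S))"

definition J_mat :: "'y network \<Rightarrow> nat \<Rightarrow> real mat" where
  "J_mat S i = Matrix.mat (width S) (num_weights S)
     (\<lambda>(a, k). partial_deriv k (\<lambda>w. forward S w i (depth S) $ a) (weights S))"

definition gauss_newton_hessian :: "'y network \<Rightarrow> real mat" where
  "gauss_newton_hessian S = Matrix.mat (num_weights S) (num_weights S)
     (\<lambda>(k, m). \<Sum>i<ndata S. (transpose_mat (J_mat S i) * Q_mat S i * J_mat S i) $$ (k, m))"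

definition positive_semidefinite :: "real mat \<Rightarrow> bool" where
  "positive_semidefinite A \<longleftrightarrow> transpose_mat A = A \<and>
     (\<forall>z \<in> carrier_vec (dim_row A). 0 \<le> z \<bullet> (A *\<^sub>v z))"

definition gnh_setting :: "'y network \<Rightarrow> bool" where
  "gnh_setting S \<longleftrightarrow>
     1 \<le> width S \<and> 1 \<le> depth S \<and> 1 \<le> ndata S \<and>
     (\<forall>u. act S field_differentiable (at u)) \<and>
     weights S \<in> carrier_vec (num_weights S) \<and>
     (\<forall>i < ndata S.
        input S i \<in> carrier_vec (width S) \<and>
        twice_partially_differentiable (\<lambda>z. loss S z (label S i)) (x_vec S i (depth S)) \<and>
        positive_semidefinite (Q_mat S i) \<and>
        factor S i \<in> carrier_mat (width S) (width S) \<and>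
        Q_mat S i = transpose_mat (factor S i) * factor S i)"

definition norm_vec :: "real vec \<Rightarrow> real" where
  "norm_vec v = sqrt (v \<bullet> v)"

definition v_part :: "'y network \<Rightarrow> nat \<Rightarrow> nat \<Rightarrow> real vec" where
  "v_part S k i = factor S i *\<^sub>v (J_mat S i *\<^sub>v unit_vec (num_weights S) k)"

definition v_vec :: "'y network \<Rightarrow> nat \<Rightarrow> real vec" where
  "v_vec S k = Matrix.vec (width S * ndata S)
     (\<lambda>p. v_part S k (p div width S) $ (p mod width S))"

definition M_mat :: "'y network \<Rightarrow> nat \<Rightarrow> nat \<Rightarrow> real mat" where
  "M_mat S i l = mat_diag (width S) (\<lambda>a. deriv (act S) ((W_mat S l *\<^sub>v x_vec S i (l - 1)) $ a))"

text \<open>\<open>C_back S i j\<close> is the matrix \<open>C\<close> of layer \<open>L - j\<close>.\<close>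

primrec C_back :: "'y network \<Rightarrow> nat \<Rightarrow> nat \<Rightarrow> real mat" where
  "C_back S i 0 = factor S i * M_mat S i (depth S)"
| "C_back S i (Suc j) = C_back S i j * W_mat S (depth S - j) * M_mat S i (depth S - Suc j)"

definition C_mat :: "'y network \<Rightarrow> nat \<Rightarrow> nat \<Rightarrow> real mat" where
  "C_mat S i l = C_back S i (depth S - l)"

definition sample_prob :: "'y network \<Rightarrow> nat \<Rightarrow> nat \<Rightarrow> nat \<Rightarrow> real" where
  "sample_prob S k m t = norm_vec (v_part S k t) * norm_vec (v_part S m t) /
     (\<Sum>j<ndata S. norm_vec (v_part S k j) * norm_vec (v_part S m j))"

definition estimator :: "'y network \<Rightarrow> nat \<Rightarrow> nat \<Rightarrow> nat \<Rightarrow> (nat \<Rightarrow> nat) \<Rightarrow> real" where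
  "estimator S k m c t =
     1 / real c * (\<Sum>j<c. (v_part S k (t j) \<bullet> v_part S m (t j)) / sample_prob S k m (t j))"

definition draws :: "(nat \<Rightarrow> real) measure" where
  "draws = Pi\<^sub>M UNIV (\<lambda>_. uniform_measure lborel {0..1})"

definition iid_samples ::
    "nat \<Rightarrow> (nat \<Rightarrow> real) \<Rightarrow> nat \<Rightarrow> ((nat \<Rightarrow> real) \<Rightarrow> nat \<Rightarrow> nat) \<Rightarrow> bool" where
  "iid_samples n P c t \<longleftrightarrow>
     prob_space.indep_vars draws (\<lambda>_. count_space {..<n}) (\<lambda>j \<omega>. t \<omega> j) {..<c} \<and>
     (\<forall>j<c. \<forall>i<n. measure draws {\<omega> \<in> space draws. t \<omega> j = i} = P i)"

text \<open>
  A program is a fixed text in a small imperative language over the real numbers, with scalar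
  variables and arrays.  Arrays are indexed by tuples of numbers; the rank of an array access is
  fixed by the program text.  The only literals are integers, so that a program has no access to
  other real constants.  The charges dominate the number of arithmetic operations, square roots,
  floors, comparisons, random draws and array accesses (reading a variable or a literal costs one
  unit as well), so bounds proved here also hold when only those are counted.
  Division by zero yields 0 as usual in HOL.
\<close>

datatype expr =
    Const int
  | Var string
  | Elem string "expr list"
  | Add expr expr
  | Sub expr expr
  | Mul expr expr
  | Div expr expr
  | Sqrt expr
  | Floor expr

datatype test = Less expr expr

datatype prog =
    Skip
  | Assign string expr
  | Store string "expr list" expr
  | Draw string
  | Seq prog prog
  | If test prog prog
  | While test prog

text \<open>\<open>used\<close> counts the random numbers drawn so far.\<close>

record state =
  scalar :: "string \<Rightarrow> real"
  arr :: "string \<Rightarrow> nat list \<Rightarrow> real"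
  used :: nat

text \<open>Index values are rounded down, negative ones being read as 0.\<close>

definition to_index :: "real \<Rightarrow> nat" where
  "to_index r = nat \<lfloor>r\<rfloor>"

fun eval_expr :: "state \<Rightarrow> expr \<Rightarrow> real" where
  "eval_expr \<sigma> (Const z) = real_of_int z"
| "eval_expr \<sigma> (Var x) = scalar \<sigma> x"
| "eval_expr \<sigma> (Elem A es) = arr \<sigma> A (map (\<lambda>e. to_index (eval_expr \<sigma> e)) es)"
| "eval_expr \<sigma> (Add e f) = eval_expr \<sigma> e + eval_expr \<sigma> f"
| "eval_expr \<sigma> (Sub e f) = eval_expr \<sigma> e - eval_expr \<sigma> f"
| "eval_expr \<sigma> (Mul e f) = eval_expr \<sigma> e * eval_expr \<sigma> f"
| "eval_expr \<sigma> (Div e f) = eval_expr \<sigma> e / eval_expr \<sigma> f"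
| "eval_expr \<sigma> (Sqrt e) = sqrt (eval_expr \<sigma> e)"
| "eval_expr \<sigma> (Floor e) = real_of_int \<lfloor>eval_expr \<sigma> e\<rfloor>"

fun expr_work :: "expr \<Rightarrow> nat" where
  "expr_work (Const z) = 1"
| "expr_work (Var x) = 1"
| "expr_work (Elem A es) = 1 + sum_list (map expr_work es)"
| "expr_work (Add e f) = 1 + expr_work e + expr_work f"
| "expr_work (Sub e f) = 1 + expr_work e + expr_work f"
| "expr_work (Mul e f) = 1 + expr_work e + expr_work f"
| "expr_work (Div e f) = 1 + expr_work e + expr_work f"
| "expr_work (Sqrt e) = 1 + expr_work e"
| "expr_work (Floor e) = 1 + expr_work e"

fun eval_test :: "state \<Rightarrow> test \<Rightarrow> bool" where
  "eval_test \<sigma> (Less e f) \<longleftrightarrow> eval_expr \<sigma> e < eval_expr \<sigma> f"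

fun test_work :: "test \<Rightarrow> nat" where
  "test_work (Less e f) = 1 + expr_work e + expr_work f"

text \<open>\<open>exec \<omega> p \<sigma> k \<sigma>'\<close>: when the random numbers are \<open>\<omega> 0, \<omega> 1, \<dots>\<close>, the program \<open>p\<close>
  started in \<open>\<sigma>\<close> terminates in \<open>\<sigma>'\<close> after \<open>k\<close> units of work.  This relation is deterministic.\<close>

inductive exec :: "(nat \<Rightarrow> real) \<Rightarrow> prog \<Rightarrow> state \<Rightarrow> nat \<Rightarrow> state \<Rightarrow> bool" for \<omega> where
  Skip: "exec \<omega> Skip \<sigma> 1 \<sigma>"
| Assign: "exec \<omega> (Assign x e) \<sigma> (1 + expr_work e)
     (\<sigma>\<lparr>scalar := (scalar \<sigma>)(x := eval_expr \<sigma> e)\<rparr>)"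
| Store: "exec \<omega> (Store A es e) \<sigma> (1 + sum_list (map expr_work es) + expr_work e)
     (\<sigma>\<lparr>arr := (arr \<sigma>)(A := (arr \<sigma> A)(map (\<lambda>e. to_index (eval_expr \<sigma> e)) es := eval_expr \<sigma> e))\<rparr>)"
| Draw: "exec \<omega> (Draw x) \<sigma> 1
     (\<sigma>\<lparr>scalar := (scalar \<sigma>)(x := \<omega> (used \<sigma>)), used := Suc (used \<sigma>)\<rparr>)"
| Seq: "exec \<omega> p \<sigma> k \<sigma>' \<Longrightarrow> exec \<omega> q \<sigma>' k' \<sigma>'' \<Longrightarrow> exec \<omega> (Seq p q) \<sigma> (k + k') \<sigma>''"
| IfTrue: "eval_test \<sigma> b \<Longrightarrow> exec \<omega> p \<sigma> k \<sigma>' \<Longrightarrow> exec \<omega> (If b p q) \<sigma> (test_work b + k) \<sigma>'"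
| IfFalse: "\<not> eval_test \<sigma> b \<Longrightarrow> exec \<omega> q \<sigma> k \<sigma>' \<Longrightarrow> exec \<omega> (If b p q) \<sigma> (test_work b + k) \<sigma>'"
| WhileFalse: "\<not> eval_test \<sigma> b \<Longrightarrow> exec \<omega> (While b p) \<sigma> (test_work b) \<sigma>"
| WhileTrue: "eval_test \<sigma> b \<Longrightarrow> exec \<omega> p \<sigma> k \<sigma>' \<Longrightarrow> exec \<omega> (While b p) \<sigma>' k' \<sigma>'' \<Longrightarrow>
     exec \<omega> (While b p) \<sigma> (test_work b + k + k') \<sigma>''"

text \<open>Nothing is said about the rest of the memory, which may contain anything.\<close>

definition stores_precomputed :: "'y network \<Rightarrow> state \<Rightarrow> bool" where
  "stores_precomputed S \<sigma> \<longleftrightarrow>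
     scalar \<sigma> ''d'' = real (width S) \<and>
     scalar \<sigma> ''L'' = real (depth S) \<and>
     scalar \<sigma> ''n'' = real (ndata S) \<and>
     (\<forall>i < ndata S. \<forall>l \<in> {1..depth S}. \<forall>a < width S.
        arr \<sigma> ''x'' [i, l - 1, a] = x_vec S i (l - 1) $ a) \<and>
     (\<forall>i < ndata S. \<forall>l \<in> {1..depth S}. \<forall>a < width S. \<forall>b < width S.
        arr \<sigma> ''C'' [i, l, a, b] = C_mat S i l $$ (a, b))"

definition stores_norms :: "'y network \<Rightarrow> state \<Rightarrow> bool" where
  "stores_norms S \<sigma> \<longleftrightarrow> (\<forall>i < ndata S. \<forall>k < num_weights S.
     arr \<sigma> ''norm'' [i, k] = norm_vec (v_part S k i))"

definition stores_query :: "nat \<Rightarrow> nat \<Rightarrow> nat \<Rightarrow> state \<Rightarrow> bool" where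
  "stores_query k m c \<sigma> \<longleftrightarrow>
     scalar \<sigma> ''k'' = real k \<and> scalar \<sigma> ''m'' = real m \<and> scalar \<sigma> ''c'' = real c"

end

theory Submission
  imports Defs
begin

text \<open>
  By the chain rule \<open>v\<^sub>k(i)\<close> is the column of \<open>C\<^sub>i\<close> (in the layer of weight \<open>k\<close>) that belongs to the row of
  the weight, scaled by the entry of the previous layer that belongs to its column.  One column norm
  therefore serves \<open>d\<close> weights, and the inner product of two vectors \<open>v\<^sub>k(i)\<close>, \<open>v\<^sub>m(i)\<close> costs \<open>O(d)\<close>.
  To draw \<open>c\<close> samples from the distribution on \<open>n\<close> points in worst-case time \<open>O(n + c)\<close>, without a factor
  \<open>log n\<close>, the program builds an alias table: \<open>n\<close> cells of equal probability, each shared by at most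
  two points.  Every sampled term is bounded by \<open>\<Sum>\<^sub>i \<parallel>v\<^sub>k(i)\<parallel> \<parallel>v\<^sub>m(i)\<parallel> \<le> \<parallel>v\<^sub>k\<parallel> \<parallel>v\<^sub>m\<parallel>\<close>, which gives the mean square
  error directly, and the tail bound by Hoeffding's inequality, or by Chebyshev's when \<open>\<delta>\<close> is close to 1.
\<close>

section \<open>Execution of programs\<close>

text \<open>The samples must be independent with law \<open>sample_prob\<close> under
  \<open>draws\<close>, yet each run sees a single \<open>\<omega>\<close>. So the sampling function
  is fixed by the initial state alone: whatever determines it is computed before the first
  \<open>Draw\<close>, and afterwards sample number j depends on one coordinate of
  \<open>\<omega>\<close> only. The work bound is demanded for every sequence of numbers in [0,1],
  not on average, which rules out rejection methods, and even the null event u = 1 must produce a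
  legal sample.

  The Jacobian consists of derivatives of the forward pass, which are propagated upwards from the
  perturbed weight, whereas the stored matrices are products accumulated downwards from the output.
  Associativity reconciles the two. Along one coordinate of the weights everything is a function of
  one real variable, so the scalar chain rule applies entry by entry.

  Termination, work and result are established together: \<open>runs\<close> is a Hoare triple for
  total correctness with a work budget. The numerical constants come from counting the nodes of the
  program texts, generously rounded.\<close>

definition runs ::
    "(nat \<Rightarrow> real) \<Rightarrow> prog \<Rightarrow> state \<Rightarrow> nat \<Rightarrow> (state \<Rightarrow> bool) \<Rightarrow> bool" where
  "runs \<omega> p \<sigma> B Q \<longleftrightarrow> (\<exists>k \<sigma>'. exec \<omega> p \<sigma> k \<sigma>' \<and> k \<le> B \<and> Q \<sigma>')"

lemma runs_mono:
  assumes "runs \<omega> p \<sigma> B Q" "B \<le> B'" "\<And>\<sigma>'. Q \<sigma>' \<Longrightarrow> Q' \<sigma>'"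
  shows "runs \<omega> p \<sigma> B' Q'"
  using assms unfolding runs_def by (meson le_trans)

lemma runs_Seq:
  assumes "runs \<omega> p \<sigma> B Q" "\<And>\<sigma>'. Q \<sigma>' \<Longrightarrow> runs \<omega> q \<sigma>' B' R" "B + B' \<le> B''"
  shows "runs \<omega> (Seq p q) \<sigma> B'' R"
proof -
  obtain k \<sigma>' where 1: "exec \<omega> p \<sigma> k \<sigma>'" "k \<le> B" "Q \<sigma>'"
    using assms(1) unfolding runs_def by blast
  obtain k' \<sigma>'' where "exec \<omega> q \<sigma>' k' \<sigma>''" "k' \<le> B'" "R \<sigma>''"
    using assms(2)[OF 1(3)] unfolding runs_def by blast
  then show ?thesis
    using 1 assms(3) unfolding runs_def by (meson add_mono exec.Seq le_trans)
qed

section \<open>Frame conditions and dependence on the random numbers\<close>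

primrec assigned :: "prog \<Rightarrow> string set" where
  "assigned Skip = {}"
| "assigned (Assign x e) = {x}"
| "assigned (Store A es e) = {}"
| "assigned (Draw x) = {x}"
| "assigned (Seq p q) = assigned p \<union> assigned q"
| "assigned (If b p q) = assigned p \<union> assigned q"
| "assigned (While b p) = assigned p"

primrec stored :: "prog \<Rightarrow> string set" where
  "stored Skip = {}"
| "stored (Assign x e) = {}"
| "stored (Store A es e) = {A}"
| "stored (Draw x) = {}"
| "stored (Seq p q) = stored p \<union> stored q"
| "stored (If b p q) = stored p \<union> stored q"
| "stored (While b p) = stored p"

primrec draw_free :: "prog \<Rightarrow> bool" where
  "draw_free Skip = True"
| "draw_free (Assign x e) = True"
| "draw_free (Store A es e) = True"
| "draw_free (Draw x) = False"
| "draw_free (Seq p q) = (draw_free p \<and> draw_free q)"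
| "draw_free (If b p q) = (draw_free p \<and> draw_free q)"
| "draw_free (While b p) = draw_free p"

text \<open>The frame condition for code that may write the scalars in \<open>X\<close> and the
  arrays in \<open>Y\<close>. The counter \<open>used\<close> is exempt; it is controlled through
  \<open>draw_free\<close>.\<close>

definition agree :: "string set \<Rightarrow> string set \<Rightarrow> state \<Rightarrow> state \<Rightarrow> bool" where
  "agree X Y \<sigma> \<sigma>' \<longleftrightarrow>
     (\<forall>x. x \<notin> X \<longrightarrow> scalar \<sigma>' x = scalar \<sigma> x) \<and> (\<forall>A. A \<notin> Y \<longrightarrow> arr \<sigma>' A = arr \<sigma> A)"

lemma agree_trans:
  "agree X Y \<sigma> \<sigma>' \<Longrightarrow> agree X' Y' \<sigma>' \<sigma>'' \<Longrightarrow> X \<subseteq> Z \<Longrightarrow> X' \<subseteq> Z \<Longrightarrow> Y \<subseteq> V \<Longrightarrow> Y' \<subseteq> V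
    \<Longrightarrow> agree Z V \<sigma> \<sigma>''"
  unfolding agree_def by (metis subsetD)

lemma agreeD:
  assumes "agree X Y \<sigma> \<sigma>'"
  shows "x \<notin> X \<Longrightarrow> scalar \<sigma>' x = scalar \<sigma> x" "A \<notin> Y \<Longrightarrow> arr \<sigma>' A = arr \<sigma> A"
  using assms by (auto simp: agree_def)

lemma exec_agree: "exec \<omega> p \<sigma> k \<sigma>' \<Longrightarrow> agree (assigned p) (stored p) \<sigma> \<sigma>'"
  by (induction rule: exec.induct) (auto simp: agree_def)

lemma exec_used: "exec \<omega> p \<sigma> k \<sigma>' \<Longrightarrow> draw_free p \<Longrightarrow> used \<sigma>' = used \<sigma>"
  by (induction rule: exec.induct) auto

text \<open>Only \<open>Draw\<close> consults the random numbers. This transfer between two streams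
  is what makes the alias table independent of \<open>\<omega>\<close>.\<close>

lemma exec_draw_free: "exec \<omega> p \<sigma> k \<sigma>' \<Longrightarrow> draw_free p \<Longrightarrow> exec \<omega>' p \<sigma> k \<sigma>'"
  by (induction rule: exec.induct)
    (auto intro: exec.intros simp del: One_nat_def plus_1_eq_Suc)

text \<open>The frame is read off the program text, so postconditions need to name only what a
  program computes; whatever it leaves alone is recovered here.\<close>

lemma runs_agree:
  assumes "runs \<omega> p \<sigma> B Q"
  shows "runs \<omega> p \<sigma> B (\<lambda>\<sigma>'. Q \<sigma>' \<and> agree (assigned p) (stored p) \<sigma> \<sigma>')"
  using assms exec_agree unfolding runs_def by blast

lemma runs_used:
  assumes "runs \<omega> p \<sigma> B Q" "draw_free p"
  shows "runs \<omega> p \<sigma> B (\<lambda>\<sigma>'. Q \<sigma>' \<and> used \<sigma>' = used \<sigma>)"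
  using assms exec_used unfolding runs_def by blast

section \<open>Loop-free programs as state transformers\<close>

primrec loop_free :: "prog \<Rightarrow> bool" where
  "loop_free Skip = True"
| "loop_free (Assign x e) = True"
| "loop_free (Store A es e) = True"
| "loop_free (Draw x) = True"
| "loop_free (Seq p q) = (loop_free p \<and> loop_free q)"
| "loop_free (If b p q) = (loop_free p \<and> loop_free q)"
| "loop_free (While b p) = False"

text \<open>Without loops the final state is a function of the initial one that the simplifier can
  evaluate. The value at \<open>While\<close> is a dummy, excluded by
  \<open>loop_free\<close>.\<close>

primrec eff :: "(nat \<Rightarrow> real) \<Rightarrow> prog \<Rightarrow> state \<Rightarrow> state" where
  "eff \<omega> Skip \<sigma> = \<sigma>"
| "eff \<omega> (Assign x e) \<sigma> = \<sigma>\<lparr>scalar := (scalar \<sigma>)(x := eval_expr \<sigma> e)\<rparr>"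
| "eff \<omega> (Store A es e) \<sigma> =
     \<sigma>\<lparr>arr := (arr \<sigma>)(A := (arr \<sigma> A)(map (\<lambda>e. to_index (eval_expr \<sigma> e)) es := eval_expr \<sigma> e))\<rparr>"
| "eff \<omega> (Draw x) \<sigma> = \<sigma>\<lparr>scalar := (scalar \<sigma>)(x := \<omega> (used \<sigma>)), used := Suc (used \<sigma>)\<rparr>"
| "eff \<omega> (Seq p q) \<sigma> = eff \<omega> q (eff \<omega> p \<sigma>)"
| "eff \<omega> (If b p q) \<sigma> = (if eval_test \<sigma> b then eff \<omega> p \<sigma> else eff \<omega> q \<sigma>)"
| "eff \<omega> (While b p) \<sigma> = \<sigma>"

text \<open>Both branches of an \<open>If\<close> are charged instead of the more expensive one,
  which keeps the bound a plain sum at the price of a larger constant.\<close>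

primrec size_bound :: "prog \<Rightarrow> nat" where
  "size_bound Skip = 1"
| "size_bound (Assign x e) = 1 + expr_work e"
| "size_bound (Store A es e) = 1 + sum_list (map expr_work es) + expr_work e"
| "size_bound (Draw x) = 1"
| "size_bound (Seq p q) = size_bound p + size_bound q"
| "size_bound (If b p q) = test_work b + size_bound p + size_bound q"
| "size_bound (While b p) = 0"

lemma exec_eff: "loop_free p \<Longrightarrow> \<exists>k\<le>size_bound p. exec \<omega> p \<sigma> k (eff \<omega> p \<sigma>)"
proof (induction p arbitrary: \<sigma>)
  case (Seq p q)
  then obtain k k' where "k \<le> size_bound p" "exec \<omega> p \<sigma> k (eff \<omega> p \<sigma>)"
    "k' \<le> size_bound q" "exec \<omega> q (eff \<omega> p \<sigma>) k' (eff \<omega> q (eff \<omega> p \<sigma>))"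
    by (metis loop_free.simps(5))
  then show ?case
    by (intro exI[of _ "k + k'"]) (auto intro: exec.Seq)
next
  case (If b p q)
  obtain k where k: "k \<le> size_bound p" "exec \<omega> p \<sigma> k (eff \<omega> p \<sigma>)"
    using If by auto
  obtain k' where k': "k' \<le> size_bound q" "exec \<omega> q \<sigma> k' (eff \<omega> q \<sigma>)"
    using If by auto
  show ?case
  proof (cases "eval_test \<sigma> b")
    case True
    then show ?thesis
      using k by (intro exI[of _ "test_work b + k"]) (auto intro: exec.IfTrue)
  next
    case False
    then show ?thesis
      using k' by (intro exI[of _ "test_work b + k'"]) (auto intro: exec.IfFalse)
  qed
next
  case Skip
  show ?case
    using exec.Skip[of \<omega> \<sigma>] by (metis eff.simps(1) order_refl size_bound.simps(1))
next
  case (Assign x e)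
  show ?case
    using exec.Assign[of \<omega> x e \<sigma>] by (metis eff.simps(2) order_refl size_bound.simps(2))
next
  case (Store A es e)
  show ?case
    using exec.Store[of \<omega> A es e \<sigma>] by (metis eff.simps(3) order_refl size_bound.simps(3))
next
  case (Draw x)
  show ?case
    using exec.Draw[of \<omega> x \<sigma>] by (metis eff.simps(4) order_refl size_bound.simps(4))
qed simp

lemma runs_loop_free:
  assumes "loop_free p" "Q (eff \<omega> p \<sigma>)" "size_bound p \<le> B"
  shows "runs \<omega> p \<sigma> B Q"
  using exec_eff[OF assms(1)] assms(2,3) unfolding runs_def by (meson le_trans)

section \<open>Rules for loops\<close>

lemma runs_While:
  assumes "I v \<sigma>"
    and step: "\<And>v \<sigma>. I v \<sigma> \<Longrightarrow> eval_test \<sigma> b \<Longrightarrow>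
      runs \<omega> p \<sigma> B (\<lambda>\<sigma>'. \<exists>v'<v. I v' \<sigma>')"
    and stop: "\<And>v \<sigma>. I v \<sigma> \<Longrightarrow> \<not> eval_test \<sigma> b \<Longrightarrow> Q \<sigma>"
    and cost: "v * (test_work b + B) + test_work b \<le> B'"
  shows "runs \<omega> (While b p) \<sigma> B' Q"
proof -
  \<comment> \<open>The variant bounds the number of rounds, each paying for test and body; the last
    summand is the test that fails.\<close>
  have "runs \<omega> (While b p) \<sigma> (v * (test_work b + B) + test_work b) Q"
    using assms(1)
  proof (induction v arbitrary: \<sigma> rule: less_induct)
    case (less v)
    show ?case
    proof (cases "eval_test \<sigma> b")
      case False
      then show ?thesis
        using exec.WhileFalse[OF False] stop[OF less.prems False] unfolding runs_def
        by (meson le_add2)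
    next
      case True
      obtain k \<sigma>' v' where 1: "exec \<omega> p \<sigma> k \<sigma>'" "k \<le> B" "v' < v" "I v' \<sigma>'"
        using step[OF less.prems True] unfolding runs_def by blast
      obtain k' \<sigma>'' where 2: "exec \<omega> (While b p) \<sigma>' k' \<sigma>''" "Q \<sigma>''"
        "k' \<le> v' * (test_work b + B) + test_work b"
        using less.IH[OF 1(3,4)] unfolding runs_def by blast
      \<comment> \<open>The decrease from \<open>v\<close> to \<open>v'\<close> pays for the round
        just executed.\<close>
      have "Suc v' * (test_work b + B) \<le> v * (test_work b + B)"
        using 1(3) by (intro mult_right_mono) auto
      then have "test_work b + k + k' \<le> v * (test_work b + B) + test_work b"
        using 1(2) 2(3) by simp
      then show ?thesis
        using exec.WhileTrue[OF True 1(1) 2(1)] 2(2) unfolding runs_def by blast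
    qed
  qed
  then show ?thesis
    using cost by (rule runs_mono)
qed

definition For :: "string \<Rightarrow> string \<Rightarrow> prog \<Rightarrow> prog" where
  "For x y p = Seq (Assign x (Const 0))
     (While (Less (Var x) (Var y)) (Seq p (Assign x (Add (Var x) (Const 1)))))"

lemma For_simps [simp]:
  "assigned (For x y p) = insert x (assigned p)"
  "stored (For x y p) = stored p"
  "draw_free (For x y p) = draw_free p"
  by (auto simp: For_def)

text \<open>Beyond its body a round costs 7 units: 3 for the test and 4 for the increment. The
  remaining 5 are 2 for the initialisation and 3 for the failing test. The frame relative to the
  state before the loop is handed to \<open>step\<close> and \<open>stop\<close>, so that invariants
  need not repeat what the loop leaves unchanged.\<close>

lemma runs_For:
  assumes y: "scalar \<sigma> y = real N" "y \<notin> assigned p" "x \<noteq> y" "x \<notin> assigned p"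
    and init: "I 0 (\<sigma>\<lparr>scalar := (scalar \<sigma>)(x := 0)\<rparr>)"
    and step: "\<And>j \<tau>. j < N \<Longrightarrow> I j \<tau> \<Longrightarrow> scalar \<tau> x = real j \<Longrightarrow>
      agree (insert x (assigned p)) (stored p) \<sigma> \<tau> \<Longrightarrow>
      runs \<omega> p \<tau> B (\<lambda>\<tau>'. I (Suc j) (\<tau>'\<lparr>scalar := (scalar \<tau>')(x := real (Suc j))\<rparr>))"
    and stop: "\<And>\<tau>. I N \<tau> \<Longrightarrow> agree (insert x (assigned p)) (stored p) \<sigma> \<tau> \<Longrightarrow> Q \<tau>"
    and cost: "N * (B + 7) + 5 \<le> B'"
  shows "runs \<omega> (For x y p) \<sigma> B' Q"
proof -
  let ?X = "insert x (assigned p)"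
  define J where "J v \<tau> \<longleftrightarrow> (\<exists>j. v + j = N \<and> I j \<tau> \<and> scalar \<tau> x = real j \<and>
    agree ?X (stored p) \<sigma> \<tau>)" for v \<tau>
  have yv: "scalar \<tau> y = real N" if "J v \<tau>" for v \<tau>
    using that y unfolding J_def by (auto dest: agreeD(1))
  let ?body = "Seq p (Assign x (Add (Var x) (Const 1)))"
  have body: "runs \<omega> ?body \<tau> (B + 4) (\<lambda>\<tau>'. \<exists>v'<v. J v' \<tau>')"
    if J: "J v \<tau>" and lt: "eval_test \<tau> (Less (Var x) (Var y))" for v \<tau>
  proof -
    obtain j where j: "v + j = N" "I j \<tau>" "scalar \<tau> x = real j" "agree ?X (stored p) \<sigma> \<tau>"
      using J unfolding J_def by blast
    have jN: "j < N"
      using lt yv[OF J] j(3) by simp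
    show ?thesis
    proof (rule runs_Seq[OF runs_agree[OF step[OF jN j(2-4)]]])
      fix \<tau>'
      assume A: "I (Suc j) (\<tau>'\<lparr>scalar := (scalar \<tau>')(x := real (Suc j))\<rparr>) \<and>
        agree (assigned p) (stored p) \<tau> \<tau>'"
      have sx: "scalar \<tau>' x = real j"
        using A j(3) y(4) by (auto dest: agreeD(1))
      have "agree ?X (stored p) \<sigma> (\<tau>'\<lparr>scalar := (scalar \<tau>')(x := real (Suc j))\<rparr>)"
        using A j(4) by (auto simp: agree_def)
      then have "J (v - 1) (\<tau>'\<lparr>scalar := (scalar \<tau>')(x := real (Suc j))\<rparr>)"
        using A j(1) jN unfolding J_def by (intro exI[of _ "Suc j"]) auto
      moreover have "v - 1 < v"
        using j(1) jN by simp
      ultimately show "runs \<omega> (Assign x (Add (Var x) (Const 1))) \<tau>' 4 (\<lambda>\<tau>'. \<exists>v'<v. J v' \<tau>')"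
        by (intro runs_loop_free) (auto simp: sx add.commute)
    qed simp
  qed
  have J0: "J N (\<sigma>\<lparr>scalar := (scalar \<sigma>)(x := 0)\<rparr>)"
    using init unfolding J_def by (auto simp: agree_def)
  have "runs \<omega> (While (Less (Var x) (Var y)) ?body) (\<sigma>\<lparr>scalar := (scalar \<sigma>)(x := 0)\<rparr>) (B' - 2) Q"
  proof (rule runs_While[where I = J, OF J0 body])
    fix v \<tau> assume J: "J v \<tau>" and "\<not> eval_test \<tau> (Less (Var x) (Var y))"
    then have "v = 0"
      using yv[OF J] unfolding J_def by auto
    then show "Q \<tau>"
      using J stop unfolding J_def by auto
  qed (use cost in \<open>auto simp: algebra_simps\<close>)
  then show ?thesis
    unfolding For_def
    using cost by (intro runs_Seq[where B = 2 and B' = "B' - 2"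
        and Q = "\<lambda>\<tau>. \<tau> = \<sigma>\<lparr>scalar := (scalar \<sigma>)(x := 0)\<rparr>"]) (auto intro!: runs_loop_free)
qed

lemma to_index_of_nat [simp]: "to_index (real k) = k"
  by (simp add: to_index_def)

section \<open>The alias method\<close>

text \<open>Cell \<open>s\<close> gives probability \<open>q s / n\<close> to \<open>s\<close> and the rest of its \<open>1 / n\<close> to \<open>al s\<close>.  The cells on the
  stacks \<open>xs\<close> (small) and \<open>ys\<close> (large) are still open: there \<open>q s\<close> is the weight left to distribute.\<close>

definition alias_inv ::
    "nat \<Rightarrow> (nat \<Rightarrow> real) \<Rightarrow> (nat \<Rightarrow> real) \<Rightarrow> (nat \<Rightarrow> nat) \<Rightarrow> nat list \<Rightarrow> nat list \<Rightarrow> bool" where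
  "alias_inv n q0 q al xs ys \<longleftrightarrow>
     distinct (xs @ ys) \<and> set (xs @ ys) \<subseteq> {..<n} \<and>
     (\<forall>s<n. al s < n \<and> 0 \<le> q s) \<and> (\<forall>s\<in>set (xs @ ys). al s = s) \<and>
     (\<forall>s<n. s \<notin> set ys \<longrightarrow> q s \<le> 1) \<and> (\<forall>s\<in>set xs. q s < 1) \<and> (\<forall>s\<in>set ys. 1 \<le> q s) \<and>
     (\<forall>x<n. q x + (\<Sum>s | s < n \<and> s \<notin> set (xs @ ys) \<and> al s = x. 1 - q s) = q0 x)"

text \<open>Here \<open>q0\<close> is n times the target distribution: the last equation says that
  the cells together give point \<open>x\<close> the probability \<open>q0 x / n\<close>.\<close>

definition alias_table :: "nat \<Rightarrow> (nat \<Rightarrow> real) \<Rightarrow> (nat \<Rightarrow> real) \<Rightarrow> (nat \<Rightarrow> nat) \<Rightarrow> bool" where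
  "alias_table n q0 q al \<longleftrightarrow> (\<forall>s<n. al s < n \<and> 0 \<le> q s \<and> q s \<le> 1) \<and>
     (\<forall>x<n. q x + (\<Sum>s | s < n \<and> al s = x. 1 - q s) = q0 x)"

lemma alias_inv_init:
  assumes "distinct (xs @ ys)" "set xs = {s. s < n \<and> q0 s < 1}" "set ys = {s. s < n \<and> 1 \<le> q0 s}"
    and "\<And>s. s < n \<Longrightarrow> 0 \<le> q0 s" "\<And>s. s < n \<Longrightarrow> q s = q0 s" "\<And>s. s < n \<Longrightarrow> al s = s"
  shows "alias_inv n q0 q al xs ys"
proof -
  have U: "set (xs @ ys) = {..<n}"
    unfolding set_append assms(2,3) by auto
  have "{s. s < n \<and> s \<notin> set (xs @ ys) \<and> al s = x} = {}" for x
    unfolding U by auto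
  then have sum: "\<forall>x<n. q x + (\<Sum>s | s < n \<and> s \<notin> set (xs @ ys) \<and> al s = x. 1 - q s) = q0 x"
    using assms(5) by (simp only: sum.empty) simp
  have "\<forall>s\<in>set (xs @ ys). al s = s" "set (xs @ ys) \<subseteq> {..<n}"
    unfolding U using assms(6) by auto
  moreover have "\<forall>s<n. al s < n \<and> 0 \<le> q s"
    using assms(4-6) by simp
  moreover have "\<forall>s<n. s \<notin> set ys \<longrightarrow> q s \<le> 1" "\<forall>s\<in>set xs. q s < 1" "\<forall>s\<in>set ys. 1 \<le> q s"
    unfolding assms(2,3) using assms(5) by auto
  ultimately show ?thesis
    unfolding alias_inv_def using assms(1) sum by blast
qed

text \<open>The small cell \<open>s\<close> is filled up by the large point \<open>l\<close>, which
  donates \<open>1 - q s\<close> and becomes the alias of \<open>s\<close>. The balance of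
  \<open>l\<close> is kept, because its open weight loses exactly what the newly closed cell adds to
  its sum; all other balances are untouched. Then \<open>l\<close> stays open, on the stack that
  fits its reduced weight.\<close>

lemma alias_inv_step:
  assumes inv: "alias_inv n q0 q al (xs @ [s]) (ys @ [l])"
  defines "q' \<equiv> q(l := q l - (1 - q s))" and "al' \<equiv> al(s := l)"
  shows "q' l < 1 \<Longrightarrow> alias_inv n q0 q' al' (xs @ [l]) ys"
    and "1 \<le> q' l \<Longrightarrow> alias_inv n q0 q' al' xs (ys @ [l])"
proof -
  define R where "R = set xs \<union> set ys"
  have i: "distinct (xs @ s # ys @ [l])" "R \<subseteq> {..<n}" "s < n" "l < n"
     "\<And>x. x < n \<Longrightarrow> al x < n" "\<And>x. x < n \<Longrightarrow> 0 \<le> q x" "\<And>x. x \<in> R \<Longrightarrow> al x = x" "al s = s" "al l = l"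
     "\<And>x. x < n \<Longrightarrow> x \<notin> set ys \<Longrightarrow> x \<noteq> l \<Longrightarrow> q x \<le> 1" "\<And>x. x \<in> set xs \<Longrightarrow> q x < 1" "q s < 1"
     "\<And>x. x \<in> set ys \<Longrightarrow> 1 \<le> q x" "1 \<le> q l"
     "\<And>x. x < n \<Longrightarrow> q x + (\<Sum>t | t < n \<and> t \<notin> R \<union> {s,l} \<and> al t = x. 1 - q t) = q0 x"
    using inv unfolding alias_inv_def R_def by (auto simp: Un_assoc Un_left_commute insert_commute)
  have sl: "s \<noteq> l" "s \<notin> R" "l \<notin> R"
    using i(1) by (auto simp: R_def)
  have sum': "q' x + (\<Sum>t | t < n \<and> t \<notin> R \<union> {l} \<and> al' t = x. 1 - q' t) = q0 x" if x: "x < n" for x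
  proof -
    let ?A = "{t. t < n \<and> t \<notin> R \<union> {s,l} \<and> al t = x}"
    have A: "(\<Sum>t\<in>?A. 1 - q' t) = (\<Sum>t\<in>?A. 1 - q t)"
      by (rule sum.cong) (auto simp: q'_def)
    have "{t. t < n \<and> t \<notin> R \<union> {l} \<and> al' t = x} = (if x = l then insert s ?A else ?A)"
      using sl i(3,8) by (auto simp: al'_def)
    then have "(\<Sum>t | t < n \<and> t \<notin> R \<union> {l} \<and> al' t = x. 1 - q' t) =
       (\<Sum>t\<in>?A. 1 - q t) + (if x = l then 1 - q s else 0)"
      using A sl by (auto simp: q'_def)
    then show ?thesis
      using i(15)[OF x] by (auto simp: q'_def)
  qed
  \<comment> \<open>As \<open>q l\<close> is at least 1, at least \<open>q s\<close> is left after
    the donation.\<close>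
  have q'l: "0 \<le> q' l"
    using i(6)[OF i(3)] i(14) by (simp add: q'_def)
  have com: "distinct (xs @ ys @ [l])" "\<And>x. x < n \<Longrightarrow> al' x < n" "\<And>x. x < n \<Longrightarrow> 0 \<le> q' x"
     "\<And>x. x \<in> R \<union> {l} \<Longrightarrow> al' x = x" "\<And>x. x < n \<Longrightarrow> x \<notin> set ys \<Longrightarrow> x \<noteq> l \<Longrightarrow> q' x \<le> 1"
     "\<And>x. x \<in> set xs \<Longrightarrow> q' x < 1" "\<And>x. x \<in> set ys \<Longrightarrow> 1 \<le> q' x"
    using i sl q'l by (auto simp: al'_def q'_def R_def)
  have U: "set (xs @ [l] @ ys) = R \<union> {l}" "set (xs @ ys @ [l]) = R \<union> {l}" "R \<union> {l} \<subseteq> {..<n}"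
    using i(2,4) by (auto simp: R_def)
  show "alias_inv n q0 q' al' (xs @ [l]) ys" if "q' l < 1"
  proof -
    have "q' x \<le> 1" if "x < n" "x \<notin> set ys" for x
      using com(5)[OF that] \<open>q' l < 1\<close> by (cases "x = l") auto
    then show ?thesis
      unfolding alias_inv_def append_assoc U using com U(3) that sum' by (auto simp: R_def)
  qed
  show "alias_inv n q0 q' al' xs (ys @ [l])" if "1 \<le> q' l"
    unfolding alias_inv_def U using com U(3) that sum' by (auto simp: R_def)
qed

text \<open>The open cells have average weight 1, so if all of them are small or all are large
  then each has weight exactly 1.\<close>

lemma alias_inv_final:
  assumes inv: "alias_inv n q0 q al xs ys" and e: "xs = [] \<or> ys = []"
    and sum: "(\<Sum>x<n. q0 x) = real n"
  shows "alias_table n q0 q al"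
proof -
  define R where "R = set (xs @ ys)"
  have i: "R \<subseteq> {..<n}" "\<And>x. x < n \<Longrightarrow> al x < n \<and> 0 \<le> q x" "\<And>x. x \<in> R \<Longrightarrow> al x = x"
    "\<And>x. x < n \<Longrightarrow> x \<notin> set ys \<Longrightarrow> q x \<le> 1" "\<And>x. x \<in> set xs \<Longrightarrow> q x < 1" "\<And>x. x \<in> set ys \<Longrightarrow> 1 \<le> q x"
    "\<And>x. x < n \<Longrightarrow> q x + (\<Sum>t | t < n \<and> t \<notin> R \<and> al t = x. 1 - q t) = q0 x"
    using inv unfolding alias_inv_def R_def by auto
  have finR: "finite R"
    by (simp add: R_def)
  \<comment> \<open>Every closed cell has exactly one alias, so summing the donations over all
    donors counts each closed cell once.\<close>
  have "(\<Sum>x<n. \<Sum>t | t < n \<and> t \<notin> R \<and> al t = x. 1 - q t) = (\<Sum>t\<in>{..<n} - R. 1 - q t)"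
  proof -
    have "(\<Sum>x<n. \<Sum>t | t \<in> {..<n} - R \<and> al t = x. 1 - q t) = (\<Sum>t\<in>{..<n} - R. 1 - q t)"
      using i(2) by (intro sum.group) auto
    then show ?thesis
      by simp
  qed
  moreover have "(\<Sum>x<n. q x + (\<Sum>t | t < n \<and> t \<notin> R \<and> al t = x. 1 - q t)) = real n"
    using sum i(7) by simp
  ultimately have "(\<Sum>x<n. q x) + (\<Sum>t\<in>{..<n} - R. 1 - q t) = real n"
    by (simp add: sum.distrib)
  moreover have "(\<Sum>x<n. q x) = (\<Sum>x\<in>R. q x) + (\<Sum>x\<in>{..<n} - R. q x)"
    using i(1) by (metis add.commute finite_lessThan sum.subset_diff)
  moreover have "real n = (\<Sum>x\<in>R. 1) + (\<Sum>x\<in>{..<n} - R. 1)"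
    using sum.subset_diff[OF i(1), of "\<lambda>_. 1::real"] by simp
  \<comment> \<open>In the closed cells \<open>q t\<close> and \<open>1 - q t\<close> add up to 1,
    so the open cells carry a total weight equal to their number.\<close>
  ultimately have s0: "(\<Sum>x\<in>R. q x - 1) = 0"
    by (simp add: sum_subtractf)
  have one: "q x = 1" if "x \<in> R" for x
    using e
  proof
    assume xs: "xs = []"
    then have "\<And>x. x \<in> R \<Longrightarrow> 0 \<le> q x - 1"
      using i(6) by (auto simp: R_def)
    then show ?thesis
      using s0 finR that by (auto simp: sum_nonneg_eq_0_iff)
  next
    assume ys: "ys = []"
    then have "\<And>x. x \<in> R \<Longrightarrow> 0 \<le> 1 - q x"
      using i(5) by (force simp: R_def)
    moreover have "(\<Sum>x\<in>R. 1 - q x) = 0"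
      using s0 by (simp add: sum_subtractf)
    ultimately show ?thesis
      using finR that by (auto simp: sum_nonneg_eq_0_iff)
  qed
  \<comment> \<open>Open cells now satisfy \<open>1 - q t = 0\<close>, so they may rejoin the
    sum.\<close>
  have "(\<Sum>t | t < n \<and> al t = x. 1 - q t) = (\<Sum>t | t < n \<and> t \<notin> R \<and> al t = x. 1 - q t)" for x
    by (rule sum.mono_neutral_right) (auto simp: one)
  moreover have "q x \<le> 1" if "x < n" for x
    using i(4)[OF that] one[of x] by (cases "x \<in> set ys") (auto simp: R_def)
  ultimately show ?thesis
    unfolding alias_table_def using i(2,7) by auto
qed

section \<open>The vectors of a weight\<close>

text \<open>The three definitions read off the mixed-radix digits of
  \<open>k = (l - 1) * d\<^sup>2 + b * d + a\<close>, where column-major storage makes the row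
  \<open>a\<close> the least significant digit. Layers count from 1, hence
  \<open>Suc\<close>.\<close>

definition weight_layer :: "'y network \<Rightarrow> nat \<Rightarrow> nat" where
  "weight_layer S k = Suc (k div (width S)\<^sup>2)"

definition weight_row :: "'y network \<Rightarrow> nat \<Rightarrow> nat" where
  "weight_row S k = k mod width S"

definition weight_col :: "'y network \<Rightarrow> nat \<Rightarrow> nat" where
  "weight_col S k = k mod (width S)\<^sup>2 div width S"

text \<open>Uniqueness of the digits. It serves in both directions: to recognise the matrix entry
  that a given weight occupies, and to find the digits of an index assembled by the program.\<close>

lemma weight_index_unique:
  assumes "p < d" "q < (d::nat)"
  shows "l * d\<^sup>2 + q * d + p = k \<longleftrightarrow> l = k div d\<^sup>2 \<and> q = k mod d\<^sup>2 div d \<and> p = k mod d"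
proof
  have lt: "q * d + p < d\<^sup>2"
  proof -
    have "q * d + p < Suc q * d"
      using assms(1) by simp
    also have "\<dots> \<le> d * d"
      using assms(2) by (intro mult_right_mono) auto
    finally show ?thesis
      by (simp add: power2_eq_square)
  qed
  assume k: "l * d\<^sup>2 + q * d + p = k"
  have k': "k = (q * d + p) + l * d\<^sup>2"
    using k by simp
  have "k div d\<^sup>2 = l" "k mod d\<^sup>2 = q * d + p"
    unfolding k' using lt assms by simp_all
  moreover have "k mod d = p"
    using assms(1) unfolding k' power2_eq_square
    by (metis add.commute mod_less mod_mult_self3 mult.assoc)
  moreover have "(q * d + p) div d = q"
    using assms by simp
  ultimately show "l = k div d\<^sup>2 \<and> q = k mod d\<^sup>2 div d \<and> p = k mod d"
    by simp
next
  assume A: "l = k div d\<^sup>2 \<and> q = k mod d\<^sup>2 div d \<and> p = k mod d"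
  have "k mod d = k mod d\<^sup>2 mod d"
    by (simp add: mod_mod_cancel power2_eq_square)
  then have "q * d + p = k mod d\<^sup>2"
    using A by (metis div_mult_mod_eq)
  then show "l * d\<^sup>2 + q * d + p = k"
    using A by (metis add.assoc div_mult_mod_eq)
qed

lemma weight_index:
  assumes "1 \<le> width S"
  shows "(weight_layer S k - 1) * (width S)\<^sup>2 + weight_col S k * width S + weight_row S k = k"
proof -
  have "weight_col S k < width S"
    using assms unfolding weight_col_def
    by (metis One_nat_def Suc_le_eq less_mult_imp_div_less mod_less_divisor power2_eq_square zero_less_power)
  moreover have "weight_row S k < width S"
    using assms unfolding weight_row_def by simp
  ultimately show ?thesis
    by (subst weight_index_unique) (auto simp: weight_layer_def weight_col_def weight_row_def)
qed

lemma weight_row_less: "1 \<le> width S \<Longrightarrow> weight_row S k < width S"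
  by (simp add: weight_row_def)

lemma weight_col_less: "1 \<le> width S \<Longrightarrow> weight_col S k < width S"
  unfolding weight_col_def
  by (metis One_nat_def Suc_le_eq less_mult_imp_div_less mod_less_divisor power2_eq_square zero_less_power)

lemma weight_layer_le:
  assumes "k < num_weights S"
  shows "1 \<le> weight_layer S k" "weight_layer S k \<le> depth S"
  using assms less_mult_imp_div_less[of k "depth S" "(width S)\<^sup>2"]
  by (auto simp: weight_layer_def num_weights_def mult.commute Suc_le_eq)

section \<open>The forward pass under a perturbation of one weight\<close>

lemma mult_mat_vec_sum:
  assumes "A \<in> carrier_mat m d" "v \<in> carrier_vec d" "p < m"
  shows "(A *\<^sub>v v) $ p = (\<Sum>q<d. A $$ (p, q) * v $ q)"
  using assms by (auto simp: scalar_prod_def atLeast0LessThan intro!: sum.cong)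

lemma gnh_settingD:
  assumes "gnh_setting S"
  shows "1 \<le> width S" "1 \<le> depth S" "1 \<le> ndata S" "\<And>u. act S field_differentiable (at u)"
    "weights S \<in> carrier_vec (num_weights S)"
    "\<And>i. i < ndata S \<Longrightarrow> input S i \<in> carrier_vec (width S)"
    "\<And>i. i < ndata S \<Longrightarrow> factor S i \<in> carrier_mat (width S) (width S)"
    "\<And>i. i < ndata S \<Longrightarrow> Q_mat S i = transpose_mat (factor S i) * factor S i"
  using assms unfolding gnh_setting_def by auto

lemma weight_mat_carrier [simp]: "weight_mat d w l \<in> carrier_mat d d"
  by (simp add: weight_mat_def)

lemma M_mat_carrier [simp]: "M_mat S i l \<in> carrier_mat (width S) (width S)"
  by (simp add: M_mat_def)

lemma forward_carrier:
  assumes "input S i \<in> carrier_vec (width S)"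
  shows "forward S w i l \<in> carrier_vec (width S)"
proof (cases l)
  case 0
  then show ?thesis using assms by simp
next
  case (Suc l')
  have "dim_row (weight_mat (width S) w l) = width S"
    by (simp add: weight_mat_def)
  then show ?thesis
    using Suc by (intro carrier_vecI) simp
qed

lemma C_back_carrier:
  assumes "factor S i \<in> carrier_mat (width S) (width S)"
  shows "C_back S i j \<in> carrier_mat (width S) (width S)"
  using assms by (induction j) (auto intro!: mult_carrier_mat[of _ _ "width S"])

lemma M_mat_mult_vec:
  assumes "y \<in> carrier_vec (width S)" "p < width S"
  shows "(M_mat S i l *\<^sub>v y) $ p =
    deriv (act S) ((W_mat S l *\<^sub>v x_vec S i (l - 1)) $ p) * y $ p"
proof -
  have "(M_mat S i l *\<^sub>v y) $ p = (\<Sum>q<width S. M_mat S i l $$ (p, q) * y $ q)"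
    using assms by (intro mult_mat_vec_sum) auto
  also have "\<dots> = (\<Sum>q<width S. if q = p then
      deriv (act S) ((W_mat S l *\<^sub>v x_vec S i (l - 1)) $ p) * y $ q else 0)"
    using assms by (intro sum.cong) (auto simp: M_mat_def mat_diag_def)
  finally show ?thesis
    using assms by simp
qed

lemma weight_mat_shift:
  assumes "weights S \<in> carrier_vec (num_weights S)" "l < depth S" "p < width S" "q < width S"
  shows "weight_mat (width S) (shift (weights S) k t) (Suc l) $$ (p, q) = W_mat S (Suc l) $$ (p, q) +
    (if Suc l = weight_layer S k \<and> p = weight_row S k \<and> q = weight_col S k then t else 0)"
proof -
  let ?j = "l * (width S)\<^sup>2 + q * width S + p"
  have "?j < num_weights S"
  proof -
    have "q * width S + p < Suc q * width S"
      using assms by simp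
    also have "\<dots> \<le> width S * width S"
      using assms by (intro mult_right_mono) auto
    finally have "?j < Suc l * (width S)\<^sup>2"
      by (simp add: power2_eq_square)
    also have "\<dots> \<le> depth S * (width S)\<^sup>2"
      using assms by (intro mult_right_mono) auto
    finally show ?thesis
      by (simp add: num_weights_def mult.commute)
  qed
  then have "shift (weights S) k t $ ?j = weights S $ ?j + (if ?j = k then t else 0)"
    using assms(1) by (auto simp: shift_def unit_vec_def)
  then show ?thesis
    using assms weight_index_unique[OF assms(3,4), of l k]
    by (auto simp: weight_mat_def weight_layer_def weight_row_def weight_col_def)
qed

text \<open>\<open>tangent S k i m\<close> is the derivative with respect to weight \<open>k\<close> of the preactivations
  of the layer \<open>m\<close> steps above the one containing that weight.\<close>

primrec tangent :: "'y network \<Rightarrow> nat \<Rightarrow> nat \<Rightarrow> nat \<Rightarrow> real vec" where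
  "tangent S k i 0 =
     x_vec S i (weight_layer S k - 1) $ weight_col S k \<cdot>\<^sub>v unit_vec (width S) (weight_row S k)"
| "tangent S k i (Suc m) = W_mat S (Suc (weight_layer S k + m)) *\<^sub>v
     (M_mat S i (weight_layer S k + m) *\<^sub>v tangent S k i m)"

lemma tangent_carrier [simp]: "tangent S k i m \<in> carrier_vec (width S)"
  by (induction m) (auto intro!: mult_mat_vec_carrier[of _ _ "width S"])

lemma forward_below:
  assumes S: "gnh_setting S" and i: "i < ndata S" and k: "k < num_weights S"
    and l: "l < weight_layer S k"
  shows "forward S (shift (weights S) k t) i l = x_vec S i l"
  using l
proof (induction l)
  case 0
  then show ?case by simp
next
  case (Suc l)
  have "weight_mat (width S) (shift (weights S) k t) (Suc l) = W_mat S (Suc l)"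
    using Suc.prems weight_layer_le[OF k] weight_mat_shift[OF gnh_settingD(5)[OF S], of l]
    by (intro eq_matI) (auto simp: weight_mat_def)
  then show ?case
    using Suc by simp
qed

lemma forward_index:
  assumes "input S i \<in> carrier_vec (width S)" "p < width S"
  shows "forward S w i (Suc l) $ p =
    act S (\<Sum>q<width S. weight_mat (width S) w (Suc l) $$ (p, q) * forward S w i l $ q)"
proof -
  have "dim_row (weight_mat (width S) w (Suc l)) = width S"
    by (simp add: weight_mat_def)
  then show ?thesis
    using assms mult_mat_vec_sum[OF weight_mat_carrier forward_carrier[OF assms(1)] assms(2)] by simp
qed

lemma act_chain:
  assumes "gnh_setting S" "(g has_field_derivative y $ p) (at 0)"
    "g 0 = (W_mat S l *\<^sub>v x_vec S i (l - 1)) $ p" "y \<in> carrier_vec (width S)" "p < width S"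
  shows "((\<lambda>t. act S (g t)) has_field_derivative (M_mat S i l *\<^sub>v y) $ p) (at 0)"
proof -
  have "(act S has_field_derivative deriv (act S) (g 0)) (at (g 0))"
    using gnh_settingD(4)[OF assms(1)] by (simp add: field_differentiable_derivI)
  then show ?thesis
    using DERIV_chain2[OF _ assms(2)] M_mat_mult_vec[OF assms(4,5)] assms(3) by metis
qed

lemma shift_0: "shift w k 0 = w"
  unfolding shift_def by (intro eq_vecI) auto

text \<open>Induction on the number of layers above the perturbed weight. Each layer is a linear map
  followed by the activation: the linear map carries the derivative along, and
  \<open>act_chain\<close> supplies the diagonal factor \<open>M_mat\<close>.\<close>

lemma forward_derivative:
  assumes S: "gnh_setting S" and i: "i < ndata S" and k: "k < num_weights S"
    and l: "weight_layer S k + m \<le> depth S" and p: "p < width S"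
  shows "((\<lambda>t. forward S (shift (weights S) k t) i (weight_layer S k + m) $ p)
    has_field_derivative (M_mat S i (weight_layer S k + m) *\<^sub>v tangent S k i m) $ p) (at 0)"
  using l p
proof (induction m arbitrary: p)
  case 0
  note D = gnh_settingD[OF S]
  obtain l where l: "weight_layer S k = Suc l" "l < depth S"
    using weight_layer_le[OF k] by (cases "weight_layer S k") auto
  have lt: "l < weight_layer S k"
    using l(1) by simp
  let ?x = "x_vec S i l" and ?W = "\<lambda>t. weight_mat (width S) (shift (weights S) k t) (Suc l)"
  let ?g = "\<lambda>t. \<Sum>q<width S. ?W t $$ (p, q) * ?x $ q"
  have F: "forward S (shift (weights S) k t) i (Suc l) $ p = act S (?g t)" for t
    unfolding forward_index[OF D(6)[OF i] 0(2)] forward_below[OF S i k lt] ..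
  \<comment> \<open>The input of this layer does not depend on \<open>t\<close>, so its
    preactivation is affine in \<open>t\<close> with the initial tangent as slope.\<close>
  have "?g = (\<lambda>t. (\<Sum>q<width S. W_mat S (Suc l) $$ (p, q) * ?x $ q) + t * tangent S k i 0 $ p)"
  proof
    fix t
    have "?W t $$ (p, q) * ?x $ q = W_mat S (Suc l) $$ (p, q) * ?x $ q +
       (if q = weight_col S k then (if p = weight_row S k then t * ?x $ q else 0) else 0)"
      if q: "q < width S" for q
      unfolding weight_mat_shift[OF D(5) l(2) 0(2) q] l(1) by (simp add: algebra_simps)
    then have "?g t = (\<Sum>q<width S. W_mat S (Suc l) $$ (p, q) * ?x $ q +
       (if q = weight_col S k then (if p = weight_row S k then t * ?x $ q else 0) else 0))"
      by (intro sum.cong) auto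
    also have "\<dots> = (\<Sum>q<width S. W_mat S (Suc l) $$ (p, q) * ?x $ q) +
       (if p = weight_row S k then t * ?x $ weight_col S k else 0)"
      using weight_col_less[OF D(1), of k] by (simp add: sum.distrib)
    also have "(if p = weight_row S k then t * ?x $ weight_col S k else 0) = t * tangent S k i 0 $ p"
      using 0(2) by (auto simp: unit_vec_def l(1))
    finally show "?g t = (\<Sum>q<width S. W_mat S (Suc l) $$ (p, q) * ?x $ q) + t * tangent S k i 0 $ p" .
  qed
  then have "(?g has_field_derivative tangent S k i 0 $ p) (at 0)"
    by (auto intro!: derivative_eq_intros)
  moreover have "?g 0 = (W_mat S (Suc l) *\<^sub>v x_vec S i (Suc l - 1)) $ p"
    using mult_mat_vec_sum[OF weight_mat_carrier forward_carrier[OF D(6)[OF i]] 0(2)]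
    by (simp add: shift_0)
  ultimately have "((\<lambda>t. act S (?g t)) has_field_derivative
      (M_mat S i (Suc l) *\<^sub>v tangent S k i 0) $ p) (at 0)"
    using 0(2) by (intro act_chain[OF S]) auto
  then show ?case
    unfolding F[symmetric] by (simp only: l(1) add_0_right)
next
  case (Suc m)
  note D = gnh_settingD[OF S]
  let ?l = "weight_layer S k + m"
  let ?F = "\<lambda>t. forward S (shift (weights S) k t) i"
  let ?g = "\<lambda>t. \<Sum>q<width S. weight_mat (width S) (shift (weights S) k t) (Suc ?l) $$ (p, q) * ?F t ?l $ q"
  have F: "?F t (Suc ?l) $ p = act S (?g t)" for t
    using forward_index[OF D(6)[OF i] Suc.prems(2)] .
  \<comment> \<open>The weight lies in a lower layer, so the matrix of this layer is the unperturbed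
    one.\<close>
  have "?g t = (\<Sum>q<width S. W_mat S (Suc ?l) $$ (p, q) * ?F t ?l $ q)" for t
    using Suc.prems by (intro sum.cong refl) (auto simp: weight_mat_shift[OF D(5)])
  moreover have "((\<lambda>t. \<Sum>q<width S. W_mat S (Suc ?l) $$ (p, q) * ?F t ?l $ q)
      has_field_derivative (\<Sum>q<width S. W_mat S (Suc ?l) $$ (p, q) *
        (M_mat S i ?l *\<^sub>v tangent S k i m) $ q)) (at 0)"
    using Suc.prems by (intro DERIV_sum DERIV_cmult Suc.IH) auto
  moreover have "(\<Sum>q<width S. W_mat S (Suc ?l) $$ (p, q) * (M_mat S i ?l *\<^sub>v tangent S k i m) $ q) =
      tangent S k i (Suc m) $ p"
    unfolding tangent.simps
    by (rule mult_mat_vec_sum[symmetric, OF weight_mat_carrier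
          mult_mat_vec_carrier[OF M_mat_carrier tangent_carrier] Suc.prems(2)])
  ultimately have "(?g has_field_derivative tangent S k i (Suc m) $ p) (at 0)"
    by simp
  moreover have "?g 0 = (W_mat S (Suc ?l) *\<^sub>v x_vec S i ?l) $ p"
    using mult_mat_vec_sum[OF weight_mat_carrier forward_carrier[OF D(6)[OF i]] Suc.prems(2)]
    by (simp add: shift_0)
  ultimately have "((\<lambda>t. act S (?g t)) has_field_derivative
      (M_mat S i (Suc ?l) *\<^sub>v tangent S k i (Suc m)) $ p) (at 0)"
    using Suc.prems tangent_carrier[of S k i "Suc m"] by (intro act_chain[OF S]) auto
  then show ?case
    using F by simp
qed

section \<open>Columns of the Jacobian and the precomputed matrices\<close>

lemma J_mat_carrier [simp]: "J_mat S i \<in> carrier_mat (width S) (num_weights S)"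
  by (simp add: J_mat_def)

lemma col_J_mat:
  assumes S: "gnh_setting S" and i: "i < ndata S" and k: "k < num_weights S"
  shows "col (J_mat S i) k = M_mat S i (depth S) *\<^sub>v tangent S k i (depth S - weight_layer S k)"
proof (rule eq_vecI)
  have M: "dim_row (M_mat S i (depth S)) = width S"
    using M_mat_carrier by (rule carrier_matD(1))
  then show "dim_vec (col (J_mat S i) k) =
      dim_vec (M_mat S i (depth S) *\<^sub>v tangent S k i (depth S - weight_layer S k))"
    by (simp add: J_mat_def)
  fix p assume "p < dim_vec (M_mat S i (depth S) *\<^sub>v tangent S k i (depth S - weight_layer S k))"
  then have p: "p < width S"
    using M by simp
  show "col (J_mat S i) k $ p =
      (M_mat S i (depth S) *\<^sub>v tangent S k i (depth S - weight_layer S k)) $ p"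
    using forward_derivative[OF S i k _ p, of "depth S - weight_layer S k"] weight_layer_le[OF k] p k
    by (auto simp: J_mat_def partial_deriv_def intro!: DERIV_imp_deriv)
qed

lemma mat_mult_unit_vec:
  fixes A :: "real mat"
  assumes "A \<in> carrier_mat m n" "k < n"
  shows "A *\<^sub>v unit_vec n k = col A k"
  using assms by (intro eq_vecI) auto

text \<open>The product of \<open>C_back S i j\<close> with the tangent at layer
  \<open>depth S - j\<close> is the same for all j, since going down one layer merely moves the
  factors \<open>W_mat\<close> and \<open>M_mat\<close> from the tangent to the matrix. At j = 0 it
  is \<open>R\<^sub>i J\<^sub>i e\<^sub>k\<close>, with the whole derivative in the tangent; at the
  layer of the weight the matrix has absorbed everything.\<close>

lemma v_part_eq:
  assumes S: "gnh_setting S" and i: "i < ndata S" and k: "k < num_weights S"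
  shows "v_part S k i = x_vec S i (weight_layer S k - 1) $ weight_col S k \<cdot>\<^sub>v
    col (C_mat S i (weight_layer S k)) (weight_row S k)"
proof -
  note D = gnh_settingD[OF S]
  note R = D(7)[OF i]
  let ?l = "weight_layer S k" and ?d = "width S"
  have l: "1 \<le> ?l" "?l \<le> depth S"
    using weight_layer_le[OF k] .
  have "C_back S i j *\<^sub>v tangent S k i (depth S - j - ?l) = v_part S k i" if "j \<le> depth S - ?l" for j
    using that
  proof (induction j)
    case 0
    have "v_part S k i = factor S i *\<^sub>v (M_mat S i (depth S) *\<^sub>v tangent S k i (depth S - ?l))"
      unfolding v_part_def mat_mult_unit_vec[OF J_mat_carrier k] col_J_mat[OF S i k] ..
    then show ?case
      using assoc_mult_mat_vec[OF R M_mat_carrier tangent_carrier] by simp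
  next
    case (Suc j)
    let ?m = "depth S - Suc j - ?l"
    have m: "depth S - j - ?l = Suc ?m" "?l + ?m = depth S - Suc j" "Suc (?l + ?m) = depth S - j"
      using Suc.prems l by auto
    have C: "C_back S i j \<in> carrier_mat ?d ?d"
      using C_back_carrier[OF R] .
    have "C_back S i (Suc j) *\<^sub>v tangent S k i ?m =
        (C_back S i j * W_mat S (depth S - j)) *\<^sub>v (M_mat S i (depth S - Suc j) *\<^sub>v tangent S k i ?m)"
      using C by (simp add: assoc_mult_mat_vec[of _ ?d ?d _ ?d])
    also have "\<dots> = C_back S i j *\<^sub>v (W_mat S (depth S - j) *\<^sub>v
        (M_mat S i (depth S - Suc j) *\<^sub>v tangent S k i ?m))"
      using C by (intro assoc_mult_mat_vec[of _ ?d ?d _ ?d] mult_mat_vec_carrier[of _ _ ?d]) auto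
    also have "\<dots> = C_back S i j *\<^sub>v tangent S k i (depth S - j - ?l)"
      unfolding m(1) tangent.simps m(3) unfolding m(2) ..
    finally show ?case
      using Suc by simp
  qed
  \<comment> \<open>The initial tangent is a multiple of a unit vector, which picks out one column
    of the matrix.\<close>
  from this[of "depth S - ?l"] have "v_part S k i = C_mat S i ?l *\<^sub>v tangent S k i 0"
    using l by (simp add: C_mat_def)
  moreover have C: "C_mat S i ?l \<in> carrier_mat ?d ?d"
    unfolding C_mat_def using C_back_carrier[OF R] .
  ultimately show ?thesis
    using mult_mat_vec[OF C unit_vec_carrier] mat_mult_unit_vec[OF C weight_row_less[OF D(1)]] by simp
qed

lemma C_mat_carrier:
  assumes "gnh_setting S" "i < ndata S"
  shows "C_mat S i l \<in> carrier_mat (width S) (width S)"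
  unfolding C_mat_def using C_back_carrier gnh_settingD(7)[OF assms] by blast

lemma v_part_carrier:
  assumes "gnh_setting S" "i < ndata S"
  shows "v_part S k i \<in> carrier_vec (width S)"
  unfolding v_part_def
  by (intro mult_mat_vec_carrier[OF gnh_settingD(7)[OF assms]] mult_mat_vec_carrier[OF J_mat_carrier]) simp

lemma v_part_index:
  assumes S: "gnh_setting S" and i: "i < ndata S" and k: "k < num_weights S" and p: "p < width S"
  shows "v_part S k i $ p = x_vec S i (weight_layer S k - 1) $ weight_col S k *
    C_mat S i (weight_layer S k) $$ (p, weight_row S k)"
  unfolding v_part_eq[OF S i k]
  using carrier_matD[OF C_mat_carrier[OF S i]] p weight_row_less[OF gnh_settingD(1)[OF S]] by simp

section \<open>Inner products, norms and entries of the Hessian\<close>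

lemma scalar_prod_sum:
  assumes "v \<in> carrier_vec d" "w \<in> carrier_vec d"
  shows "v \<bullet> w = (\<Sum>p<d. v $ p * w $ p)"
  using assms by (auto simp: scalar_prod_def atLeast0LessThan)

text \<open>This is the formula evaluated by both programs: two stored entries of x and one sum of d
  products of stored entries of C.\<close>

lemma v_part_scalar_prod:
  assumes S: "gnh_setting S" and i: "i < ndata S" and k: "k < num_weights S" "m < num_weights S"
  shows "v_part S k i \<bullet> v_part S m i =
    x_vec S i (weight_layer S k - 1) $ weight_col S k * x_vec S i (weight_layer S m - 1) $ weight_col S m *
    (\<Sum>p<width S. C_mat S i (weight_layer S k) $$ (p, weight_row S k) *
      C_mat S i (weight_layer S m) $$ (p, weight_row S m))"
  unfolding scalar_prod_sum[OF v_part_carrier[OF S i] v_part_carrier[OF S i]] sum_distrib_left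
  by (intro sum.cong refl) (simp add: v_part_index[OF S i] k)

lemma norm_vec_nonneg [simp]: "0 \<le> norm_vec v"
  by (auto simp: norm_vec_def scalar_prod_def intro: sum_nonneg)

lemma norm_vec_L2_set:
  assumes "v \<in> carrier_vec d"
  shows "norm_vec v = L2_set (\<lambda>p. v $ p) {..<d}"
  unfolding norm_vec_def L2_set_def scalar_prod_sum[OF assms assms] by (simp add: power2_eq_square)

lemma scalar_prod_le_norm_vec:
  assumes "v \<in> carrier_vec d" "w \<in> carrier_vec d"
  shows "\<bar>v \<bullet> w\<bar> \<le> norm_vec v * norm_vec w"
proof -
  have "\<bar>v \<bullet> w\<bar> \<le> (\<Sum>p<d. \<bar>v $ p\<bar> * \<bar>w $ p\<bar>)"
    unfolding scalar_prod_sum[OF assms] by (rule sum_abs[THEN order_trans]) (simp add: abs_mult)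
  also have "\<dots> \<le> norm_vec v * norm_vec w"
    unfolding assms[THEN norm_vec_L2_set] by (rule L2_set_mult_ineq)
  finally show ?thesis .
qed

lemma norm_vec_v_vec:
  assumes S: "gnh_setting S"
  shows "norm_vec (v_vec S k) = L2_set (\<lambda>i. norm_vec (v_part S k i)) {..<ndata S}"
proof -
  let ?d = "width S"
  have "v_vec S k \<bullet> v_vec S k = (\<Sum>p<ndata S * ?d. (v_vec S k $ p)\<^sup>2)"
    by (subst scalar_prod_sum[where d = "ndata S * ?d"])
      (auto simp: v_vec_def mult.commute power2_eq_square)
  also have "\<dots> = (\<Sum>i<ndata S. \<Sum>p\<in>{i * ?d..<i * ?d + ?d}. (v_vec S k $ p)\<^sup>2)"
    by (rule sum.nat_group[symmetric])
  also have "\<dots> = (\<Sum>i<ndata S. (norm_vec (v_part S k i))\<^sup>2)"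
  proof (rule sum.cong[OF refl])
    fix i assume "i \<in> {..<ndata S}"
    then have i: "i < ndata S" by simp
    have "(\<Sum>p\<in>{i * ?d..<i * ?d + ?d}. (v_vec S k $ p)\<^sup>2) = (\<Sum>q<?d. (v_vec S k $ (i * ?d + q))\<^sup>2)"
      by (rule sum.reindex_bij_witness[of _ "\<lambda>q. i * ?d + q" "\<lambda>p. p - i * ?d"]) auto
    also have "\<dots> = (\<Sum>q<?d. v_part S k i $ q * v_part S k i $ q)"
    proof (rule sum.cong[OF refl])
      fix q assume "q \<in> {..<?d}"
      then have q: "q < ?d" by simp
      have "i * ?d + q < Suc i * ?d"
        using q by simp
      also have "\<dots> \<le> ndata S * ?d"
        using i by (intro mult_right_mono) auto
      finally have "v_vec S k $ (i * ?d + q) = v_part S k i $ q"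
        using q by (simp add: v_vec_def mult.commute)
      then show "(v_vec S k $ (i * ?d + q))\<^sup>2 = v_part S k i $ q * v_part S k i $ q"
        by (simp add: power2_eq_square)
    qed
    also have "\<dots> = v_part S k i \<bullet> v_part S k i"
      by (rule scalar_prod_sum[symmetric, OF v_part_carrier[OF S i] v_part_carrier[OF S i]])
    also have "\<dots> = (norm_vec (v_part S k i))\<^sup>2"
      by (simp add: norm_vec_def scalar_prod_def sum_nonneg)
    finally show "(\<Sum>p\<in>{i * ?d..<i * ?d + ?d}. (v_vec S k $ p)\<^sup>2) = (norm_vec (v_part S k i))\<^sup>2" .
  qed
  finally show ?thesis
    by (simp add: norm_vec_def[of "v_vec S k"] L2_set_def)
qed

text \<open>Cauchy-Schwarz over the data points. It passes from the constant that bounds the sampled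
  terms to the product of norms in the accuracy claims.\<close>

lemma sum_norm_vec_le:
  assumes "gnh_setting S"
  shows "(\<Sum>i<ndata S. norm_vec (v_part S k i) * norm_vec (v_part S m i)) \<le>
    norm_vec (v_vec S k) * norm_vec (v_vec S m)"
  using L2_set_mult_ineq[of "\<lambda>i. norm_vec (v_part S k i)" "\<lambda>i. norm_vec (v_part S m i)" "{..<ndata S}"]
  by (simp add: norm_vec_v_vec[OF assms])

text \<open>The factorization of \<open>Q\<^sub>i\<close> turns
  \<open>J\<^sub>i\<^sup>T Q\<^sub>i J\<^sub>i\<close> into the Gram matrix of the columns of
  \<open>R\<^sub>i J\<^sub>i\<close>. This ties the mean of the estimator to the Hessian as defined
  through derivatives of the loss.\<close>

lemma gauss_newton_hessian_entry:
  assumes S: "gnh_setting S" and k: "k < num_weights S" "m < num_weights S"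
  shows "gauss_newton_hessian S $$ (k, m) = (\<Sum>i<ndata S. v_part S k i \<bullet> v_part S m i)"
proof -
  have "(transpose_mat (J_mat S i) * Q_mat S i * J_mat S i) $$ (k, m) = v_part S k i \<bullet> v_part S m i"
    if i: "i < ndata S" for i
  proof -
    let ?J = "J_mat S i" and ?R = "factor S i" and ?d = "width S" and ?N = "num_weights S"
    have R: "?R \<in> carrier_mat ?d ?d"
      using gnh_settingD(7)[OF S i] .
    have v: "v_part S n i = col (?R * ?J) n" if "n < ?N" for n
      unfolding v_part_def mat_mult_unit_vec[OF J_mat_carrier that] using col_mult2[OF R J_mat_carrier that] ..
    have "transpose_mat ?J * Q_mat S i * ?J = transpose_mat ?J * (transpose_mat ?R * (?R * ?J))"
      unfolding gnh_settingD(8)[OF S i]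
      using R by (simp add: assoc_mult_mat[of _ _ ?d _ ?d _ ?N] assoc_mult_mat[of _ ?N ?d _ ?d _ ?N]
          assoc_mult_mat[of _ ?d ?d _ ?d _ ?N])
    also have "\<dots> = transpose_mat (?R * ?J) * (?R * ?J)"
      using R by (simp add: transpose_mult[OF R J_mat_carrier] assoc_mult_mat[of _ ?N ?d _ ?d _ ?N])
    finally show ?thesis
      using k R carrier_matD[OF J_mat_carrier[of S i]] by (simp add: v)
  qed
  then show ?thesis
    using k by (simp add: gauss_newton_hessian_def)
qed

section \<open>Accuracy of importance sampling\<close>

interpretation unit: prob_space "uniform_measure lborel {0..1::real}"
  by (intro prob_space_uniform_measure) auto

interpretation draws: prob_space draws
  unfolding draws_def by (intro prob_space_PiM unit.prob_space_axioms)

text \<open>One uniform number does double duty: the integer part of \<open>n * u\<close> selects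
  the cell, the fractional part decides between its two points. For n > 0 and u in [0,1] the default
  0 occurs only at u = 1; it keeps the sample below n without exception.\<close>

definition alias_sample :: "nat \<Rightarrow> (nat \<Rightarrow> real) \<Rightarrow> (nat \<Rightarrow> nat) \<Rightarrow> real \<Rightarrow> nat" where
  "alias_sample n q al u = (let s = to_index (real n * u) in
     if s < n then if real n * u - real s < q s then s else al s else 0)"

text \<open>Distinct coordinates of a product measure are independent, and so are functions of them.
  The offset \<open>u\<close> stands for the random numbers consumed before the program
  starts.\<close>

lemma indep_vars_draws:
  assumes "(g :: real \<Rightarrow> 'a) \<in> borel \<rightarrow>\<^sub>M N"
  shows "draws.indep_vars (\<lambda>_. N) (\<lambda>j \<omega>. g (\<omega> (u + j))) {..<c}"
\<comment> \<open>The characterisation of independence by product measures used below asks for a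
  nonempty index set.\<close>
proof (cases "c = 0")
  case True
  then show ?thesis
    unfolding draws.indep_vars_def draws.indep_sets_def by simp
next
  case False
  let ?U = "uniform_measure lborel {0..1::real}"
  have c: "{..<c} \<noteq> {}"
    using False by auto
  have "draws.indep_vars (\<lambda>_. ?U) (\<lambda>j \<omega>. \<omega> (u + j)) {..<c}"
  proof (subst draws.indep_vars_iff_distr_eq_PiM'[OF c])
    show "(\<lambda>\<omega>. \<omega> (u + j)) \<in> draws \<rightarrow>\<^sub>M ?U" for j
      unfolding draws_def by (rule measurable_component_singleton) simp
    have "distr draws (\<Pi>\<^sub>M i\<in>{..<c}. ?U) (\<lambda>x. \<lambda>i\<in>{..<c}. x (u + i)) = (\<Pi>\<^sub>M i\<in>{..<c}. ?U)"
      unfolding draws_def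
      by (rule distr_PiM_reindex[where f = "\<lambda>i. u + i"]) (auto intro: unit.prob_space_axioms)
    moreover have "distr draws ?U (\<lambda>x. x (u + i)) = ?U" for i
      unfolding draws_def
      by (rule distr_PiM_component) (auto intro: unit.prob_space_axioms)
    ultimately show "distr draws (\<Pi>\<^sub>M i\<in>{..<c}. ?U) (\<lambda>x. \<lambda>i\<in>{..<c}. x (u + i)) =
        (\<Pi>\<^sub>M i\<in>{..<c}. distr draws ?U (\<lambda>x. x (u + i)))"
      by simp
  qed
  moreover have "?U \<rightarrow>\<^sub>M N = borel \<rightarrow>\<^sub>M N"
    by (rule measurable_cong_sets) simp_all
  then have "g \<in> ?U \<rightarrow>\<^sub>M N"
    using assms by simp
  ultimately show ?thesis
    by (rule draws.indep_vars_compose2[where Y = "\<lambda>_. g"])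
qed

lemma measure_draws:
  assumes "(g :: real \<Rightarrow> 'a) \<in> borel \<rightarrow>\<^sub>M count_space A" "x \<in> A"
  shows "measure draws {\<omega> \<in> space draws. g (\<omega> j) = x} = measure (uniform_measure lborel {0..1}) {u. g u = x}"
proof -
  let ?U = "uniform_measure lborel {0..1::real}"
  have U: "distr draws ?U (\<lambda>\<omega>. \<omega> j) = ?U"
    unfolding draws_def by (rule distr_PiM_component) (auto intro: unit.prob_space_axioms)
  have "g -` {x} \<inter> space borel \<in> sets borel"
    using assms by (intro measurable_sets) auto
  then have "{u. g u = x} \<in> sets ?U"
    by (simp add: vimage_def)
  moreover have "(\<lambda>\<omega>. \<omega> j) \<in> draws \<rightarrow>\<^sub>M ?U"
    unfolding draws_def by (rule measurable_component_singleton) simp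
  ultimately have "measure (distr draws ?U (\<lambda>\<omega>. \<omega> j)) {u. g u = x} =
      measure draws ((\<lambda>\<omega>. \<omega> j) -` {u. g u = x} \<inter> space draws)"
    by (intro measure_distr)
  then show ?thesis
    unfolding U by (simp add: vimage_def Int_def conj_commute)
qed

lemma measure_unit_interval:
  assumes "0 \<le> a" "a \<le> b" "b \<le> 1"
  shows "measure (uniform_measure lborel {0..1}) {a..<b::real} = b - a"
proof -
  have "{0..1} \<inter> {a..<b} = {a..<b}"
    using assms by auto
  then show ?thesis
    using assms by (simp add: measure_uniform_measure)
qed

lemma alias_sample_less:
  assumes "alias_table n q0 q al" "0 < n"
  shows "alias_sample n q al u < n"
  using assms unfolding alias_sample_def alias_table_def Let_def by auto

lemma alias_sample_measurable:
  assumes "alias_table n q0 q al" "0 < n"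
  shows "alias_sample n q al \<in> borel \<rightarrow>\<^sub>M count_space {..<n}"
proof -
  have "alias_sample n q al \<in> borel \<rightarrow>\<^sub>M count_space UNIV"
    unfolding alias_sample_def to_index_def Let_def by measurable
  then have "alias_sample n q al -` {a} \<inter> space borel \<in> sets borel" for a
    by (rule measurable_sets) auto
  then show ?thesis
    using alias_sample_less[OF assms] by (subst measurable_count_space_eq2) auto
qed

text \<open>The unit interval is cut into 2n pieces, two for each cell: a left one of length
  \<open>q s / n\<close> leading to \<open>s\<close>, and a right one of length
  \<open>(1 - q s) / n\<close> leading to \<open>al s\<close>. Adding the lengths of the pieces that
  lead to \<open>x\<close> gives the balance of \<open>alias_table\<close>.\<close>

lemma measure_alias_sample:
  assumes tab: "alias_table n q0 q al" and x: "x < n"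
  shows "measure (uniform_measure lborel {0..1}) {u. alias_sample n q al u = x} = q0 x / real n"
proof -
  let ?U = "uniform_measure lborel {0..1::real}"
  have n: "0 < n"
    using x by simp
  have q: "\<And>s. s < n \<Longrightarrow> al s < n \<and> 0 \<le> q s \<and> q s \<le> 1"
    "q x + (\<Sum>s | s < n \<and> al s = x. 1 - q s) = q0 x"
    using tab x unfolding alias_table_def by auto
  define J where "J = (\<lambda>(s, b). if b then {real s / n..<(s + q s) / n} else {(s + q s) / n..<(real s + 1) / n})"
  define tgt where "tgt = (\<lambda>(s, b). if b then s else al s)"
  have J: "u \<in> J (s, b) \<longleftrightarrow> s = to_index (n * u) \<and> b = (n * u - s < q s)" if "s < n" "0 \<le> u" for u :: real and s b
  proof -
    have "s = to_index (n * u) \<longleftrightarrow> real s \<le> n * u \<and> n * u < real s + 1"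
    proof -
      have "0 \<le> \<lfloor>n * u\<rfloor>"
        using that by simp
      then have "s = to_index (n * u) \<longleftrightarrow> \<lfloor>n * u\<rfloor> = int s"
        unfolding to_index_def by linarith
      then show ?thesis
        by (simp add: floor_eq_iff)
    qed
    moreover have "real s / n \<le> u \<longleftrightarrow> s \<le> n * u" "u < (s + q s) / n \<longleftrightarrow> n * u - s < q s"
      "(s + q s) / n \<le> u \<longleftrightarrow> q s \<le> n * u - s" "u < (real s + 1) / n \<longleftrightarrow> n * u < real s + 1"
      using n by (auto simp: field_simps)
    ultimately show ?thesis
      using q(1)[OF that(1)] unfolding J_def by (cases b) auto
  qed
  \<comment> \<open>At u = 1 the default applies and no piece contains u, so this point is
    discarded.\<close>
  have "AE u in ?U. u \<in> {0..<1}"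
    using AE_lborel_singleton[of 1] by (intro AE_uniform_measureI) auto
  \<comment> \<open>The shape expected by \<open>prob_sum\<close>: up to a null set, the event is
    the disjoint union of the pieces leading to \<open>x\<close>.\<close>
  then have ae: "AE u in ?U. (\<forall>p\<in>{..<n} \<times> UNIV. u \<in> J p \<and> tgt p = x \<longrightarrow> alias_sample n q al u = x) \<and>
      (alias_sample n q al u = x \<longrightarrow> (\<exists>!p. p \<in> {..<n} \<times> UNIV \<and> u \<in> J p \<and> tgt p = x))"
  proof (rule eventually_mono)
    fix u :: real assume u: "u \<in> {0..<1}"
    let ?s = "to_index (n * u)" let ?b = "n * u - ?s < q ?s"
    have "n * u < n"
      using u n by simp
    then have s: "?s < n"
      unfolding to_index_def using u n by (simp add: nat_less_iff floor_less_iff)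
    have "alias_sample n q al u = tgt (?s, ?b)"
      using s by (simp add: alias_sample_def Let_def tgt_def)
    moreover have "u \<in> J p \<longleftrightarrow> p = (?s, ?b)" if "p \<in> {..<n} \<times> UNIV" for p
      using that J[of "fst p" u "snd p"] u by (cases p) auto
    ultimately show "(\<forall>p\<in>{..<n} \<times> UNIV. u \<in> J p \<and> tgt p = x \<longrightarrow> alias_sample n q al u = x) \<and>
      (alias_sample n q al u = x \<longrightarrow> (\<exists>!p. p \<in> {..<n} \<times> UNIV \<and> u \<in> J p \<and> tgt p = x))"
      using s by (auto intro!: ex1I[of _ "(?s, ?b)"])
  qed
  have Jm: "J p \<in> sets borel" for p
    by (cases p) (simp add: J_def)
  have "alias_sample n q al -` {x} \<inter> space borel \<in> sets borel"
    using alias_sample_measurable[OF tab n] x by (intro measurable_sets) auto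
  then have "measure ?U {u \<in> space ?U. alias_sample n q al u = x} =
      (\<Sum>p\<in>{..<n} \<times> UNIV. measure ?U {u \<in> space ?U. u \<in> J p \<and> tgt p = x})"
    using ae Jm by (intro unit.prob_sum) (auto simp: vimage_def)
  also have "\<dots> = (\<Sum>p\<in>{..<n} \<times> UNIV. if tgt p = x then measure ?U (J p) else 0)"
    by (intro sum.cong refl) (simp del: measure_uniform_measure)
  also have "\<dots> = (\<Sum>s<n. \<Sum>b\<in>UNIV. if tgt (s, b) = x then measure ?U (J (s, b)) else 0)"
    by (simp add: sum.cartesian_product del: measure_uniform_measure)
  also have "\<dots> = (\<Sum>s<n. (if s = x then q s / n else 0) + (if al s = x then (1 - q s) / n else 0))"
  proof (intro sum.cong refl)
    fix s assume "s \<in> {..<n}"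
    then have s: "s < n" by simp
    have "real s + 1 \<le> n"
      using s by linarith
    have qs: "0 \<le> q s" "q s \<le> 1"
      using q(1)[OF s] by auto
    have le: "0 \<le> real s / n" "real s / n \<le> (s + q s) / n" "(s + q s) / n \<le> (real s + 1) / n"
      using qs by (auto intro!: divide_right_mono)
    have "(real s + 1) / n \<le> 1"
      using \<open>real s + 1 \<le> n\<close> n by (intro divide_le_eq_1[THEN iffD2]) auto
    note le = le this
    have "measure ?U (J (s, True)) = (s + q s) / n - real s / n"
      unfolding J_def using le by (simp only: prod.case if_True measure_unit_interval)
    moreover have "measure ?U (J (s, False)) = (real s + 1) / n - (s + q s) / n"
      unfolding J_def using measure_unit_interval[OF order_trans[OF le(1,2)] le(3,4)]
      by (simp only: prod.case if_False)
    ultimately have "measure ?U (J (s, True)) = q s / n" "measure ?U (J (s, False)) = (1 - q s) / n"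
      by (simp_all add: add_divide_distrib diff_divide_distrib)
    then show "(\<Sum>b\<in>UNIV. if tgt (s, b) = x then measure ?U (J (s, b)) else 0) =
        (if s = x then q s / n else 0) + (if al s = x then (1 - q s) / n else 0)"
      by (auto simp: UNIV_bool tgt_def simp del: measure_uniform_measure)
  qed
  also have "\<dots> = q x / n + (\<Sum>s | s < n \<and> al s = x. (1 - q s) / n)"
    using x by (simp add: sum.distrib sum.If_cases Int_def lessThan_def)
  also have "\<dots> = q0 x / n"
    unfolding q(2)[symmetric] by (simp add: sum_divide_distrib add_divide_distrib)
  finally show ?thesis
    by simp
qed

lemma iid_alias_samples:
  assumes tab: "alias_table n q0 q al" and n: "0 < n"
  shows "iid_samples n (\<lambda>i. q0 i / real n) c (\<lambda>\<omega> j. alias_sample n q al (\<omega> (u + j)))"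
  unfolding iid_samples_def
  using indep_vars_draws[OF alias_sample_measurable[OF assms]]
    measure_draws[OF alias_sample_measurable[OF assms]] measure_alias_sample[OF tab]
  by auto

section \<open>Mean, variance and tails of an importance sampling estimator\<close>

locale importance_sampling =
  fixes n c :: nat and P a :: "nat \<Rightarrow> real" and t :: "(nat \<Rightarrow> real) \<Rightarrow> nat \<Rightarrow> nat" and T :: real
  assumes iid: "iid_samples n P c t" and c: "1 \<le> c" and T: "0 < T"
    and bound: "\<And>i. i < n \<Longrightarrow> 0 \<le> P i \<and> \<bar>a i\<bar> \<le> T * P i"
begin

text \<open>The assumption \<open>bound\<close> makes every such term at most \<open>T\<close> in
  absolute value. Where \<open>P i = 0\<close> it forces \<open>a i = 0\<close>, so that the value 0
  of a division by zero is the right one.\<close>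

definition X :: "nat \<Rightarrow> (nat \<Rightarrow> real) \<Rightarrow> real" where
  "X j \<omega> = a (t \<omega> j) / P (t \<omega> j)"

definition \<mu> :: real where
  "\<mu> = (\<Sum>i<n. a i)"

definition est :: "(nat \<Rightarrow> real) \<Rightarrow> real" where
  "est \<omega> = 1 / real c * (\<Sum>j<c. X j \<omega>)"

lemma t_measurable: "j < c \<Longrightarrow> (\<lambda>\<omega>. t \<omega> j) \<in> draws \<rightarrow>\<^sub>M count_space {..<n}"
  using iid unfolding iid_samples_def draws.indep_vars_def by auto

lemma t_less: "j < c \<Longrightarrow> \<omega> \<in> space draws \<Longrightarrow> t \<omega> j < n"
  using measurable_space[OF t_measurable, of j \<omega>] by simp

text \<open>The function \<open>h\<close> covers the plain terms, needed for Hoeffding's inequality,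
  and the centred ones, needed for the variance.\<close>

lemma indep_X: "draws.indep_vars (\<lambda>_. borel) (\<lambda>j \<omega>. h (a (t \<omega> j) / P (t \<omega> j)) :: real) {..<c}"
  by (rule draws.indep_vars_compose2[where M' = "\<lambda>_. count_space {..<n}" and X = "\<lambda>j \<omega>. t \<omega> j"
      and Y = "\<lambda>_ i. h (a i / P i)"])
    (use iid in \<open>auto simp: iid_samples_def\<close>)

lemma X_measurable [measurable]: "j < c \<Longrightarrow> X j \<in> borel_measurable draws"
  using indep_X[of "\<lambda>x. x"] unfolding draws.indep_vars_def X_def by auto

lemma X_bound:
  assumes "j < c" "\<omega> \<in> space draws"
  shows "\<bar>X j \<omega>\<bar> \<le> T"
proof -
  have b: "0 \<le> P (t \<omega> j)" "\<bar>a (t \<omega> j)\<bar> \<le> T * P (t \<omega> j)"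
    using bound[OF t_less[OF assms]] by auto
  show ?thesis
  proof (cases "P (t \<omega> j) = 0")
    case True
    then show ?thesis using T by (simp add: X_def)
  next
    case False
    then show ?thesis using b by (simp add: X_def divide_le_eq)
  qed
qed

lemma integrable_X [simp]: "j < c \<Longrightarrow> integrable draws (X j)"
  by (rule draws.integrable_const_bound[where B = T]) (auto simp: X_bound)

lemma expectation_X:
  assumes j: "j < c"
  shows "draws.expectation (X j) = \<mu>"
proof -
  let ?A = "\<lambda>i. {\<omega> \<in> space draws. t \<omega> j = i}"
  have A: "?A i \<in> sets draws" if "i < n" for i
  proof -
    have "(\<lambda>\<omega>. t \<omega> j) -` {i} \<inter> space draws \<in> sets draws"
      using that by (intro measurable_sets[OF t_measurable[OF j]]) auto
    then show ?thesis
      by (simp add: vimage_def Int_def conj_commute)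
  qed
  have "draws.expectation (X j) = draws.expectation (\<lambda>\<omega>. \<Sum>i<n. a i / P i * indicator (?A i) \<omega>)"
  proof (rule Bochner_Integration.integral_cong[OF refl])
    fix \<omega> assume w: "\<omega> \<in> space draws"
    have "(\<Sum>i<n. a i / P i * indicator (?A i) \<omega>) = (\<Sum>i<n. if i = t \<omega> j then a i / P i else 0)"
      using w by (intro sum.cong) auto
    then show "X j \<omega> = (\<Sum>i<n. a i / P i * indicator (?A i) \<omega>)"
      using t_less[OF j w] by (simp add: X_def)
  qed
  also have "\<dots> = (\<Sum>i<n. a i / P i * draws.prob (?A i))"
  proof (subst Bochner_Integration.integral_sum)
    show "integrable draws (\<lambda>\<omega>. a i / P i * indicator (?A i) \<omega>)" if "i \<in> {..<n}" for i
      using A[of i] that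
      by (intro integrable_mult_right integrable_real_indicator) (auto simp: draws.emeasure_eq_measure)
    show "(\<Sum>i<n. draws.expectation (\<lambda>\<omega>. a i / P i * indicator (?A i) \<omega>)) =
        (\<Sum>i<n. a i / P i * draws.prob (?A i))"
      using A by (intro sum.cong refl) (simp add: Int_absorb2)
  qed
  also have "\<dots> = \<mu>"
    unfolding \<mu>_def
  proof (rule sum.cong[OF refl])
    fix i assume "i \<in> {..<n}"
    then have i: "i < n" by simp
    have "draws.prob (?A i) = P i"
      using iid j i unfolding iid_samples_def by auto
    \<comment> \<open>The weight cancels the probability; if \<open>P i = 0\<close>, both sides
      vanish.\<close>
    then show "a i / P i * draws.prob (?A i) = a i"
      using bound[OF i] by (cases "P i = 0") auto
  qed
  finally show ?thesis .
qed

lemma expectation_product: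
  assumes "j < c" "l < c" "j \<noteq> l"
  shows "draws.expectation (\<lambda>\<omega>. (X j \<omega> - \<mu>) * (X l \<omega> - \<mu>)) = 0"
proof -
  have "draws.indep_vars (\<lambda>_. borel) (\<lambda>j \<omega>. X j \<omega> - \<mu>) {j, l}"
    using assms indep_X[of "\<lambda>x. x - \<mu>"] unfolding X_def
    by (rule_tac draws.indep_vars_subset) auto
  then have "draws.expectation (\<lambda>\<omega>. \<Prod>i\<in>{j, l}. X i \<omega> - \<mu>) = (\<Prod>i\<in>{j, l}. draws.expectation (\<lambda>\<omega>. X i \<omega> - \<mu>))"
    using assms by (intro draws.indep_vars_lebesgue_integral) auto
  then show ?thesis
    using assms by (simp add: expectation_X draws.prob_space)
qed

text \<open>The variance is at most the second moment, and the terms are bounded by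
  \<open>T\<close>.\<close>

lemma expectation_square:
  assumes "j < c"
  shows "draws.expectation (\<lambda>\<omega>. (X j \<omega> - \<mu>) * (X j \<omega> - \<mu>)) \<le> T\<^sup>2"
proof -
  have sq: "(X j \<omega>)\<^sup>2 \<le> T\<^sup>2" if "\<omega> \<in> space draws" for \<omega>
    using X_bound[OF assms that] T by (simp add: abs_le_square_iff[symmetric])
  have i2: "integrable draws (\<lambda>\<omega>. (X j \<omega>)\<^sup>2)"
    using assms sq by (intro draws.integrable_const_bound[where B = "T\<^sup>2"]) auto
  have "draws.expectation (\<lambda>\<omega>. (X j \<omega>)\<^sup>2) \<le> draws.expectation (\<lambda>_. T\<^sup>2)"
    using i2 sq by (intro integral_mono) auto
  moreover have "draws.expectation (\<lambda>\<omega>. (X j \<omega> - \<mu>) * (X j \<omega> - \<mu>)) =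
      draws.expectation (\<lambda>\<omega>. (X j \<omega>)\<^sup>2) - \<mu>\<^sup>2"
    using draws.variance_eq[OF integrable_X[OF assms] i2] expectation_X[OF assms]
    by (simp add: power2_eq_square)
  ultimately have "draws.expectation (\<lambda>\<omega>. (X j \<omega> - \<mu>) * (X j \<omega> - \<mu>)) \<le> T\<^sup>2 - \<mu>\<^sup>2"
    by (simp add: draws.prob_space)
  then show ?thesis
    by (smt (verit) zero_le_power2)
qed

lemma est_measurable [measurable]: "est \<in> borel_measurable draws"
  unfolding est_def[abs_def] by measurable

lemma expectation_est: "draws.expectation est = \<mu>"
  unfolding est_def[abs_def] using c by (simp add: expectation_X)

text \<open>Independence kills the mixed products of centred terms. The c diagonal ones contribute
  at most \<open>T\<^sup>2\<close> each and are divided by \<open>c\<^sup>2\<close>.\<close>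

lemma expectation_est_square: "draws.expectation (\<lambda>\<omega>. (est \<omega> - \<mu>)\<^sup>2) \<le> T\<^sup>2 / c"
proof -
  let ?Z = "\<lambda>j \<omega>. X j \<omega> - \<mu>"
  have int: "integrable draws (\<lambda>\<omega>. ?Z j \<omega> * ?Z l \<omega>)" if "j < c" "l < c" for j l
  proof (rule draws.integrable_const_bound[where B = "(T + \<bar>\<mu>\<bar>) * (T + \<bar>\<mu>\<bar>)"])
    have "\<bar>?Z j \<omega> * ?Z l \<omega>\<bar> \<le> (T + \<bar>\<mu>\<bar>) * (T + \<bar>\<mu>\<bar>)" if "\<omega> \<in> space draws" for \<omega>
      unfolding abs_mult using X_bound[OF \<open>j < c\<close> that] X_bound[OF \<open>l < c\<close> that]
      by (intro mult_mono) auto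
    then show "AE \<omega> in draws. norm (?Z j \<omega> * ?Z l \<omega>) \<le> (T + \<bar>\<mu>\<bar>) * (T + \<bar>\<mu>\<bar>)"
      by (intro AE_I2) simp
  qed (use that in measurable)
  have "est \<omega> - \<mu> = 1 / c * (\<Sum>j<c. ?Z j \<omega>)" for \<omega>
    using c by (simp add: est_def sum_subtractf diff_divide_distrib)
  then have sq: "(est \<omega> - \<mu>)\<^sup>2 = 1 / (real c)\<^sup>2 * (\<Sum>j<c. \<Sum>l<c. ?Z j \<omega> * ?Z l \<omega>)" for \<omega>
    by (simp add: power_mult_distrib power_divide power2_eq_square[of "sum _ _"] sum_product)
  have "draws.expectation (\<lambda>\<omega>. (est \<omega> - \<mu>)\<^sup>2) =
      1 / (real c)\<^sup>2 * (\<Sum>j<c. \<Sum>l<c. draws.expectation (\<lambda>\<omega>. ?Z j \<omega> * ?Z l \<omega>))"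
  proof -
    have "draws.expectation (\<lambda>\<omega>. \<Sum>j<c. \<Sum>l<c. ?Z j \<omega> * ?Z l \<omega>) =
        (\<Sum>j<c. draws.expectation (\<lambda>\<omega>. \<Sum>l<c. ?Z j \<omega> * ?Z l \<omega>))"
      using int by (intro Bochner_Integration.integral_sum Bochner_Integration.integrable_sum) auto
    also have "\<dots> = (\<Sum>j<c. \<Sum>l<c. draws.expectation (\<lambda>\<omega>. ?Z j \<omega> * ?Z l \<omega>))"
      using int by (intro sum.cong refl Bochner_Integration.integral_sum) auto
    finally show ?thesis
      unfolding sq by simp
  qed
  also have "(\<Sum>j<c. \<Sum>l<c. draws.expectation (\<lambda>\<omega>. ?Z j \<omega> * ?Z l \<omega>)) \<le> (\<Sum>j<c. T\<^sup>2)"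
  proof (rule sum_mono)
    fix j assume "j \<in> {..<c}"
    then have j: "j < c" by simp
    have "(\<Sum>l<c. draws.expectation (\<lambda>\<omega>. ?Z j \<omega> * ?Z l \<omega>)) =
        (\<Sum>l<c. if l = j then draws.expectation (\<lambda>\<omega>. ?Z j \<omega> * ?Z j \<omega>) else 0)"
      using expectation_product[OF j] by (intro sum.cong) auto
    then show "(\<Sum>l<c. draws.expectation (\<lambda>\<omega>. ?Z j \<omega> * ?Z l \<omega>)) \<le> T\<^sup>2"
      using expectation_square[OF j] j by simp
  qed
  finally show ?thesis
    using c by (simp add: mult_left_mono power2_eq_square field_simps)
qed

lemma integrable_est_square: "integrable draws (\<lambda>\<omega>. (est \<omega>)\<^sup>2)"
proof (rule draws.integrable_const_bound[where B = "T\<^sup>2"])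
  have "\<bar>est \<omega>\<bar> \<le> T" if w: "\<omega> \<in> space draws" for \<omega>
  proof -
    have "\<bar>\<Sum>j<c. X j \<omega>\<bar> \<le> (\<Sum>j<c. T)"
      using X_bound[OF _ w] by (intro order_trans[OF sum_abs] sum_mono) auto
    then show ?thesis
      using c by (simp add: est_def abs_mult divide_le_eq mult.commute)
  qed
  then show "AE \<omega> in draws. norm ((est \<omega>)\<^sup>2) \<le> T\<^sup>2"
    using T by (intro AE_I2) (simp add: abs_le_square_iff[symmetric])
qed measurable

lemma est_rms:
  assumes e: "0 < \<epsilon>" "1 / \<epsilon>\<^sup>2 \<le> real c"
  shows "sqrt (\<integral>\<omega>. (est \<omega> - \<mu>)\<^sup>2 \<partial>draws) \<le> \<epsilon> * T"
proof (rule real_le_lsqrt)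
  have "T\<^sup>2 / c \<le> (\<epsilon> * T)\<^sup>2"
    using e c T by (simp add: field_simps power_mult_distrib)
  then show "draws.expectation (\<lambda>\<omega>. (est \<omega> - \<mu>)\<^sup>2) \<le> (\<epsilon> * T)\<^sup>2"
    using expectation_est_square by linarith
qed (use e T in auto)

lemma est_Chebyshev:
  assumes e: "0 < \<epsilon>"
  shows "draws.prob {\<omega> \<in> space draws. \<epsilon> * T \<le> \<bar>est \<omega> - \<mu>\<bar>} \<le> 1 / (real c * \<epsilon>\<^sup>2)"
proof -
  have "draws.prob {\<omega> \<in> space draws. \<epsilon> * T \<le> \<bar>est \<omega> - \<mu>\<bar>} \<le>
      draws.expectation (\<lambda>\<omega>. (est \<omega> - \<mu>)\<^sup>2) / (\<epsilon> * T)\<^sup>2"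
    using draws.Chebyshev_inequality[OF est_measurable integrable_est_square, of "\<epsilon> * T"] e T
    by (simp add: expectation_est)
  also have "\<dots> \<le> (T\<^sup>2 / c) / (\<epsilon> * T)\<^sup>2"
    using expectation_est_square by (rule divide_right_mono) simp
  also have "\<dots> = 1 / (real c * \<epsilon>\<^sup>2)"
    using T by (simp add: power_mult_distrib)
  finally show ?thesis .
qed

lemma est_Hoeffding:
  assumes e: "0 < \<epsilon>"
  shows "draws.prob {\<omega> \<in> space draws. \<epsilon> * T \<le> \<bar>est \<omega> - \<mu>\<bar>} \<le> 2 * exp (- (real c * \<epsilon>\<^sup>2) / 2)"
proof -
  interpret H: Hoeffding_ineq draws "{..<c}" X "\<lambda>_. - T" "\<lambda>_. T" "\<Sum>j<c. draws.expectation (X j)"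
  proof unfold_locales
    show "draws.indep_vars (\<lambda>_. borel) X {..<c}"
      using indep_X[of "\<lambda>x. x"] by (simp add: X_def[abs_def])
    show "AE \<omega> in draws. X j \<omega> \<in> {- T..T}" if "j \<in> {..<c}" for j
    proof (rule AE_I2)
      fix \<omega> assume "\<omega> \<in> space draws"
      then have "\<bar>X j \<omega>\<bar> \<le> T"
        using that by (intro X_bound) auto
      then show "X j \<omega> \<in> {- T..T}"
        by auto
    qed
  qed simp_all
  have "\<epsilon> * T \<le> \<bar>est \<omega> - \<mu>\<bar> \<longleftrightarrow> real c * (\<epsilon> * T) \<le> \<bar>(\<Sum>j<c. X j \<omega>) - c * \<mu>\<bar>" for \<omega>
  proof -
    have "(\<Sum>j<c. X j \<omega>) - c * \<mu> = c * (est \<omega> - \<mu>)"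
      using c by (simp add: est_def right_diff_distrib)
    then show ?thesis
      using c by (simp add: abs_mult)
  qed
  moreover have "(\<Sum>j<c. draws.expectation (X j)) = c * \<mu>"
    by (simp add: expectation_X)
  ultimately have "draws.prob {\<omega> \<in> space draws. \<epsilon> * T \<le> \<bar>est \<omega> - \<mu>\<bar>} \<le>
      2 * exp (-2 * (real c * (\<epsilon> * T))\<^sup>2 / (\<Sum>j<c. (T - - T)\<^sup>2))"
    using H.Hoeffding_ineq_abs_ge[of "real c * (\<epsilon> * T)"] e T c by simp
  \<comment> \<open>Each term ranges over an interval of length 2T, so the denominator is
    \<open>c * (2 * T)\<^sup>2\<close> and T cancels.\<close>
  also have "-2 * (real c * (\<epsilon> * T))\<^sup>2 / (\<Sum>j<c. (T - - T)\<^sup>2) = - (real c * \<epsilon>\<^sup>2) / 2"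
    using c T by (simp add: power2_eq_square field_simps)
  finally show ?thesis .
qed

text \<open>Hoeffding's inequality does not suffice for \<open>\<delta>\<close> close to 1, where Chebyshev's does.\<close>

lemma est_tail:
  assumes e: "0 < \<epsilon>" and \<delta>: "0 < \<delta>" "\<delta> < 1" and ce: "(1 + sqrt (8 * ln (1 / \<delta>)))\<^sup>2 / \<epsilon>\<^sup>2 \<le> real c"
  shows "1 - \<delta> \<le> draws.prob {\<omega> \<in> space draws. \<bar>est \<omega> - \<mu>\<bar> \<le> \<epsilon> * T}"
proof -
  define l where "l = ln (1 / \<delta>)"
  have l: "0 < l" "exp (- l) = \<delta>"
    using \<delta> by (auto simp: l_def exp_minus)
  have "(1 + sqrt (8 * l))\<^sup>2 = 1 + 8 * l + 2 * sqrt (8 * l)"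
    using l by (simp add: power2_sum)
  then have "1 + 8 * l \<le> (1 + sqrt (8 * l))\<^sup>2"
    using l by simp
  also have "\<dots> \<le> real c * \<epsilon>\<^sup>2"
    using ce e by (simp add: l_def divide_le_eq)
  finally have h: "1 + 8 * l \<le> real c * \<epsilon>\<^sup>2" .
  have "draws.prob {\<omega> \<in> space draws. \<epsilon> * T \<le> \<bar>est \<omega> - \<mu>\<bar>} \<le> \<delta>"
  \<comment> \<open>For \<open>l \<le> 1\<close> Chebyshev's bound is at most
    \<open>1 / (1 + 8 * l)\<close>, so \<open>exp l \<le> 1 + 8 * l\<close> suffices, and
    \<open>exp_bound\<close> holds up to 1. For larger \<open>l\<close> the exponent in Hoeffding's
    bound is below \<open>- l - 1\<close>, and the spare 1 absorbs the factor 2 through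
    \<open>2 \<le> exp 1\<close>.\<close>
  proof (cases "l \<le> 1")
    case True
    have "exp l \<le> 1 + l + l\<^sup>2"
      using l True by (intro exp_bound) auto
    also have "l\<^sup>2 \<le> l"
      using l True by (simp add: power2_eq_square mult_left_le)
    finally have "exp l \<le> real c * \<epsilon>\<^sup>2"
      using h l by linarith
    then have "1 / (real c * \<epsilon>\<^sup>2) \<le> 1 / exp l"
      by (intro divide_left_mono) (use h l in \<open>auto intro!: mult_pos_pos\<close>)
    also have "1 / exp l = \<delta>"
      using l(2) by (simp add: exp_minus inverse_eq_divide)
    finally show ?thesis
      using est_Chebyshev[OF e] by linarith
  next
    case False
    have "(2::real) \<le> exp 1"
      using exp_ge_add_one_self[of 1] by simp
    then have "2 * exp (- (real c * \<epsilon>\<^sup>2) / 2) \<le> exp 1 * exp (- (real c * \<epsilon>\<^sup>2) / 2)"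
      by (intro mult_right_mono) auto
    also have "\<dots> = exp (1 - real c * \<epsilon>\<^sup>2 / 2)"
      by (simp add: exp_add[symmetric])
    also have "\<dots> \<le> exp (- l)"
      using h False by simp
    finally show ?thesis
      using est_Hoeffding[OF e] l(2) by linarith
  qed
  \<comment> \<open>The complement of the tail event is a strict inequality, hence contained in the
    event to be bounded.\<close>
  moreover have "draws.prob {\<omega> \<in> space draws. \<not> \<epsilon> * T \<le> \<bar>est \<omega> - \<mu>\<bar>} =
      1 - draws.prob {\<omega> \<in> space draws. \<epsilon> * T \<le> \<bar>est \<omega> - \<mu>\<bar>}"
    by (rule draws.prob_neg) measurable
  moreover have "draws.prob {\<omega> \<in> space draws. \<not> \<epsilon> * T \<le> \<bar>est \<omega> - \<mu>\<bar>} \<le>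
      draws.prob {\<omega> \<in> space draws. \<bar>est \<omega> - \<mu>\<bar> \<le> \<epsilon> * T}"
    by (rule draws.finite_measure_mono) (auto, measurable)
  ultimately show ?thesis
    by linarith
qed

end

section \<open>Computing the norms\<close>

lemma stores_precomputed_agree:
  assumes "stores_precomputed S \<sigma>" "agree X Y \<sigma> \<tau>"
    "''d'' \<notin> X" "''L'' \<notin> X" "''n'' \<notin> X" "''x'' \<notin> Y" "''C'' \<notin> Y"
  shows "stores_precomputed S \<tau>"
  using assms unfolding stores_precomputed_def by (auto simp: agree_def)

lemma stores_precomputedD:
  assumes "stores_precomputed S \<sigma>"
  shows "scalar \<sigma> ''d'' = real (width S)" "scalar \<sigma> ''L'' = real (depth S)" "scalar \<sigma> ''n'' = real (ndata S)"
    "i < ndata S \<Longrightarrow> l < depth S \<Longrightarrow> a < width S \<Longrightarrow> arr \<sigma> ''x'' [i, l, a] = x_vec S i l $ a"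
    "i < ndata S \<Longrightarrow> l' \<in> {1..depth S} \<Longrightarrow> a < width S \<Longrightarrow> b < width S \<Longrightarrow>
      arr \<sigma> ''C'' [i, l', a, b] = C_mat S i l' $$ (a, b)"
proof -
  assume r: "i < ndata S" "l < depth S" "a < width S"
  then have "Suc l \<in> {1..depth S}"
    by simp
  then have "arr \<sigma> ''x'' [i, Suc l - 1, a] = x_vec S i (Suc l - 1) $ a"
    using assms r unfolding stores_precomputed_def by blast
  then show "arr \<sigma> ''x'' [i, l, a] = x_vec S i l $ a"
    by simp
qed (use assms in \<open>auto simp: stores_precomputed_def\<close>)

lemma stores_norms_agree:
  assumes "stores_norms S \<sigma>" "agree X Y \<sigma> \<tau>" "''norm'' \<notin> Y"
  shows "stores_norms S \<tau>"
  using assms unfolding stores_norms_def by (auto simp: agree_def)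

text \<open>Taking the variable names as parameters lets one program text serve both purposes: the
  squared norm of a column, and the inner product of two columns from different layers.\<close>

definition column_dot :: "string \<Rightarrow> string \<Rightarrow> string \<Rightarrow> string \<Rightarrow> string \<Rightarrow> prog" where
  "column_dot t l a l' a' = Seq (Assign ''s'' (Const 0)) (For ''p'' ''d'' (Assign ''s'' (Add (Var ''s'')
     (Mul (Elem ''C'' [Var t, Var l, Var ''p'', Var a]) (Elem ''C'' [Var t, Var l', Var ''p'', Var a'])))))"

lemma column_dot_frame [simp]:
  "assigned (column_dot t l a l' a') = {''s'', ''p''}" "stored (column_dot t l a l' a') = {}"
  "draw_free (column_dot t l a l' a')"
  by (auto simp: column_dot_def)

text \<open>The names must avoid the accumulator \<open>s\<close> and the loop variable
  \<open>p\<close>, which are overwritten. A round costs 14 units for the assignment and 7 for the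
  loop.\<close>

lemma runs_column_dot:
  assumes pre: "stores_precomputed S \<sigma>"
    and names: "{t, vl, va, vl', va'} \<inter> {''s'', ''p''} = {}"
    and vals: "scalar \<sigma> t = real i" "scalar \<sigma> vl = real l" "scalar \<sigma> va = real a"
      "scalar \<sigma> vl' = real l'" "scalar \<sigma> va' = real a'"
    and ranges: "i < ndata S" "l \<in> {1..depth S}" "a < width S" "l' \<in> {1..depth S}" "a' < width S"
  shows "runs \<omega> (column_dot t vl va vl' va') \<sigma> (width S * 21 + 7) (\<lambda>\<sigma>'.
    scalar \<sigma>' ''s'' = (\<Sum>p<width S. C_mat S i l $$ (p, a) * C_mat S i l' $$ (p, a')))"
proof -
  let ?s = "\<lambda>j. \<Sum>p<j. C_mat S i l $$ (p, a) * C_mat S i l' $$ (p, a')"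
  let ?\<sigma> = "\<sigma>\<lparr>scalar := (scalar \<sigma>)(''s'' := 0)\<rparr>"
  have pre': "stores_precomputed S ?\<sigma>"
    using pre by (rule stores_precomputed_agree[of _ _ "{''s''}" "{}"]) (auto simp: agree_def)
  have "runs \<omega> (For ''p'' ''d'' (Assign ''s'' (Add (Var ''s'')
     (Mul (Elem ''C'' [Var t, Var vl, Var ''p'', Var va]) (Elem ''C'' [Var t, Var vl', Var ''p'', Var va'])))))
     ?\<sigma> (width S * 21 + 5) (\<lambda>\<sigma>'. scalar \<sigma>' ''s'' = ?s (width S))"
  proof (rule runs_For[where N = "width S" and I = "\<lambda>j \<tau>. scalar \<tau> ''s'' = ?s j" and B = 14])
    show "scalar ?\<sigma> ''d'' = real (width S)"
      using pre' by (simp add: stores_precomputed_def)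
    fix j :: nat and \<tau> :: state
    assume j: "j < width S" "scalar \<tau> ''s'' = ?s j" "scalar \<tau> ''p'' = real j"
    assume "agree (insert ''p'' (assigned (Assign ''s'' (Add (Var ''s'')
       (Mul (Elem ''C'' [Var t, Var vl, Var ''p'', Var va]) (Elem ''C'' [Var t, Var vl', Var ''p'', Var va']))))))
      (stored (Assign ''s'' (Add (Var ''s'')
       (Mul (Elem ''C'' [Var t, Var vl, Var ''p'', Var va]) (Elem ''C'' [Var t, Var vl', Var ''p'', Var va']))))) ?\<sigma> \<tau>"
    then have ag: "agree {''p'', ''s''} {} ?\<sigma> \<tau>"
      by simp
    have pre\<tau>: "stores_precomputed S \<tau>"
      by (rule stores_precomputed_agree[OF pre' ag]) auto
    have C: "arr \<tau> ''C'' [i, l, j, a] = C_mat S i l $$ (j, a)"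
        "arr \<tau> ''C'' [i, l', j, a'] = C_mat S i l' $$ (j, a')"
      using stores_precomputedD(5)[OF pre\<tau>] ranges j(1) by auto
    have v: "scalar \<tau> t = real i" "scalar \<tau> vl = real l" "scalar \<tau> va = real a"
      "scalar \<tau> vl' = real l'" "scalar \<tau> va' = real a'"
    proof -
      have "scalar \<tau> y = scalar \<sigma> y" if "''s'' \<noteq> y" "''p'' \<noteq> y" for y
        using agreeD(1)[OF ag, of y] that by simp
      then show "scalar \<tau> t = real i" "scalar \<tau> vl = real l" "scalar \<tau> va = real a"
          "scalar \<tau> vl' = real l'" "scalar \<tau> va' = real a'"
        using names by (simp_all add: vals)
    qed
    show "runs \<omega> (Assign ''s'' (Add (Var ''s'')
       (Mul (Elem ''C'' [Var t, Var vl, Var ''p'', Var va]) (Elem ''C'' [Var t, Var vl', Var ''p'', Var va']))))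
      \<tau> 14 (\<lambda>\<tau>'. scalar (\<tau>'\<lparr>scalar := (scalar \<tau>')(''p'' := real (Suc j))\<rparr>) ''s'' = ?s (Suc j))"
      by (rule runs_loop_free) (simp_all add: v j C)
  qed auto
  then show ?thesis
    unfolding column_dot_def
    by (intro runs_Seq[where B = 2 and B' = "width S * 21 + 5" and Q = "\<lambda>\<tau>. \<tau> = ?\<sigma>"])
      (auto intro!: runs_loop_free)
qed

text \<open>The right-hand side is what the program stores. Here \<open>l\<close> counts layers from
  0, as its loop does, so the layer in question is \<open>Suc l\<close>; the square of the width is
  written as a product to match the computed address.\<close>

lemma norm_vec_v_part:
  assumes S: "gnh_setting S" and i: "i < ndata S" and l: "l < depth S" and a: "a < width S" "b < width S"
  shows "norm_vec (v_part S (l * (width S * width S) + b * width S + a) i) =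
    sqrt (x_vec S i l $ b * x_vec S i l $ b *
      (\<Sum>p<width S. C_mat S i (Suc l) $$ (p, a) * C_mat S i (Suc l) $$ (p, a)))"
proof -
  let ?k = "l * (width S * width S) + b * width S + a"
  have k: "weight_layer S ?k = Suc l" "weight_col S ?k = b" "weight_row S ?k = a"
    using weight_index_unique[OF a, of l ?k]
    by (auto simp: weight_layer_def weight_col_def weight_row_def power2_eq_square)
  have "b * width S + a < Suc b * width S"
    using a by simp
  also have "\<dots> \<le> width S * width S"
    using a by (intro mult_right_mono) auto
  finally have "?k < Suc l * (width S * width S)"
    by simp
  also have "\<dots> \<le> depth S * (width S * width S)"
    using l by (intro mult_right_mono) auto
  finally have "?k < num_weights S"
    by (simp add: num_weights_def power2_eq_square mult.commute)
  then show ?thesis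
    unfolding norm_vec_def v_part_scalar_prod[OF S i \<open>?k < num_weights S\<close> \<open>?k < num_weights S\<close>] k by simp
qed

abbreviation "norm_store \<equiv> Store ''norm''
   [Var ''i'', Add (Add (Mul (Var ''l'') (Mul (Var ''d'') (Var ''d''))) (Mul (Var ''b'') (Var ''d''))) (Var ''a'')]
   (Sqrt (Mul (Mul (Elem ''x'' [Var ''i'', Var ''l'', Var ''b'']) (Elem ''x'' [Var ''i'', Var ''l'', Var ''b'']))
     (Var ''s'')))"

text \<open>One inner product followed by d stores, one for each column \<open>b\<close> of the
  weight matrix: O(d) work for d norms. The scalar \<open>m\<close> holds the layer counted from
  1.\<close>

definition norm_row :: prog where
  "norm_row = Seq (Assign ''m'' (Add (Var ''l'') (Const 1)))
     (Seq (column_dot ''i'' ''m'' ''a'' ''m'' ''a'') (For ''b'' ''d'' norm_store))"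

definition norm_prog :: prog where
  "norm_prog = For ''i'' ''n'' (For ''l'' ''L'' (For ''a'' ''d'' norm_row))"

lemma norm_row_frame [simp]:
  "assigned norm_row = {''m'', ''s'', ''p'', ''b''}" "stored norm_row = {''norm''}"
  by (auto simp: norm_row_def)

text \<open>Since only correct values are ever stored, the set of correct entries grows, whether or not
  two stores hit the same index.\<close>

definition norm_ok :: "'y network \<Rightarrow> state \<Rightarrow> (nat \<times> nat) set" where
  "norm_ok S \<sigma> = {(i, k). arr \<sigma> ''norm'' [i, k] = norm_vec (v_part S k i)}"

lemma norm_ok_scalar [simp]: "norm_ok S (\<sigma>\<lparr>scalar := f\<rparr>) = norm_ok S \<sigma>"
  by (simp add: norm_ok_def)

lemma norm_ok_grow:
  "A \<union> B \<subseteq> norm_ok S \<sigma> \<Longrightarrow> norm_ok S \<sigma> \<union> C \<subseteq> norm_ok S \<sigma>' \<Longrightarrow> D = B \<union> C \<Longrightarrow>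
    A \<union> D \<subseteq> norm_ok S (\<sigma>'\<lparr>scalar := f\<rparr>)"
  by auto

lemma runs_norm_row:
  assumes S: "gnh_setting S" and pre: "stores_precomputed S \<sigma>"
    and vals: "scalar \<sigma> ''i'' = real i" "scalar \<sigma> ''l'' = real l" "scalar \<sigma> ''a'' = real a"
    and ranges: "i < ndata S" "l < depth S" "a < width S"
  shows "runs \<omega> norm_row \<sigma> (69 * width S) (\<lambda>\<sigma>'. norm_ok S \<sigma> \<union>
    (\<lambda>b. (i, l * (width S * width S) + b * width S + a)) ` {..<width S} \<subseteq> norm_ok S \<sigma>')"
proof -
  let ?d = "width S"
  let ?s = "\<Sum>p<?d. C_mat S i (Suc l) $$ (p, a) * C_mat S i (Suc l) $$ (p, a)"
  let ?\<sigma> = "\<sigma>\<lparr>scalar := (scalar \<sigma>)(''m'' := real (Suc l))\<rparr>"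
  let ?I = "\<lambda>j \<tau>. norm_ok S \<sigma> \<union> (\<lambda>b. (i, l * (?d * ?d) + b * ?d + a)) ` {..<j} \<subseteq> norm_ok S \<tau>"
  have ag0: "agree {''m''} {} \<sigma> ?\<sigma>"
    by (auto simp: agree_def)
  have loop: "runs \<omega> (For ''b'' ''d'' norm_store) \<tau> (32 * ?d + 5) (?I ?d)"
    if s: "scalar \<tau> ''s'' = ?s" and ag: "agree {''s'', ''p''} {} ?\<sigma> \<tau>" for \<tau>
  proof (rule runs_For[where N = ?d and I = ?I and B = 25])
    have ag\<tau>: "agree {''s'', ''p'', ''m''} {} \<sigma> \<tau>"
      by (rule agree_trans[OF ag0 ag]) auto
    have pre\<tau>: "stores_precomputed S \<tau>"
      by (rule stores_precomputed_agree[OF pre ag\<tau>]) auto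
    then show "scalar \<tau> ''d'' = real ?d"
      by (simp add: stores_precomputed_def)
    have "norm_ok S \<tau> = norm_ok S \<sigma>"
      using agreeD(2)[OF ag\<tau>] by (simp add: norm_ok_def)
    then show "?I 0 (\<tau>\<lparr>scalar := (scalar \<tau>)(''b'' := 0)\<rparr>)"
      by simp
    fix j :: nat and \<tau>' :: state
    assume j: "j < ?d" and I: "?I j \<tau>'" and b: "scalar \<tau>' ''b'' = real j"
      and "agree (insert ''b'' (assigned norm_store)) (stored norm_store) \<tau> \<tau>'"
    then have ag': "agree {''b''} {''norm''} \<tau> \<tau>'"
      by simp
    have pre\<tau>': "stores_precomputed S \<tau>'"
      by (rule stores_precomputed_agree[OF pre\<tau> ag']) auto
    have v: "scalar \<tau>' ''d'' = real ?d" "arr \<tau>' ''x'' [i, l, j] = x_vec S i l $ j"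
      using stores_precomputedD[OF pre\<tau>'] ranges j by auto
    have w: "scalar \<tau>' ''s'' = ?s" "scalar \<tau>' ''i'' = real i" "scalar \<tau>' ''l'' = real l" "scalar \<tau>' ''a'' = real a"
      using s vals agreeD(1)[OF ag\<tau>] agreeD(1)[OF ag'] by auto
    let ?k = "l * (?d * ?d) + j * ?d + a"
    have k: "to_index (real l * (real ?d * real ?d) + real j * real ?d + real a) = ?k"
      using to_index_of_nat[of ?k] by simp
    show "runs \<omega> norm_store \<tau>' 25 (\<lambda>\<tau>''. ?I (Suc j) (\<tau>''\<lparr>scalar := (scalar \<tau>'')(''b'' := real (Suc j))\<rparr>))"
    proof (rule runs_loop_free)
      let ?e = "eff \<omega> norm_store \<tau>'"
      have "arr ?e ''norm'' = (arr \<tau>' ''norm'')([i, ?k] := norm_vec (v_part S ?k i))"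
        by (simp add: v w b k norm_vec_v_part[OF S ranges(1,2,3) j])
      then have "norm_ok S \<tau>' \<union> {(i, ?k)} \<subseteq> norm_ok S ?e"
        unfolding norm_ok_def by auto
      then show "?I (Suc j) (?e\<lparr>scalar := (scalar ?e)(''b'' := real (Suc j))\<rparr>)"
        using I by (auto simp: lessThan_Suc simp del: eff.simps)
    qed simp_all
  qed auto
  have "runs \<omega> (column_dot ''i'' ''m'' ''a'' ''m'' ''a'') ?\<sigma> (?d * 21 + 7)
      (\<lambda>\<tau>. scalar \<tau> ''s'' = ?s)"
    using vals ranges
    by (intro runs_column_dot stores_precomputed_agree[OF pre ag0]) auto
  from runs_agree[OF this] have "runs \<omega> (column_dot ''i'' ''m'' ''a'' ''m'' ''a'') ?\<sigma> (?d * 21 + 7)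
      (\<lambda>\<tau>. scalar \<tau> ''s'' = ?s \<and> agree {''s'', ''p''} {} ?\<sigma> \<tau>)"
    by simp
  then have rest: "runs \<omega> (Seq (column_dot ''i'' ''m'' ''a'' ''m'' ''a'') (For ''b'' ''d'' norm_store)) ?\<sigma>
      (53 * ?d + 12) (?I ?d)"
    by (rule runs_Seq) (use loop in auto)
  have "runs \<omega> (Assign ''m'' (Add (Var ''l'') (Const 1))) \<sigma> 4 (\<lambda>\<tau>. \<tau> = ?\<sigma>)"
    by (rule runs_loop_free) (simp_all add: vals add.commute)
  then show ?thesis
    unfolding norm_row_def
  proof (rule runs_Seq)
    \<comment> \<open>The additive 16 is absorbed using \<open>1 \<le> width S\<close>.\<close>
    show "4 + (53 * ?d + 12) \<le> 69 * ?d"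
      using gnh_settingD(1)[OF S] by simp
  qed (simp only: rest)
qed

text \<open>Absorbs the overhead of a \<open>For\<close> loop into the product of the loop lengths,
  raising the constant by 12. Three nested loops thus lead from 69 through 81 and 93 to 105.\<close>

lemma loop_cost:
  fixes N x K :: nat
  assumes "1 \<le> N" "1 \<le> x"
  shows "N * (K * x + 7) + 5 \<le> (K + 12) * (N * x)"
proof -
  have "N * 1 \<le> N * x"
    using assms(2) by (rule mult_le_mono2)
  then have "7 * N + 5 \<le> 12 * (N * x)"
    using assms(1) by linarith
  then show ?thesis
    by (simp add: algebra_simps)
qed

lemma runs_norm_prog:
  assumes S: "gnh_setting S" and pre: "stores_precomputed S \<sigma>"
  shows "runs \<omega> norm_prog \<sigma> (105 * (ndata S * num_weights S)) (stores_norms S)"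
proof -
  let ?d = "width S" and ?k = "\<lambda>l b a. l * (width S * width S) + b * width S + a"
  note D = gnh_settingD[OF S]
  \<comment> \<open>With rows and layers counted from 0, \<open>?A i l j\<close> holds the entries
    finished after j rows of layer l, and \<open>?L i j\<close> those finished after j layers, all
    for data point i.\<close>
  let ?A = "\<lambda>i l j. (\<lambda>(a, b). (i, ?k l b a)) ` ({..<j} \<times> {..<?d})"
  let ?L = "\<lambda>i j. (\<Union>l<j. ?A i l ?d)"
  have 1: "runs \<omega> (For ''a'' ''d'' norm_row) \<sigma> (81 * (?d * ?d)) (\<lambda>\<sigma>'. norm_ok S \<sigma> \<union> ?A i l ?d \<subseteq> norm_ok S \<sigma>')"
    if pre: "stores_precomputed S \<sigma>" and vals: "scalar \<sigma> ''i'' = real i" "scalar \<sigma> ''l'' = real l"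
      and ranges: "i < ndata S" "l < depth S" for \<sigma> i l
  proof (rule runs_For[where N = ?d and B = "69 * ?d" and I = "\<lambda>j \<tau>. norm_ok S \<sigma> \<union> ?A i l j \<subseteq> norm_ok S \<tau>"])
    show "scalar \<sigma> ''d'' = real ?d"
      using pre by (simp add: stores_precomputed_def)
    show "?d * (69 * ?d + 7) + 5 \<le> 81 * (?d * ?d)"
      using loop_cost[OF D(1) D(1), of 69] by simp
    fix j :: nat and \<tau> :: state assume j: "j < ?d" and I: "norm_ok S \<sigma> \<union> ?A i l j \<subseteq> norm_ok S \<tau>"
      and a: "scalar \<tau> ''a'' = real j" and "agree (insert ''a'' (assigned norm_row)) (stored norm_row) \<sigma> \<tau>"
    then have ag: "agree {''a'', ''m'', ''s'', ''p'', ''b''} {''norm''} \<sigma> \<tau>"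
      by simp
    have "stores_precomputed S \<tau>"
      by (rule stores_precomputed_agree[OF pre ag]) auto
    from runs_norm_row[OF S this _ _ a ranges j, of \<omega>]
    have "runs \<omega> norm_row \<tau> (69 * ?d) (\<lambda>\<sigma>'. norm_ok S \<tau> \<union> (\<lambda>b. (i, ?k l b j)) ` {..<?d} \<subseteq> norm_ok S \<sigma>')"
      using vals agreeD(1)[OF ag] by simp
    then show "runs \<omega> norm_row \<tau> (69 * ?d) (\<lambda>\<tau>'. norm_ok S \<sigma> \<union> ?A i l (Suc j) \<subseteq>
        norm_ok S (\<tau>'\<lparr>scalar := (scalar \<tau>')(''a'' := real (Suc j))\<rparr>))"
    proof (rule runs_mono[OF _ order_refl])
      fix \<tau>' assume grow: "norm_ok S \<tau> \<union> (\<lambda>b. (i, ?k l b j)) ` {..<?d} \<subseteq> norm_ok S \<tau>'"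
      have "{..<Suc j} \<times> {..<?d} = {..<j} \<times> {..<?d} \<union> Pair j ` {..<?d}"
        by (auto simp: lessThan_Suc)
      then have "?A i l (Suc j) = ?A i l j \<union> (\<lambda>b. (i, ?k l b j)) ` {..<?d}"
        by (simp only: image_Un image_image prod.case)
      then show "norm_ok S \<sigma> \<union> ?A i l (Suc j) \<subseteq>
          norm_ok S (\<tau>'\<lparr>scalar := (scalar \<tau>')(''a'' := real (Suc j))\<rparr>)"
        by (rule norm_ok_grow[OF I grow])
    qed
  qed auto
  have 2: "runs \<omega> (For ''l'' ''L'' (For ''a'' ''d'' norm_row)) \<sigma> (93 * (depth S * (?d * ?d)))
      (\<lambda>\<sigma>'. norm_ok S \<sigma> \<union> ?L i (depth S) \<subseteq> norm_ok S \<sigma>')"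
    if pre: "stores_precomputed S \<sigma>" and vals: "scalar \<sigma> ''i'' = real i" and ranges: "i < ndata S" for \<sigma> i
  proof (rule runs_For[where N = "depth S" and B = "81 * (?d * ?d)"
        and I = "\<lambda>j \<tau>. norm_ok S \<sigma> \<union> ?L i j \<subseteq> norm_ok S \<tau>"])
    show "scalar \<sigma> ''L'' = real (depth S)"
      using pre by (simp add: stores_precomputed_def)
    show "depth S * (81 * (?d * ?d) + 7) + 5 \<le> 93 * (depth S * (?d * ?d))"
      using loop_cost[OF D(2), of "?d * ?d" 81] D(1) by simp
    fix j :: nat and \<tau> :: state assume j: "j < depth S" and I: "norm_ok S \<sigma> \<union> ?L i j \<subseteq> norm_ok S \<tau>"
      and l: "scalar \<tau> ''l'' = real j"
      and "agree (insert ''l'' (assigned (For ''a'' ''d'' norm_row))) (stored (For ''a'' ''d'' norm_row)) \<sigma> \<tau>"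
    then have ag: "agree {''l'', ''a'', ''m'', ''s'', ''p'', ''b''} {''norm''} \<sigma> \<tau>"
      by simp
    have "stores_precomputed S \<tau>"
      by (rule stores_precomputed_agree[OF pre ag]) auto
    from 1[OF this _ l ranges j]
    have "runs \<omega> (For ''a'' ''d'' norm_row) \<tau> (81 * (?d * ?d)) (\<lambda>\<sigma>'. norm_ok S \<tau> \<union> ?A i j ?d \<subseteq> norm_ok S \<sigma>')"
      using vals agreeD(1)[OF ag] by simp
    then show "runs \<omega> (For ''a'' ''d'' norm_row) \<tau> (81 * (?d * ?d)) (\<lambda>\<tau>'. norm_ok S \<sigma> \<union> ?L i (Suc j) \<subseteq>
        norm_ok S (\<tau>'\<lparr>scalar := (scalar \<tau>')(''l'' := real (Suc j))\<rparr>))"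
    proof (rule runs_mono[OF _ order_refl])
      fix \<tau>' assume grow: "norm_ok S \<tau> \<union> ?A i j ?d \<subseteq> norm_ok S \<tau>'"
      have "?L i (Suc j) = ?L i j \<union> ?A i j ?d"
        by (simp only: lessThan_Suc UN_insert Un_commute)
      then show "norm_ok S \<sigma> \<union> ?L i (Suc j) \<subseteq>
          norm_ok S (\<tau>'\<lparr>scalar := (scalar \<tau>')(''l'' := real (Suc j))\<rparr>)"
        by (rule norm_ok_grow[OF I grow])
    qed
  qed auto
  have "runs \<omega> norm_prog \<sigma> (105 * (ndata S * (depth S * (?d * ?d)))) (\<lambda>\<sigma>'. (\<Union>i<ndata S. ?L i (depth S)) \<subseteq> norm_ok S \<sigma>')"
    unfolding norm_prog_def
  proof (rule runs_For[where N = "ndata S" and B = "93 * (depth S * (?d * ?d))"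
        and I = "\<lambda>j \<tau>. (\<Union>i<j. ?L i (depth S)) \<subseteq> norm_ok S \<tau>"])
    let ?p = "For ''l'' ''L'' (For ''a'' ''d'' norm_row)"
    show "scalar \<sigma> ''n'' = real (ndata S)"
      using pre by (simp add: stores_precomputed_def)
    show "ndata S * (93 * (depth S * (?d * ?d)) + 7) + 5 \<le> 105 * (ndata S * (depth S * (?d * ?d)))"
      using loop_cost[OF D(3), of "depth S * (?d * ?d)" 93] D(1,2) by simp
    fix j :: nat and \<tau> :: state assume j: "j < ndata S" and I: "(\<Union>i<j. ?L i (depth S)) \<subseteq> norm_ok S \<tau>"
      and i: "scalar \<tau> ''i'' = real j"
      and "agree (insert ''i'' (assigned ?p)) (stored ?p) \<sigma> \<tau>"
    then have ag: "agree {''i'', ''l'', ''a'', ''m'', ''s'', ''p'', ''b''} {''norm''} \<sigma> \<tau>"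
      by simp
    have "stores_precomputed S \<tau>"
      by (rule stores_precomputed_agree[OF pre ag]) auto
    from 2[OF this i j]
    show "runs \<omega> ?p \<tau> (93 * (depth S * (?d * ?d))) (\<lambda>\<tau>'. (\<Union>i<Suc j. ?L i (depth S)) \<subseteq>
        norm_ok S (\<tau>'\<lparr>scalar := (scalar \<tau>')(''i'' := real (Suc j))\<rparr>))"
    proof (rule runs_mono[OF _ order_refl])
      fix \<tau>' assume grow: "norm_ok S \<tau> \<union> ?L j (depth S) \<subseteq> norm_ok S \<tau>'"
      have I': "{} \<union> (\<Union>i<j. ?L i (depth S)) \<subseteq> norm_ok S \<tau>"
        using I by simp
      have "(\<Union>i<Suc j. ?L i (depth S)) = (\<Union>i<j. ?L i (depth S)) \<union> ?L j (depth S)"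
        by (simp only: lessThan_Suc UN_insert Un_commute)
      from norm_ok_grow[OF I' grow this]
      show "(\<Union>i<Suc j. ?L i (depth S)) \<subseteq>
          norm_ok S (\<tau>'\<lparr>scalar := (scalar \<tau>')(''i'' := real (Suc j))\<rparr>)"
        by (simp only: Un_empty_left)
    qed
  qed auto
  then show ?thesis
  proof (rule runs_mono)
    show "105 * (ndata S * (depth S * (?d * ?d))) \<le> 105 * (ndata S * num_weights S)"
      by (simp add: num_weights_def power2_eq_square)
    fix \<sigma>' assume ok: "(\<Union>i<ndata S. ?L i (depth S)) \<subseteq> norm_ok S \<sigma>'"
    show "stores_norms S \<sigma>'"
      unfolding stores_norms_def
    proof (intro allI impI)
      fix i k assume i: "i < ndata S" and k: "k < num_weights S"
      let ?l = "weight_layer S k - 1"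
      \<comment> \<open>The digits of \<open>k\<close> tell at which round of the loops its norm was
        stored, so no entry is missed.\<close>
      have "(i, k) = (\<lambda>(a, b). (i, ?k ?l b a)) (weight_row S k, weight_col S k)"
        using weight_index[OF D(1), of k] by (simp add: power2_eq_square)
      then have "(i, k) \<in> ?A i ?l ?d"
        by (rule image_eqI) (simp add: weight_row_less[OF D(1)] weight_col_less[OF D(1)])
      moreover have "?l < depth S"
        using weight_layer_le[OF k] by linarith
      ultimately have "(i, k) \<in> ?L i (depth S)"
        by (intro UN_I[of ?l]) simp_all
      then have "(i, k) \<in> (\<Union>i<ndata S. ?L i (depth S))"
        by (rule UN_I[OF lessThan_iff[THEN iffD2, OF i]])
      from subsetD[OF ok this] show "arr \<sigma>' ''norm'' [i, k] = norm_vec (v_part S k i)"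
        by (simp add: norm_ok_def)
    qed
  qed
qed

section \<open>Computing an estimator\<close>

lemma to_index_minus_1 [simp]: "to_index (real l - 1) = l - 1"
  by (cases l) (simp_all add: to_index_def)

lemma runs_Assign_Seq:
  assumes "runs \<omega> p (\<sigma>\<lparr>scalar := (scalar \<sigma>)(x := eval_expr \<sigma> e)\<rparr>) B Q" "B + expr_work e + 1 \<le> B'"
  shows "runs \<omega> (Seq (Assign x e) p) \<sigma> B' Q"
proof -
  have "runs \<omega> (Assign x e) \<sigma> (1 + expr_work e) (\<lambda>\<tau>. \<tau> = \<sigma>\<lparr>scalar := (scalar \<sigma>)(x := eval_expr \<sigma> e)\<rparr>)"
    by (rule runs_loop_free) simp_all
  then show ?thesis
    by (rule runs_Seq) (use assms in auto)
qed

definition ready :: "'y network \<Rightarrow> nat \<Rightarrow> nat \<Rightarrow> nat \<Rightarrow> state \<Rightarrow> bool" where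
  "ready S k m c \<sigma> \<longleftrightarrow> stores_precomputed S \<sigma> \<and> stores_norms S \<sigma> \<and> stores_query k m c \<sigma>"

lemma ready_agree:
  assumes "ready S k m c \<sigma>" "agree X Y \<sigma> \<tau>"
    "{''d'', ''L'', ''n'', ''k'', ''m'', ''c''} \<inter> X = {}" "{''x'', ''C'', ''norm''} \<inter> Y = {}"
  shows "ready S k m c \<tau>"
proof -
  have "stores_precomputed S \<tau>"
    by (rule stores_precomputed_agree[OF _ assms(2)]) (use assms in \<open>auto simp: ready_def\<close>)
  moreover have "stores_norms S \<tau>"
    by (rule stores_norms_agree[OF _ assms(2)]) (use assms in \<open>auto simp: ready_def\<close>)
  moreover have "''k'' \<notin> X" "''m'' \<notin> X" "''c'' \<notin> X"
    using assms(3) by auto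
  then have "stores_query k m c \<tau>"
    using assms(1) by (simp add: ready_def stores_query_def agreeD(1)[OF assms(2)])
  ultimately show ?thesis
    by (simp add: ready_def)
qed

lemma readyD:
  assumes "ready S k m c \<sigma>"
  shows "stores_precomputed S \<sigma>" "stores_norms S \<sigma>" "stores_query k m c \<sigma>"
    "scalar \<sigma> ''d'' = real (width S)" "scalar \<sigma> ''n'' = real (ndata S)"
    "scalar \<sigma> ''k'' = real k" "scalar \<sigma> ''m'' = real m" "scalar \<sigma> ''c'' = real c"
    "i < ndata S \<Longrightarrow> k' < num_weights S \<Longrightarrow> arr \<sigma> ''norm'' [i, k'] = norm_vec (v_part S k' i)"
  using assms by (auto simp: ready_def stores_precomputed_def stores_norms_def stores_query_def)

text \<open>Quotients are obtained as \<open>Floor\<close> of \<open>Div\<close>, remainders by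
  subtracting the multiple again. The scalar \<open>r\<close> holds the position inside the block of
  \<open>d\<^sup>2\<close> weights.\<close>

definition decode :: "string \<Rightarrow> string \<Rightarrow> string \<Rightarrow> string \<Rightarrow> prog" where
  "decode vk vl vb va =
     Seq (Assign vl (Add (Floor (Div (Var vk) (Mul (Var ''d'') (Var ''d'')))) (Const 1)))
    (Seq (Assign ''r'' (Sub (Var vk) (Mul (Sub (Var vl) (Const 1)) (Mul (Var ''d'') (Var ''d'')))))
    (Seq (Assign vb (Floor (Div (Var ''r'') (Var ''d''))))
         (Assign va (Sub (Var ''r'') (Mul (Var vb) (Var ''d''))))))"

definition decoded :: "'y network \<Rightarrow> nat \<Rightarrow> string \<Rightarrow> string \<Rightarrow> string \<Rightarrow> state \<Rightarrow> bool" where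
  "decoded S k vl vb va \<sigma> \<longleftrightarrow> scalar \<sigma> vl = real (weight_layer S k) \<and>
     scalar \<sigma> vb = real (weight_col S k) \<and> scalar \<sigma> va = real (weight_row S k)"

lemma real_minus_div_mult: "real k - real (k div n) * real n = real (k mod n)"
proof -
  have "real (k div n) * real n + real (k mod n) = real k"
    by (metis div_mult_mod_eq of_nat_add of_nat_mult)
  then show ?thesis
    by linarith
qed

lemma runs_decode:
  assumes "scalar \<sigma> ''d'' = real (width S)" "scalar \<sigma> vk = real k"
    and names: "distinct [vl, ''r'', vb, va]" "vk \<notin> {vl, ''r'', vb, va}" "''d'' \<notin> {vl, ''r'', vb, va}"
  shows "runs \<omega> (decode vk vl vb va) \<sigma> 50 (decoded S k vl vb va)"
proof (rule runs_loop_free)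
  let ?D = "width S * width S"
  have "\<lfloor>real k / (real (width S) * real (width S))\<rfloor> = int (k div ?D)"
    using floor_divide_of_nat_eq[of k ?D] by simp
  moreover have "real k - real (k div ?D) * (real (width S) * real (width S)) = real (k mod ?D)"
    using real_minus_div_mult[of k ?D] by simp
  moreover have "\<lfloor>real (k mod ?D) / real (width S)\<rfloor> = int (k mod ?D div width S)"
    using floor_divide_of_nat_eq[of "k mod ?D" "width S"] by simp
  moreover have "real (k mod ?D) - real (k mod ?D div width S) * real (width S) = real (k mod width S)"
    using real_minus_div_mult[of "k mod ?D" "width S"] by (simp add: mod_mod_cancel)
  ultimately show "decoded S k vl vb va (eff \<omega> (decode vk vl vb va) \<sigma>)"
    using names assms(1,2)
    by (simp add: decode_def decoded_def weight_layer_def weight_col_def weight_row_def power2_eq_square)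
qed (simp_all add: decode_def)

lemma decode_frame [simp]:
  "assigned (decode vk vl vb va) = {vl, ''r'', vb, va}" "stored (decode vk vl vb va) = {}"
  "draw_free (decode vk vl vb va)"
  by (auto simp: decode_def)

definition norm_product :: expr where
  "norm_product = Mul (Elem ''norm'' [Var ''i'', Var ''k'']) (Elem ''norm'' [Var ''i'', Var ''m''])"

definition total_prog :: prog where
  "total_prog = Seq (Assign ''total'' (Const 0))
     (For ''i'' ''n'' (Assign ''total'' (Add (Var ''total'') norm_product)))"

lemma total_prog_frame [simp]:
  "assigned total_prog = {''total'', ''i''}" "stored total_prog = {}" "draw_free total_prog"
  by (auto simp: total_prog_def)

lemma norm_product_work [simp]: "expr_work norm_product = 7"
  by (simp add: norm_product_def)

lemma eval_norm_product:
  assumes "ready S k m c \<sigma>" "scalar \<sigma> ''i'' = real i" "i < ndata S" "k < num_weights S" "m < num_weights S"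
  shows "eval_expr \<sigma> norm_product = norm_vec (v_part S k i) * norm_vec (v_part S m i)"
  using readyD[OF assms(1)] assms(2-) by (simp add: norm_product_def)

lemma runs_total_prog:
  assumes ready: "ready S k m c \<sigma>" and km: "k < num_weights S" "m < num_weights S"
  shows "runs \<omega> total_prog \<sigma> (ndata S * 17 + 7)
    (\<lambda>\<tau>. scalar \<tau> ''total'' = (\<Sum>i<ndata S. norm_vec (v_part S k i) * norm_vec (v_part S m i)))"
proof -
  let ?w = "\<lambda>i. norm_vec (v_part S k i) * norm_vec (v_part S m i)"
  let ?\<sigma> = "\<sigma>\<lparr>scalar := (scalar \<sigma>)(''total'' := 0)\<rparr>"
  let ?p = "Assign ''total'' (Add (Var ''total'') norm_product)"
  have ready': "ready S k m c ?\<sigma>"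
    by (rule ready_agree[OF ready, of "{''total''}" "{}"]) (auto simp: agree_def)
  have loop: "runs \<omega> (For ''i'' ''n'' ?p) ?\<sigma> (ndata S * 17 + 5) (\<lambda>\<tau>. scalar \<tau> ''total'' = (\<Sum>i<ndata S. ?w i))"
  proof (rule runs_For[where N = "ndata S" and B = 10 and I = "\<lambda>j \<tau>. scalar \<tau> ''total'' = (\<Sum>i<j. ?w i)"])
    show "scalar ?\<sigma> ''n'' = real (ndata S)"
      by (rule readyD[OF ready'])
    fix j :: nat and \<tau> :: state
    assume j: "j < ndata S" "scalar \<tau> ''total'' = (\<Sum>i<j. ?w i)" "scalar \<tau> ''i'' = real j"
      and "agree (insert ''i'' (assigned ?p)) (stored ?p) ?\<sigma> \<tau>"
    then have ag: "agree {''i'', ''total''} {} ?\<sigma> \<tau>"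
      by simp
    have "ready S k m c \<tau>"
      by (rule ready_agree[OF ready' ag]) auto
    then have "eval_expr \<tau> norm_product = ?w j"
      using j km by (rule_tac eval_norm_product) auto
    then show "runs \<omega> ?p \<tau> 10
        (\<lambda>\<tau>'. scalar (\<tau>'\<lparr>scalar := (scalar \<tau>')(''i'' := real (Suc j))\<rparr>) ''total'' = (\<Sum>i<Suc j. ?w i))"
      by (intro runs_loop_free) (simp_all add: j)
  qed auto
  show ?thesis
    unfolding total_prog_def by (rule runs_Assign_Seq[where B = "ndata S * 17 + 5"]) (use loop in simp_all)
qed

section \<open>Building the alias table\<close>

definition stack :: "string \<Rightarrow> string \<Rightarrow> nat list \<Rightarrow> state \<Rightarrow> bool" where
  "stack A v xs \<sigma> \<longleftrightarrow> scalar \<sigma> v = real (length xs) \<and> (\<forall>i<length xs. arr \<sigma> A [i] = real (xs ! i))"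

lemma stack_push:
  assumes "\<forall>i<length xs. arr \<sigma> A [i] = real (xs ! i)"
    "scalar \<tau> v = real (length xs) + 1" "arr \<tau> A = (arr \<sigma> A)([length xs] := real x)"
  shows "stack A v (xs @ [x]) \<tau>"
  using assms by (auto simp: stack_def nth_append less_Suc_eq)

lemma stack_snoc:
  assumes "stack A v (xs @ [x]) \<sigma>"
  shows "scalar \<sigma> v = real (length xs) + 1" "arr \<sigma> A [length xs] = real x"
    "\<forall>i<length xs. arr \<sigma> A [i] = real (xs ! i)"
proof -
  have *: "\<forall>i<Suc (length xs). arr \<sigma> A [i] = real ((xs @ [x]) ! i)" and
    "scalar \<sigma> v = real (Suc (length xs))"
    using assms by (auto simp: stack_def)
  then show "scalar \<sigma> v = real (length xs) + 1"
    by simp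
  show "arr \<sigma> A [length xs] = real x"
    using *[rule_format, of "length xs"] by simp
  show "\<forall>i<length xs. arr \<sigma> A [i] = real (xs ! i)"
    using * by (auto simp: nth_append dest: less_SucI)
qed

text \<open>The array \<open>S\<close> holds the small cells and \<open>B\<close> the big ones,
  bottom first, with heights \<open>sp\<close> and \<open>bp\<close>. A weight of exactly 1 counts
  as large, in agreement with \<open>alias_inv\<close>.\<close>

definition push :: "string \<Rightarrow> prog" where
  "push x = If (Less (Elem ''q'' [Var x]) (Const 1))
     (Seq (Store ''S'' [Var ''sp''] (Var x)) (Assign ''sp'' (Add (Var ''sp'') (Const 1))))
     (Seq (Store ''B'' [Var ''bp''] (Var x)) (Assign ''bp'' (Add (Var ''bp'') (Const 1))))"

definition init_body :: prog where
  "init_body = Seq (Store ''q'' [Var ''i''] (Mul (Var ''n'') (Div norm_product (Var ''total''))))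
     (Seq (Store ''al'' [Var ''i''] (Var ''i'')) (push ''i''))"

definition init_prog :: prog where
  "init_prog = Seq (Assign ''sp'' (Const 0)) (Seq (Assign ''bp'' (Const 0)) (For ''i'' ''n'' init_body))"

lemma init_frame [simp]:
  "assigned init_body = {''sp'', ''bp''}" "stored init_body = {''q'', ''al'', ''S'', ''B''}"
  "assigned init_prog = {''sp'', ''bp'', ''i''}" "stored init_prog = {''q'', ''al'', ''S'', ''B''}"
  "draw_free init_prog"
  by (auto simp: init_prog_def init_body_def push_def)

definition stores_table :: "nat \<Rightarrow> (nat \<Rightarrow> real) \<Rightarrow> (nat \<Rightarrow> nat) \<Rightarrow> state \<Rightarrow> bool" where
  "stores_table n q al \<sigma> \<longleftrightarrow> (\<forall>s<n. arr \<sigma> ''q'' [s] = q s \<and> arr \<sigma> ''al'' [s] = real (al s))"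

definition init_inv :: "(nat \<Rightarrow> real) \<Rightarrow> nat \<Rightarrow> state \<Rightarrow> bool" where
  "init_inv q0 j \<tau> \<longleftrightarrow> (\<exists>xs ys. stack ''S'' ''sp'' xs \<tau> \<and> stack ''B'' ''bp'' ys \<tau> \<and> distinct (xs @ ys) \<and>
     set xs = {s. s < j \<and> q0 s < 1} \<and> set ys = {s. s < j \<and> 1 \<le> q0 s} \<and> stores_table j q0 (\<lambda>s. s) \<tau>)"

lemma runs_init_body:
  assumes ready: "ready S k m c \<tau>" and km: "k < num_weights S" "m < num_weights S"
    and total: "scalar \<tau> ''total'' = (\<Sum>i<ndata S. norm_vec (v_part S k i) * norm_vec (v_part S m i))"
    and j: "j < ndata S" "scalar \<tau> ''i'' = real j"
    and inv: "init_inv (\<lambda>s. real (ndata S) * sample_prob S k m s) j \<tau>"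
  shows "runs \<omega> init_body \<tau> 60 (\<lambda>\<tau>'. init_inv (\<lambda>s. real (ndata S) * sample_prob S k m s) (Suc j)
     (\<tau>'\<lparr>scalar := (scalar \<tau>')(''i'' := real (Suc j))\<rparr>))"
proof (rule runs_loop_free)
  let ?q = "\<lambda>s. real (ndata S) * sample_prob S k m s"
  let ?e = "eff \<omega> init_body \<tau>"
  let ?e' = "?e\<lparr>scalar := (scalar ?e)(''i'' := real (Suc j))\<rparr>"
  obtain xs ys where I: "stack ''S'' ''sp'' xs \<tau>" "stack ''B'' ''bp'' ys \<tau>" "distinct (xs @ ys)"
    "set xs = {s. s < j \<and> ?q s < 1}" "set ys = {s. s < j \<and> 1 \<le> ?q s}" "stores_table j ?q (\<lambda>s. s) \<tau>"
    using inv unfolding init_inv_def by blast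
  have "real (ndata S) * (eval_expr \<tau> norm_product / scalar \<tau> ''total'') = ?q j"
    unfolding eval_norm_product[OF ready j(2,1) km] total sample_prob_def ..
  then have val: "real (ndata S) * eval_expr \<tau> norm_product / scalar \<tau> ''total'' = ?q j"
    by simp
  have sp: "scalar \<tau> ''sp'' = real (length xs)" "scalar \<tau> ''bp'' = real (length ys)"
    using I(1,2) by (auto simp: stack_def)
  note simps = init_body_def push_def j(2) readyD(5)[OF ready] val sp
  have e: "arr ?e' ''q'' = (arr \<tau> ''q'')([j] := ?q j)" "arr ?e' ''al'' = (arr \<tau> ''al'')([j] := real j)"
    by (auto simp: simps)
  have tab: "stores_table (Suc j) ?q (\<lambda>s. s) ?e'"
    using I(6) unfolding stores_table_def e by (auto simp: less_Suc_eq)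
  have new: "j \<notin> set (xs @ ys)"
    unfolding set_append I(4,5) by simp
  show "init_inv ?q (Suc j) ?e'"
  proof (cases "?q j < 1")
    case True
    have f: "arr ?e' ''S'' = (arr \<tau> ''S'')([length xs] := real j)" "scalar ?e' ''sp'' = real (length xs) + 1"
        "arr ?e' ''B'' = arr \<tau> ''B''" "scalar ?e' ''bp'' = scalar \<tau> ''bp''"
      using True by (simp_all add: simps)
    have "stack ''S'' ''sp'' (xs @ [j]) ?e'"
      using I(1) by (intro stack_push[OF _ f(2,1)]) (simp add: stack_def)
    moreover have "stack ''B'' ''bp'' ys ?e'"
      using I(2) unfolding stack_def f(3,4) .
    moreover have "distinct ((xs @ [j]) @ ys)"
      using I(3) new by auto
    moreover have "set (xs @ [j]) = {s. s < Suc j \<and> ?q s < 1}"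
      using True unfolding set_append I(4) by (auto simp: less_Suc_eq)
    moreover have "set ys = {s. s < Suc j \<and> 1 \<le> ?q s}"
      using True unfolding I(5) by (auto simp: less_Suc_eq)
    ultimately show ?thesis
      using tab unfolding init_inv_def by blast
  next
    case False
    have f: "arr ?e' ''B'' = (arr \<tau> ''B'')([length ys] := real j)" "scalar ?e' ''bp'' = real (length ys) + 1"
        "arr ?e' ''S'' = arr \<tau> ''S''" "scalar ?e' ''sp'' = scalar \<tau> ''sp''"
      using False by (simp_all add: simps)
    have "stack ''B'' ''bp'' (ys @ [j]) ?e'"
      using I(2) by (intro stack_push[OF _ f(2,1)]) (simp add: stack_def)
    moreover have "stack ''S'' ''sp'' xs ?e'"
      using I(1) unfolding stack_def f(3,4) .
    moreover have "distinct (xs @ (ys @ [j]))"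
      using I(3) new by auto
    moreover have "set xs = {s. s < Suc j \<and> ?q s < 1}"
      using False unfolding I(4) by (auto simp: less_Suc_eq)
    moreover have "set (ys @ [j]) = {s. s < Suc j \<and> 1 \<le> ?q s}"
      using False unfolding set_append I(5) by (auto simp: less_Suc_eq)
    ultimately show ?thesis
      using tab unfolding init_inv_def by blast
  qed
qed (simp_all add: init_body_def push_def)

lemma runs_init_prog:
  assumes ready: "ready S k m c \<sigma>" and km: "k < num_weights S" "m < num_weights S"
    and total: "scalar \<sigma> ''total'' = (\<Sum>i<ndata S. norm_vec (v_part S k i) * norm_vec (v_part S m i))"
  shows "runs \<omega> init_prog \<sigma> (ndata S * 67 + 9)
    (init_inv (\<lambda>s. real (ndata S) * sample_prob S k m s) (ndata S))"
proof -
  let ?q = "\<lambda>s. real (ndata S) * sample_prob S k m s"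
  let ?\<sigma> = "\<sigma>\<lparr>scalar := (scalar \<sigma>)(''sp'' := 0, ''bp'' := 0)\<rparr>"
  have ready': "ready S k m c ?\<sigma>"
    by (rule ready_agree[OF ready, of "{''sp'', ''bp''}" "{}"]) (auto simp: agree_def)
  have loop: "runs \<omega> (For ''i'' ''n'' init_body) ?\<sigma> (ndata S * 67 + 5) (init_inv ?q (ndata S))"
  proof (rule runs_For[where N = "ndata S" and B = 60 and I = "init_inv ?q"])
    show "scalar ?\<sigma> ''n'' = real (ndata S)"
      by (rule readyD[OF ready'])
    show "init_inv ?q 0 (?\<sigma>\<lparr>scalar := (scalar ?\<sigma>)(''i'' := 0)\<rparr>)"
      unfolding init_inv_def by (intro exI[of _ "[]"]) (simp add: stack_def stores_table_def)
    fix j :: nat and \<tau> :: state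
    assume j: "j < ndata S" "init_inv ?q j \<tau>" "scalar \<tau> ''i'' = real j"
      and "agree (insert ''i'' (assigned init_body)) (stored init_body) ?\<sigma> \<tau>"
    then have ag: "agree {''i'', ''sp'', ''bp''} {''q'', ''al'', ''S'', ''B''} ?\<sigma> \<tau>"
      by simp
    have "ready S k m c \<tau>"
      by (rule ready_agree[OF ready' ag]) auto
    then show "runs \<omega> init_body \<tau> 60 (\<lambda>\<tau>'. init_inv ?q (Suc j)
       (\<tau>'\<lparr>scalar := (scalar \<tau>')(''i'' := real (Suc j))\<rparr>))"
      by (rule runs_init_body[OF _ km _ j(1,3,2)]) (simp add: agreeD(1)[OF ag] total)
  qed auto
  show ?thesis
    unfolding init_prog_def
    by (intro runs_Assign_Seq[where B = "ndata S * 67 + 7"] runs_Assign_Seq[where B = "ndata S * 67 + 5"])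
      (use loop in simp_all)
qed

definition alias_body :: prog where
  "alias_body = Seq (Assign ''e'' (Elem ''S'' [Sub (Var ''sp'') (Const 1)]))
    (Seq (Assign ''h'' (Elem ''B'' [Sub (Var ''bp'') (Const 1)]))
    (Seq (Store ''al'' [Var ''e''] (Var ''h''))
    (Seq (Store ''q'' [Var ''h''] (Sub (Elem ''q'' [Var ''h'']) (Sub (Const 1) (Elem ''q'' [Var ''e'']))))
    (Seq (Assign ''sp'' (Sub (Var ''sp'') (Const 1)))
    (Seq (Assign ''bp'' (Sub (Var ''bp'') (Const 1))) (push ''h''))))))"

text \<open>A test is a single comparison, so the conjunction of two nonempty stacks is expressed by
  a positive product of their heights.\<close>

definition alias_prog :: prog where
  "alias_prog = While (Less (Const 0) (Mul (Var ''sp'') (Var ''bp''))) alias_body"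

lemma alias_frame [simp]:
  "assigned alias_prog = {''e'', ''h'', ''sp'', ''bp''}" "stored alias_prog = {''q'', ''al'', ''S'', ''B''}"
  "draw_free alias_prog"
  by (auto simp: alias_prog_def alias_body_def push_def)

text \<open>Two pops are followed by one push, so each round closes one cell for good; this decrease
  bounds the loop.\<close>

lemma runs_alias_body:
  assumes st: "stack ''S'' ''sp'' (xs @ [s]) \<tau>" "stack ''B'' ''bp'' (ys @ [l]) \<tau>"
    and tab: "stores_table n q al \<tau>" and inv: "alias_inv n q0 q al (xs @ [s]) (ys @ [l])"
  shows "runs \<omega> alias_body \<tau> 60 (\<lambda>\<tau>'. \<exists>xs' ys' q' al'. length xs' + length ys' = Suc (length xs + length ys) \<and>
    stack ''S'' ''sp'' xs' \<tau>' \<and> stack ''B'' ''bp'' ys' \<tau>' \<and> stores_table n q' al' \<tau>' \<and>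
    alias_inv n q0 q' al' xs' ys')"
proof (rule runs_loop_free)
  let ?e = "eff \<omega> alias_body \<tau>"
  define q' al' where "q' = q(l := q l - (1 - q s))" and "al' = al(s := l)"
  have sl: "s < n" "l < n" "s \<noteq> l"
    using inv by (auto simp: alias_inv_def)
  note S = stack_snoc[OF st(1)] and B = stack_snoc[OF st(2)]
  have t: "arr \<tau> ''q'' [s] = q s" "arr \<tau> ''q'' [l] = q l"
    using tab sl by (auto simp: stores_table_def)
  note simps = alias_body_def push_def S(1,2) B(1,2) t sl
  have e: "arr ?e ''q'' = (arr \<tau> ''q'')([l] := q l - (1 - q s))" "arr ?e ''al'' = (arr \<tau> ''al'')([s] := real l)"
    by (auto simp: simps)
  have tab': "stores_table n q' al' ?e"
    using tab unfolding stores_table_def e by (auto simp: q'_def al'_def)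
  show "\<exists>xs' ys' q' al'. length xs' + length ys' = Suc (length xs + length ys) \<and>
    stack ''S'' ''sp'' xs' ?e \<and> stack ''B'' ''bp'' ys' ?e \<and> stores_table n q' al' ?e \<and>
    alias_inv n q0 q' al' xs' ys'"
  proof (cases "q' l < 1")
    case True
    then have "q l - (1 - q s) < 1"
      by (simp add: q'_def)
    then have f: "arr ?e ''S'' = (arr \<tau> ''S'')([length xs] := real l)" "scalar ?e ''sp'' = real (length xs) + 1"
        "arr ?e ''B'' = arr \<tau> ''B''" "scalar ?e ''bp'' = real (length ys)"
      by (simp_all add: simps)
    have "stack ''S'' ''sp'' (xs @ [l]) ?e"
      by (rule stack_push[OF S(3) f(2,1)])
    moreover have "stack ''B'' ''bp'' ys ?e"
      using B(3) unfolding stack_def f(3,4) by blast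
    moreover have "alias_inv n q0 q' al' (xs @ [l]) ys"
      using alias_inv_step(1)[OF inv] True unfolding q'_def al'_def by blast
    moreover have "length (xs @ [l]) + length ys = Suc (length xs + length ys)"
      by simp
    ultimately show ?thesis
      using tab' by blast
  next
    case False
    then have "\<not> q l - (1 - q s) < 1"
      by (simp add: q'_def)
    then have f: "arr ?e ''B'' = (arr \<tau> ''B'')([length ys] := real l)" "scalar ?e ''bp'' = real (length ys) + 1"
        "arr ?e ''S'' = arr \<tau> ''S''" "scalar ?e ''sp'' = real (length xs)"
      by (simp_all add: simps)
    have "stack ''B'' ''bp'' (ys @ [l]) ?e"
      by (rule stack_push[OF B(3) f(2,1)])
    moreover have "stack ''S'' ''sp'' xs ?e"
      using S(3) unfolding stack_def f(3,4) by blast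
    moreover have "alias_inv n q0 q' al' xs (ys @ [l])"
      using alias_inv_step(2)[OF inv] False unfolding q'_def al'_def not_less by blast
    moreover have "length xs + length (ys @ [l]) = Suc (length xs + length ys)"
      by simp
    ultimately show ?thesis
      using tab' by blast
  qed
qed (simp_all add: alias_body_def push_def)

text \<open>The variant is the total height of both stacks. Their entries are distinct and below n,
  so it starts at n or less. A round costs 60 units for the body and 5 for the test.\<close>

lemma runs_alias_prog:
  assumes q0: "\<And>s. s < n \<Longrightarrow> 0 \<le> q0 s" "(\<Sum>s<n. q0 s) = real n" and init: "init_inv q0 n \<sigma>"
  shows "runs \<omega> alias_prog \<sigma> (n * 65 + 5) (\<lambda>\<tau>. \<exists>q al. alias_table n q0 q al \<and> stores_table n q al \<tau>)"
proof -
  define I where "I v \<tau> \<longleftrightarrow> (\<exists>xs ys q al. v = length xs + length ys \<and> stack ''S'' ''sp'' xs \<tau> \<and>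
    stack ''B'' ''bp'' ys \<tau> \<and> stores_table n q al \<tau> \<and> alias_inv n q0 q al xs ys)" for v \<tau>
  obtain xs ys where s: "stack ''S'' ''sp'' xs \<sigma>" "stack ''B'' ''bp'' ys \<sigma>" "distinct (xs @ ys)"
     "set xs = {s. s < n \<and> q0 s < 1}" "set ys = {s. s < n \<and> 1 \<le> q0 s}" "stores_table n q0 (\<lambda>s. s) \<sigma>"
    using init unfolding init_inv_def by blast
  have "alias_inv n q0 q0 (\<lambda>s. s) xs ys"
    using s(3-5) q0(1) by (intro alias_inv_init) auto
  then have I0: "I (length xs + length ys) \<sigma>"
    using s unfolding I_def by blast
  have "length (xs @ ys) = card (set (xs @ ys))"
    using s(3) by (simp only: distinct_card)
  also have "\<dots> \<le> card {..<n}"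
    unfolding set_append s(4,5) by (intro card_mono) auto
  finally have len: "length xs + length ys \<le> n"
    by simp
  have test: "eval_test \<tau> (Less (Const 0) (Mul (Var ''sp'') (Var ''bp''))) \<longleftrightarrow> xs \<noteq> [] \<and> ys \<noteq> []"
    if "stack ''S'' ''sp'' xs \<tau>" "stack ''B'' ''bp'' ys \<tau>" for xs ys \<tau>
    using that by (simp add: stack_def zero_less_mult_iff)
  show ?thesis
    unfolding alias_prog_def
  proof (rule runs_While[where I = I and B = 60, OF I0])
    fix v \<tau> assume "I v \<tau>" and b: "eval_test \<tau> (Less (Const 0) (Mul (Var ''sp'') (Var ''bp'')))"
    then obtain xs ys q al where v: "v = length xs + length ys" and st: "stack ''S'' ''sp'' xs \<tau>"
      "stack ''B'' ''bp'' ys \<tau>" "stores_table n q al \<tau>" "alias_inv n q0 q al xs ys"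
      unfolding I_def by blast
    then obtain xs' s ys' l where xy: "xs = xs' @ [s]" "ys = ys' @ [l]"
      using b test[OF st(1,2)] by (metis rev_exhaust)
    have "Suc (length xs' + length ys') < v"
      by (simp add: v xy)
    then show "runs \<omega> alias_body \<tau> 60 (\<lambda>\<tau>'. \<exists>v'<v. I v' \<tau>')"
      by (intro runs_mono[OF runs_alias_body[OF st[unfolded xy]] order_refl]) (unfold I_def, metis)
  next
    fix v \<tau> assume "I v \<tau>" and b: "\<not> eval_test \<tau> (Less (Const 0) (Mul (Var ''sp'') (Var ''bp'')))"
    then obtain xs ys q al where st: "stack ''S'' ''sp'' xs \<tau>"
      "stack ''B'' ''bp'' ys \<tau>" "stores_table n q al \<tau>" "alias_inv n q0 q al xs ys"
      unfolding I_def by blast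
    then have "alias_table n q0 q al"
      using b test[OF st(1,2)] q0(2) by (intro alias_inv_final[of n q0 q al xs ys]) auto
    then show "\<exists>q al. alias_table n q0 q al \<and> stores_table n q al \<tau>"
      using st(3) by blast
  next
    have "(length xs + length ys) * 65 \<le> n * 65"
      using len by (rule mult_le_mono1)
    then show "(length xs + length ys) * (test_work (Less (Const 0) (Mul (Var ''sp'') (Var ''bp''))) + 60) +
        test_work (Less (Const 0) (Mul (Var ''sp'') (Var ''bp''))) \<le> n * 65 + 5"
      by simp
  qed
qed

section \<open>The preparation before the first draw\<close>

lemma decoded_agree:
  assumes "decoded S k vl vb va \<sigma>" "agree X Y \<sigma> \<tau>" "{vl, vb, va} \<inter> X = {}"
  shows "decoded S k vl vb va \<tau>"
proof -
  have "vl \<notin> X" "vb \<notin> X" "va \<notin> X"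
    using assms(3) by auto
  then show ?thesis
    using assms(1) by (simp add: decoded_def agreeD(1)[OF assms(2)])
qed

definition norm_total :: "'y network \<Rightarrow> nat \<Rightarrow> nat \<Rightarrow> real" where
  "norm_total S k m = (\<Sum>i<ndata S. norm_vec (v_part S k i) * norm_vec (v_part S m i))"

definition prepared :: "'y network \<Rightarrow> nat \<Rightarrow> nat \<Rightarrow> nat \<Rightarrow> state \<Rightarrow> bool" where
  "prepared S k m c \<sigma> \<longleftrightarrow> ready S k m c \<sigma> \<and> decoded S k ''lk'' ''bk'' ''ak'' \<sigma> \<and>
     decoded S m ''lm'' ''bm'' ''am'' \<sigma> \<and> scalar \<sigma> ''total'' = norm_total S k m"

lemma prepared_agree:
  assumes "prepared S k m c \<sigma>" "agree X Y \<sigma> \<tau>"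
    "{''d'', ''L'', ''n'', ''k'', ''m'', ''c'', ''lk'', ''bk'', ''ak'', ''lm'', ''bm'', ''am'', ''total''} \<inter> X = {}"
    "{''x'', ''C'', ''norm''} \<inter> Y = {}"
  shows "prepared S k m c \<tau>"
  unfolding prepared_def
proof (intro conjI)
  show "ready S k m c \<tau>"
    by (rule ready_agree[OF _ assms(2) _ assms(4)]) (use assms(1,3) in \<open>auto simp: prepared_def\<close>)
  show "decoded S k ''lk'' ''bk'' ''ak'' \<tau>" "decoded S m ''lm'' ''bm'' ''am'' \<tau>"
    by (rule decoded_agree[OF _ assms(2)]; use assms(1,3) in \<open>auto simp: prepared_def\<close>)+
  have "''total'' \<notin> X"
    using assms(3) by auto
  then show "scalar \<tau> ''total'' = norm_total S k m"
    using assms(1) by (simp add: prepared_def agreeD(1)[OF assms(2)])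
qed

definition prep_prog :: prog where
  "prep_prog = Seq (decode ''k'' ''lk'' ''bk'' ''ak'') (Seq (decode ''m'' ''lm'' ''bm'' ''am'')
     (Seq total_prog (Seq init_prog alias_prog)))"

lemma sum_sample_prob:
  assumes "norm_total S k m \<noteq> 0"
  shows "(\<Sum>i<ndata S. real (ndata S) * sample_prob S k m i) = real (ndata S)"
proof -
  have "(\<Sum>i<ndata S. sample_prob S k m i) = norm_total S k m / norm_total S k m"
    unfolding sample_prob_def sum_divide_distrib[symmetric] norm_total_def ..
  then show ?thesis
    using assms by (simp add: sum_distrib_left[symmetric])
qed

lemma norm_total_nonneg: "0 \<le> norm_total S k m"
  unfolding norm_total_def by (intro sum_nonneg mult_nonneg_nonneg norm_vec_nonneg)

lemma sample_prob_nonneg: "0 \<le> sample_prob S k m i"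
  using norm_total_nonneg[of S k m] by (simp add: sample_prob_def norm_total_def)

text \<open>Each data point costs 17 units for the normalising sum, 67 for the initial stacks and 65
  for the pairing of cells; the rest is constant, mostly for decoding the two weight
  indices.\<close>

lemma runs_prep_prog:
  assumes ready: "ready S k m c \<sigma>" and km: "k < num_weights S" "m < num_weights S"
    and total: "norm_total S k m \<noteq> 0"
  shows "runs \<omega> prep_prog \<sigma> (ndata S * 149 + 121) (\<lambda>\<tau>. prepared S k m c \<tau> \<and>
    (\<exists>q al. alias_table (ndata S) (\<lambda>s. real (ndata S) * sample_prob S k m s) q al \<and>
      stores_table (ndata S) q al \<tau>))"
proof -
  let ?q0 = "\<lambda>s. real (ndata S) * sample_prob S k m s"
  let ?Q1 = "\<lambda>\<tau>. ready S k m c \<tau> \<and> decoded S k ''lk'' ''bk'' ''ak'' \<tau>"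
  let ?Q2 = "\<lambda>\<tau>. ?Q1 \<tau> \<and> decoded S m ''lm'' ''bm'' ''am'' \<tau>"
  let ?Q4 = "\<lambda>\<tau>. prepared S k m c \<tau> \<and> init_inv ?q0 (ndata S) \<tau>"
  have 1: "runs \<omega> (decode ''k'' ''lk'' ''bk'' ''ak'') \<sigma> 50 ?Q1"
  proof (rule runs_mono[OF runs_agree[OF runs_decode] order_refl])
    fix \<tau> assume A: "decoded S k ''lk'' ''bk'' ''ak'' \<tau> \<and> agree (assigned (decode ''k'' ''lk'' ''bk'' ''ak''))
      (stored (decode ''k'' ''lk'' ''bk'' ''ak'')) \<sigma> \<tau>"
    then have "ready S k m c \<tau>"
      by (intro ready_agree[OF ready]) auto
    then show "?Q1 \<tau>"
      using A by blast
  qed (use readyD[OF ready] in auto)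
  have 2: "runs \<omega> (decode ''m'' ''lm'' ''bm'' ''am'') \<sigma>1 50 ?Q2" if Q: "?Q1 \<sigma>1" for \<sigma>1
  proof (rule runs_mono[OF runs_agree[OF runs_decode] order_refl])
    fix \<tau> assume A: "decoded S m ''lm'' ''bm'' ''am'' \<tau> \<and> agree (assigned (decode ''m'' ''lm'' ''bm'' ''am''))
      (stored (decode ''m'' ''lm'' ''bm'' ''am'')) \<sigma>1 \<tau>"
    then have ag: "agree {''lm'', ''r'', ''bm'', ''am''} {} \<sigma>1 \<tau>"
      by simp
    have "ready S k m c \<tau>"
      by (rule ready_agree[OF _ ag]) (use Q in auto)
    moreover have "decoded S k ''lk'' ''bk'' ''ak'' \<tau>"
      by (rule decoded_agree[OF _ ag]) (use Q in auto)
    ultimately show "?Q2 \<tau>"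
      using A by blast
  qed (use readyD[of S k m c \<sigma>1] Q in auto)
  have 3: "runs \<omega> total_prog \<sigma>2 (ndata S * 17 + 7) (prepared S k m c)" if Q: "?Q2 \<sigma>2" for \<sigma>2
  proof (rule runs_mono[OF runs_agree[OF runs_total_prog] order_refl])
    fix \<tau>
    assume A: "scalar \<tau> ''total'' = (\<Sum>i<ndata S. norm_vec (v_part S k i) * norm_vec (v_part S m i)) \<and>
      agree (assigned total_prog) (stored total_prog) \<sigma>2 \<tau>"
    then have ag: "agree {''total'', ''i''} {} \<sigma>2 \<tau>"
      by simp
    have "ready S k m c \<tau>"
      by (rule ready_agree[OF _ ag]) (use Q in auto)
    moreover have "decoded S k ''lk'' ''bk'' ''ak'' \<tau>" "decoded S m ''lm'' ''bm'' ''am'' \<tau>"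
      by (rule decoded_agree[OF _ ag]; use Q in auto)+
    ultimately show "prepared S k m c \<tau>"
      using A by (simp add: prepared_def norm_total_def)
  qed (use Q km in auto)
  have 4: "runs \<omega> init_prog \<sigma>3 (ndata S * 67 + 9) ?Q4" if Q: "prepared S k m c \<sigma>3" for \<sigma>3
  proof (rule runs_mono[OF runs_agree[OF runs_init_prog] order_refl])
    show "ready S k m c \<sigma>3" "scalar \<sigma>3 ''total'' =
        (\<Sum>i<ndata S. norm_vec (v_part S k i) * norm_vec (v_part S m i))"
      using Q by (simp_all add: prepared_def norm_total_def)
    fix \<tau>
    assume A: "init_inv ?q0 (ndata S) \<tau> \<and> agree (assigned init_prog) (stored init_prog) \<sigma>3 \<tau>"
    then show "?Q4 \<tau>"
      by (intro conjI prepared_agree[OF Q]) auto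
  qed (use km in auto)
  have 5: "runs \<omega> alias_prog \<sigma>4 (ndata S * 65 + 5) (\<lambda>\<tau>. prepared S k m c \<tau> \<and>
      (\<exists>q al. alias_table (ndata S) ?q0 q al \<and> stores_table (ndata S) q al \<tau>))" if Q: "?Q4 \<sigma>4" for \<sigma>4
  proof (rule runs_mono[OF runs_agree[OF runs_alias_prog] order_refl])
    show "(\<Sum>s<ndata S. ?q0 s) = real (ndata S)"
      using total by (rule sum_sample_prob)
    show "init_inv ?q0 (ndata S) \<sigma>4"
      using Q ..
    fix \<tau>
    assume A: "(\<exists>q al. alias_table (ndata S) ?q0 q al \<and> stores_table (ndata S) q al \<tau>) \<and>
      agree (assigned alias_prog) (stored alias_prog) \<sigma>4 \<tau>"
    have "prepared S k m c \<tau>"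
      by (rule prepared_agree[of _ _ _ _ \<sigma>4]) (use Q A in auto)
    then show "prepared S k m c \<tau> \<and>
      (\<exists>q al. alias_table (ndata S) ?q0 q al \<and> stores_table (ndata S) q al \<tau>)"
      using A by blast
  qed (simp add: sample_prob_nonneg)
  show ?thesis
    unfolding prep_prog_def
    by (rule runs_Seq[OF 1], rule runs_Seq[OF 2], assumption, rule runs_Seq[OF 3], assumption,
        rule runs_Seq[OF 4], assumption, rule 5, assumption) (rule order_refl | simp)+
qed

section \<open>Drawing the samples and averaging\<close>

definition sample_draw :: prog where
  "sample_draw = Seq (Draw ''u'') (Seq (Assign ''z'' (Mul (Var ''n'') (Var ''u'')))
     (Seq (Assign ''f'' (Floor (Var ''z''))) (Seq (Assign ''t'' (Const 0))
     (If (Less (Var ''f'') (Var ''n''))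
        (If (Less (Sub (Var ''z'') (Var ''f'')) (Elem ''q'' [Var ''f'']))
           (Assign ''t'' (Var ''f'')) (Assign ''t'' (Elem ''al'' [Var ''f''])))
        Skip))))"

definition sample_expr :: expr where
  "sample_expr = Div
     (Mul (Mul (Elem ''x'' [Var ''t'', Sub (Var ''lk'') (Const 1), Var ''bk''])
       (Elem ''x'' [Var ''t'', Sub (Var ''lm'') (Const 1), Var ''bm''])) (Var ''s''))
     (Div (Mul (Elem ''norm'' [Var ''t'', Var ''k'']) (Elem ''norm'' [Var ''t'', Var ''m''])) (Var ''total''))"

abbreviation "sample_add \<equiv> Assign ''acc'' (Add (Var ''acc'') sample_expr)"

definition sample_body :: prog where
  "sample_body = Seq sample_draw (Seq (column_dot ''t'' ''lk'' ''ak'' ''lm'' ''am'') sample_add)"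

definition estimate_prog :: prog where
  "estimate_prog = Seq prep_prog (Seq (Assign ''acc'' (Const 0)) (Seq (For ''j'' ''c'' sample_body)
     (Assign ''estimate'' (Mul (Div (Const 1) (Var ''c'')) (Var ''acc'')))))"

lemma sample_frame [simp]:
  "assigned sample_draw = {''u'', ''z'', ''f'', ''t''}" "stored sample_draw = {}"
  "assigned sample_body = {''u'', ''z'', ''f'', ''t'', ''s'', ''p'', ''acc''}" "stored sample_body = {}"
  by (auto simp: sample_draw_def sample_body_def)

text \<open>The program sets \<open>t\<close> to 0 before its tests and so reproduces the default of
  \<open>alias_sample\<close>. For a random number in [0,1] the floor is nonnegative, hence equal to
  the index obtained by \<open>to_index\<close>.\<close>

lemma runs_sample_draw:
  assumes n: "scalar \<tau> ''n'' = real n" and tab: "stores_table n q al \<tau>" and u: "\<omega> (used \<tau>) \<in> {0..1}"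
  shows "runs \<omega> sample_draw \<tau> 40 (\<lambda>\<tau>'. scalar \<tau>' ''t'' = real (alias_sample n q al (\<omega> (used \<tau>))) \<and>
    used \<tau>' = Suc (used \<tau>))"
proof (rule runs_loop_free)
  let ?z = "real n * \<omega> (used \<tau>)"
  define s where "s = to_index ?z"
  have "0 \<le> \<lfloor>?z\<rfloor>"
    using u by simp
  then have f: "real_of_int \<lfloor>?z\<rfloor> = real s"
    by (simp add: s_def to_index_def)
  have a: "alias_sample n q al (\<omega> (used \<tau>)) = (if s < n then if ?z - real s < q s then s else al s else 0)"
    unfolding alias_sample_def s_def Let_def ..
  have "arr \<tau> ''q'' [s] = q s" "arr \<tau> ''al'' [s] = real (al s)" if "s < n"
    using tab that by (auto simp: stores_table_def)
  then show "scalar (eff \<omega> sample_draw \<tau>) ''t'' = real (alias_sample n q al (\<omega> (used \<tau>))) \<and>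
      used (eff \<omega> sample_draw \<tau>) = Suc (used \<tau>)"
    unfolding a by (simp add: sample_draw_def n f)
qed (simp_all add: sample_draw_def)

definition sample_term :: "'y network \<Rightarrow> nat \<Rightarrow> nat \<Rightarrow> nat \<Rightarrow> real" where
  "sample_term S k m t = (v_part S k t \<bullet> v_part S m t) / sample_prob S k m t"

text \<open>Only the inner product depends on d. The probability of the drawn point is recomputed in
  constant time from two stored norms and the normalising sum.\<close>

lemma runs_sample_body:
  assumes S: "gnh_setting S" and km: "k < num_weights S" "m < num_weights S"
    and prep: "prepared S k m c \<tau>" and tab: "stores_table (ndata S) q al \<tau>" "alias_table (ndata S) q0 q al"
    and u: "\<omega> (used \<tau>) \<in> {0..1}"
  shows "runs \<omega> sample_body \<tau> (width S * 21 + 77) (\<lambda>\<tau>'. used \<tau>' = Suc (used \<tau>) \<and> scalar \<tau>' ''acc'' =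
    scalar \<tau> ''acc'' + sample_term S k m (alias_sample (ndata S) q al (\<omega> (used \<tau>))))"
proof -
  let ?t = "alias_sample (ndata S) q al (\<omega> (used \<tau>))"
  let ?s = "\<Sum>p<width S. C_mat S ?t (weight_layer S k) $$ (p, weight_row S k) *
     C_mat S ?t (weight_layer S m) $$ (p, weight_row S m)"
  note D = gnh_settingD[OF S]
  have t: "?t < ndata S"
    using D(3) by (intro alias_sample_less[OF tab(2)]) simp
  note lk = weight_layer_le[OF km(1)] weight_row_less[OF D(1), of k] weight_col_less[OF D(1), of k]
  note lm = weight_layer_le[OF km(2)] weight_row_less[OF D(1), of m] weight_col_less[OF D(1), of m]
  have n: "scalar \<tau> ''n'' = real (ndata S)"
    using prep readyD(5) unfolding prepared_def by blast
  have 1: "runs \<omega> sample_draw \<tau> 40 (\<lambda>\<tau>'. (scalar \<tau>' ''t'' = real ?t \<and> used \<tau>' = Suc (used \<tau>)) \<and>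
      agree {''u'', ''z'', ''f'', ''t''} {} \<tau> \<tau>')"
    using runs_agree[OF runs_sample_draw[where \<omega> = \<omega> and \<tau> = \<tau>, OF n tab(1) u]] by simp
  show ?thesis
    unfolding sample_body_def
  proof (rule runs_Seq[OF 1])
    fix \<tau>1
    assume A: "(scalar \<tau>1 ''t'' = real ?t \<and> used \<tau>1 = Suc (used \<tau>)) \<and> agree {''u'', ''z'', ''f'', ''t''} {} \<tau> \<tau>1"
    then have ag1: "agree {''u'', ''z'', ''f'', ''t''} {} \<tau> \<tau>1"
      by blast
    have prep1: "prepared S k m c \<tau>1"
      by (rule prepared_agree[OF prep ag1]) auto
    then have "runs \<omega> (column_dot ''t'' ''lk'' ''ak'' ''lm'' ''am'') \<tau>1 (width S * 21 + 7) (\<lambda>\<tau>'. scalar \<tau>' ''s'' = ?s)"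
      using A t lk lm by (intro runs_column_dot) (auto simp: prepared_def ready_def decoded_def)
    from runs_agree[OF runs_used[OF this]]
    have 2: "runs \<omega> (column_dot ''t'' ''lk'' ''ak'' ''lm'' ''am'') \<tau>1 (width S * 21 + 7)
      (\<lambda>\<tau>'. (scalar \<tau>' ''s'' = ?s \<and> used \<tau>' = used \<tau>1) \<and> agree {''s'', ''p''} {} \<tau>1 \<tau>')"
      by simp
    show "runs \<omega> (Seq (column_dot ''t'' ''lk'' ''ak'' ''lm'' ''am'') sample_add) \<tau>1 (width S * 21 + 37)
        (\<lambda>\<tau>'. used \<tau>' = Suc (used \<tau>) \<and> scalar \<tau>' ''acc'' = scalar \<tau> ''acc'' + sample_term S k m ?t)"
    proof (rule runs_Seq[OF 2])
      fix \<tau>2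
      assume B: "(scalar \<tau>2 ''s'' = ?s \<and> used \<tau>2 = used \<tau>1) \<and> agree {''s'', ''p''} {} \<tau>1 \<tau>2"
      then have ag2: "agree {''s'', ''p''} {} \<tau>1 \<tau>2"
        by blast
      have prep2: "prepared S k m c \<tau>2"
        by (rule prepared_agree[OF prep1 ag2]) auto
      then have ready2: "ready S k m c \<tau>2"
        by (simp add: prepared_def)
      have x: "arr \<tau>2 ''x'' [?t, weight_layer S k - 1, weight_col S k] =
          x_vec S ?t (weight_layer S k - 1) $ weight_col S k"
        "arr \<tau>2 ''x'' [?t, weight_layer S m - 1, weight_col S m] =
          x_vec S ?t (weight_layer S m - 1) $ weight_col S m"
        using lk lm by (auto intro!: stores_precomputedD(4)[OF readyD(1)[OF ready2]] t)
      have vals: "scalar \<tau>2 ''t'' = real ?t" "scalar \<tau>2 ''acc'' = scalar \<tau> ''acc''" "scalar \<tau>2 ''s'' = ?s"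
        "used \<tau>2 = Suc (used \<tau>)"
        using A B by (simp_all add: agreeD(1)[OF ag2] agreeD(1)[OF ag1])
      have dec: "scalar \<tau>2 ''lk'' = real (weight_layer S k)" "scalar \<tau>2 ''bk'' = real (weight_col S k)"
        "scalar \<tau>2 ''lm'' = real (weight_layer S m)" "scalar \<tau>2 ''bm'' = real (weight_col S m)"
        "scalar \<tau>2 ''total'' = norm_total S k m"
        using prep2 by (simp_all add: prepared_def decoded_def)
      have "sample_term S k m ?t = x_vec S ?t (weight_layer S k - 1) $ weight_col S k *
          x_vec S ?t (weight_layer S m - 1) $ weight_col S m * ?s /
          (norm_vec (v_part S k ?t) * norm_vec (v_part S m ?t) / norm_total S k m)"
        unfolding sample_term_def v_part_scalar_prod[OF S t km] sample_prob_def norm_total_def ..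
      also have "\<dots> = eval_expr \<tau>2 sample_expr"
        unfolding sample_expr_def by (simp add: vals dec x[simplified] readyD[OF ready2] t km)
      finally show "runs \<omega> sample_add \<tau>2 30
          (\<lambda>\<tau>'. used \<tau>' = Suc (used \<tau>) \<and> scalar \<tau>' ''acc'' = scalar \<tau> ''acc'' + sample_term S k m ?t)"
        by (intro runs_loop_free) (simp_all add: vals(2,4), simp_all add: sample_expr_def)
    qed simp
  qed simp
qed

text \<open>The preparation enters as a given execution ending in \<open>\<sigma>1\<close>, so that
  \<open>q\<close> and \<open>al\<close> are fixed from outside instead of being chosen anew for
  each \<open>\<omega>\<close>. Since it draws nothing, sample j uses the random number at position
  \<open>used \<sigma> + j\<close>.\<close>

lemma runs_estimate_prog:
  assumes S: "gnh_setting S" and km: "k < num_weights S" "m < num_weights S"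
    and tab: "stores_table (ndata S) q al \<sigma>1" "alias_table (ndata S) q0 q al"
    and prep: "prepared S k m c \<sigma>1" "exec \<omega> prep_prog \<sigma> B \<sigma>1" "used \<sigma>1 = used \<sigma>"
    and \<omega>: "\<And>j. \<omega> j \<in> {0..1}"
  shows "runs \<omega> estimate_prog \<sigma> (B + c * (width S * 21 + 84) + 13) (\<lambda>\<sigma>'. ready S k m c \<sigma>' \<and>
    scalar \<sigma>' ''estimate'' = estimator S k m c (\<lambda>j. alias_sample (ndata S) q al (\<omega> (used \<sigma> + j))))"
proof -
  let ?t = "\<lambda>j. alias_sample (ndata S) q al (\<omega> (used \<sigma> + j))"
  let ?s = "\<lambda>j. \<Sum>i<j. sample_term S k m (?t i)"
  let ?\<sigma> = "\<sigma>1\<lparr>scalar := (scalar \<sigma>1)(''acc'' := 0)\<rparr>"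
  have ag0: "agree {''acc''} {} \<sigma>1 ?\<sigma>"
    by (auto simp: agree_def)
  have prep0: "prepared S k m c ?\<sigma>"
    by (rule prepared_agree[OF prep(1) ag0]) auto
  have loop: "runs \<omega> (For ''j'' ''c'' sample_body) ?\<sigma> (c * (width S * 21 + 84) + 5)
      (\<lambda>\<tau>. prepared S k m c \<tau> \<and> scalar \<tau> ''acc'' = ?s c)"
  proof (rule runs_For[where N = c and B = "width S * 21 + 77"
        and I = "\<lambda>j \<tau>. used \<tau> = used \<sigma> + j \<and> scalar \<tau> ''acc'' = ?s j"])
    show "scalar ?\<sigma> ''c'' = real c"
      using prep0 readyD(8) unfolding prepared_def by blast
    show "used (?\<sigma>\<lparr>scalar := (scalar ?\<sigma>)(''j'' := 0)\<rparr>) = used \<sigma> + 0 \<and>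
        scalar (?\<sigma>\<lparr>scalar := (scalar ?\<sigma>)(''j'' := 0)\<rparr>) ''acc'' = ?s 0"
      by (simp add: prep(3))
    show "prepared S k m c \<tau> \<and> scalar \<tau> ''acc'' = ?s c"
      if "used \<tau> = used \<sigma> + c \<and> scalar \<tau> ''acc'' = ?s c"
        "agree (insert ''j'' (assigned sample_body)) (stored sample_body) ?\<sigma> \<tau>" for \<tau>
      using that(1) by (intro conjI prepared_agree[OF prep0 that(2)]) auto
    fix j :: nat and \<tau> :: state
    assume j: "used \<tau> = used \<sigma> + j \<and> scalar \<tau> ''acc'' = ?s j"
      and "agree (insert ''j'' (assigned sample_body)) (stored sample_body) ?\<sigma> \<tau>"
    then have ag: "agree {''j'', ''u'', ''z'', ''f'', ''t'', ''s'', ''p'', ''acc''} {} ?\<sigma> \<tau>"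
      by simp
    have "prepared S k m c \<tau>"
      by (rule prepared_agree[OF prep0 ag]) auto
    moreover have "stores_table (ndata S) q al \<tau>"
      using tab(1) by (simp add: stores_table_def agreeD(2)[OF ag])
    ultimately have "runs \<omega> sample_body \<tau> (width S * 21 + 77) (\<lambda>\<tau>'. used \<tau>' = Suc (used \<tau>) \<and> scalar \<tau>' ''acc'' =
        scalar \<tau> ''acc'' + sample_term S k m (alias_sample (ndata S) q al (\<omega> (used \<tau>))))"
      using tab(2) \<omega> by (rule runs_sample_body[OF S km])
    then show "runs \<omega> sample_body \<tau> (width S * 21 + 77) (\<lambda>\<tau>'.
        used (\<tau>'\<lparr>scalar := (scalar \<tau>')(''j'' := real (Suc j))\<rparr>) = used \<sigma> + Suc j \<and>
        scalar (\<tau>'\<lparr>scalar := (scalar \<tau>')(''j'' := real (Suc j))\<rparr>) ''acc'' = ?s (Suc j))"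
      by (rule runs_mono) (use j in auto)
  qed auto
  have fin: "runs \<omega> (Assign ''estimate'' (Mul (Div (Const 1) (Var ''c'')) (Var ''acc''))) \<tau> 6 (\<lambda>\<sigma>'. ready S k m c \<sigma>' \<and>
      scalar \<sigma>' ''estimate'' = estimator S k m c ?t)"
    if Q: "prepared S k m c \<tau> \<and> scalar \<tau> ''acc'' = ?s c" for \<tau>
  proof (rule runs_loop_free)
    let ?e = "eff \<omega> (Assign ''estimate'' (Mul (Div (Const 1) (Var ''c'')) (Var ''acc''))) \<tau>"
    have ready: "ready S k m c \<tau>"
      using Q by (simp add: prepared_def)
    have "ready S k m c ?e"
      by (rule ready_agree[OF ready, of "{''estimate''}" "{}"]) (auto simp: agree_def)
    moreover have "scalar ?e ''estimate'' = estimator S k m c ?t"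
      using Q by (simp add: readyD(8)[OF ready] estimator_def sample_term_def)
    ultimately show "ready S k m c ?e \<and> scalar ?e ''estimate'' = estimator S k m c ?t"
      by blast
  qed simp_all
  have rest: "runs \<omega> (Seq (Assign ''acc'' (Const 0)) (Seq (For ''j'' ''c'' sample_body)
     (Assign ''estimate'' (Mul (Div (Const 1) (Var ''c'')) (Var ''acc''))))) \<sigma>1
     (c * (width S * 21 + 84) + 13) (\<lambda>\<sigma>'. ready S k m c \<sigma>' \<and>
      scalar \<sigma>' ''estimate'' = estimator S k m c ?t)"
    by (rule runs_Assign_Seq[where B = "c * (width S * 21 + 84) + 11"])
      (use runs_Seq[OF loop fin] in simp_all)
  have "runs \<omega> prep_prog \<sigma> B (\<lambda>\<tau>. \<tau> = \<sigma>1)"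
    using prep(2) unfolding runs_def by blast
  then show ?thesis
    unfolding estimate_prog_def by (rule runs_Seq) (use rest in auto)
qed

lemma prep_prog_draw_free: "draw_free prep_prog"
  by (simp add: prep_prog_def)

section \<open>Accuracy and total work\<close>

lemma importance_sampling_estimator:
  assumes S: "gnh_setting S" and km: "k < num_weights S" "m < num_weights S"
    and total: "norm_total S k m \<noteq> 0" and c: "1 \<le> c"
    and iid: "iid_samples (ndata S) (sample_prob S k m) c t"
  shows "importance_sampling (ndata S) c (sample_prob S k m) (\<lambda>i. v_part S k i \<bullet> v_part S m i) t (norm_total S k m)"
proof
  show "0 < norm_total S k m"
    using total norm_total_nonneg[of S k m] by linarith
  fix i assume i: "i < ndata S"
  \<comment> \<open>Sampling in proportion to the products of norms makes the Cauchy-Schwarz bound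
    on a term, divided by its probability, the same for all data points.\<close>
  have "norm_total S k m * sample_prob S k m i = norm_vec (v_part S k i) * norm_vec (v_part S m i)"
    using total by (simp add: sample_prob_def norm_total_def)
  then show "0 \<le> sample_prob S k m i \<and> \<bar>v_part S k i \<bullet> v_part S m i\<bar> \<le> norm_total S k m * sample_prob S k m i"
    using scalar_prod_le_norm_vec[OF v_part_carrier[OF S i] v_part_carrier[OF S i]] sample_prob_nonneg by metis
qed (rule iid c)+

lemma estimator_accuracy:
  assumes S: "gnh_setting S" and km: "k < num_weights S" "m < num_weights S"
    and total: "norm_total S k m \<noteq> 0" and c: "1 \<le> c" and \<epsilon>: "0 < \<epsilon>"
    and iid: "iid_samples (ndata S) (sample_prob S k m) c t"
  shows "1 / \<epsilon>\<^sup>2 \<le> real c \<Longrightarrow>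
      sqrt (\<integral>\<omega>. (estimator S k m c (t \<omega>) - gauss_newton_hessian S $$ (k, m))\<^sup>2 \<partial>draws)
        \<le> \<epsilon> * norm_vec (v_vec S k) * norm_vec (v_vec S m)"
    and "\<lbrakk>0 < \<delta>; \<delta> < 1; (1 + sqrt (8 * ln (1 / \<delta>)))\<^sup>2 / \<epsilon>\<^sup>2 \<le> real c\<rbrakk> \<Longrightarrow>
      1 - \<delta> \<le> measure draws {\<omega> \<in> space draws.
        \<bar>estimator S k m c (t \<omega>) - gauss_newton_hessian S $$ (k, m)\<bar>
          \<le> \<epsilon> * norm_vec (v_vec S k) * norm_vec (v_vec S m)}"
proof -
  interpret I: importance_sampling "ndata S" c "sample_prob S k m" "\<lambda>i. v_part S k i \<bullet> v_part S m i" t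
    "norm_total S k m"
    using importance_sampling_estimator[OF S km total c iid] .
  have est: "estimator S k m c (t \<omega>) = I.est \<omega>" for \<omega>
    by (simp add: estimator_def I.est_def I.X_def)
  have mu: "gauss_newton_hessian S $$ (k, m) = I.\<mu>"
    by (simp add: gauss_newton_hessian_entry[OF S km] I.\<mu>_def)
  have le: "\<epsilon> * norm_total S k m \<le> \<epsilon> * norm_vec (v_vec S k) * norm_vec (v_vec S m)"
    using sum_norm_vec_le[OF S, of k m] \<epsilon> by (simp add: norm_total_def mult.assoc)
  show "sqrt (\<integral>\<omega>. (estimator S k m c (t \<omega>) - gauss_newton_hessian S $$ (k, m))\<^sup>2 \<partial>draws)
      \<le> \<epsilon> * norm_vec (v_vec S k) * norm_vec (v_vec S m)" if "1 / \<epsilon>\<^sup>2 \<le> real c"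
    unfolding est mu using I.est_rms[OF \<epsilon> that] le by linarith
  assume \<delta>: "0 < \<delta>" "\<delta> < 1" "(1 + sqrt (8 * ln (1 / \<delta>)))\<^sup>2 / \<epsilon>\<^sup>2 \<le> real c"
  have "1 - \<delta> \<le> draws.prob {\<omega> \<in> space draws. \<bar>I.est \<omega> - I.\<mu>\<bar> \<le> \<epsilon> * norm_total S k m}"
    using I.est_tail[OF \<epsilon> \<delta>] .
  also have "\<dots> \<le> draws.prob {\<omega> \<in> space draws. \<bar>I.est \<omega> - I.\<mu>\<bar> \<le>
      \<epsilon> * norm_vec (v_vec S k) * norm_vec (v_vec S m)}"
  proof (rule draws.finite_measure_mono)
    show "{\<omega> \<in> space draws. \<bar>I.est \<omega> - I.\<mu>\<bar> \<le> \<epsilon> * norm_total S k m} \<subseteq>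
        {\<omega> \<in> space draws. \<bar>I.est \<omega> - I.\<mu>\<bar> \<le> \<epsilon> * norm_vec (v_vec S k) * norm_vec (v_vec S m)}"
      using le by auto
  qed measurable
  finally show "1 - \<delta> \<le> measure draws {\<omega> \<in> space draws.
      \<bar>estimator S k m c (t \<omega>) - gauss_newton_hessian S $$ (k, m)\<bar>
        \<le> \<epsilon> * norm_vec (v_vec S k) * norm_vec (v_vec S m)}"
    unfolding est mu .
qed

text \<open>Using \<open>1 \<le> n\<close>, the constants 121 and 13 join 149 to give 283; using
  \<open>1 \<le> d\<close>, 21 and 84 give 105 per sample and unit of width. The absolute value
  keeps the factor nonnegative for every \<open>A\<close>.\<close>

lemma estimate_cost:
  assumes n: "1 \<le> (n::nat)" and d: "1 \<le> (d::nat)" and \<epsilon>: "0 < \<epsilon>" and c: "real c \<le> A / \<epsilon>\<^sup>2"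
    and work: "work \<le> (n * 149 + 121) + c * (d * 21 + 84) + 13"
  shows "real work \<le> (283 + 105 * \<bar>A\<bar>) * (real n + real d / \<epsilon>\<^sup>2)"
proof -
  have "c * (d * 21 + 84) \<le> c * (105 * d)"
    using d by (intro mult_le_mono2) linarith
  then have "work \<le> 283 * n + 105 * (c * d)"
    using work n by linarith
  then have "real work \<le> real (283 * n + 105 * (c * d))"
    by (rule of_nat_mono)
  also have "\<dots> = 283 * real n + 105 * (real c * real d)"
    by simp
  also have "real c * real d \<le> \<bar>A\<bar> * (real d / \<epsilon>\<^sup>2)"
  proof -
    have "A / \<epsilon>\<^sup>2 \<le> \<bar>A\<bar> / \<epsilon>\<^sup>2"
      by (intro divide_right_mono) auto
    then have "real c * real d \<le> \<bar>A\<bar> / \<epsilon>\<^sup>2 * real d"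
      using c by (intro mult_right_mono) auto
    then show ?thesis
      by simp
  qed
  finally have "real work \<le> 283 * real n + 105 * \<bar>A\<bar> * (real d / \<epsilon>\<^sup>2)"
    by simp
  also have "\<dots> \<le> (283 + 105 * \<bar>A\<bar>) * real n + (283 + 105 * \<bar>A\<bar>) * (real d / \<epsilon>\<^sup>2)"
    by (intro add_mono mult_right_mono) auto
  finally show ?thesis
    by (simp add: distrib_left)
qed

lemma norm_prog_correct:
  assumes S: "gnh_setting S" and pre: "stores_precomputed S \<sigma>"
  shows "\<exists>work \<sigma>'. exec \<omega> norm_prog \<sigma> work \<sigma>' \<and> stores_precomputed S \<sigma>' \<and> stores_norms S \<sigma>' \<and>
    real work \<le> 105 * (real (ndata S) * real (num_weights S))"
proof -
  obtain work \<sigma>' where w: "exec \<omega> norm_prog \<sigma> work \<sigma>'" "stores_norms S \<sigma>'"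
    "work \<le> 105 * (ndata S * num_weights S)"
    using runs_norm_prog[OF S pre, of \<omega>] unfolding runs_def by blast
  have "stores_precomputed S \<sigma>'"
    by (rule stores_precomputed_agree[OF pre exec_agree[OF w(1)]]) (auto simp: norm_prog_def)
  moreover have "real work \<le> 105 * (real (ndata S) * real (num_weights S))"
    using of_nat_mono[OF w(3), where 'a = real] by simp
  ultimately show ?thesis
    using w by blast
qed

lemma estimate_prog_correct:
  assumes S: "gnh_setting S" and st: "stores_precomputed S \<sigma>" "stores_norms S \<sigma>" "stores_query k m c \<sigma>"
    and \<epsilon>: "0 < \<epsilon>" and c: "1 \<le> c" "real c \<le> A / \<epsilon>\<^sup>2"
    and km: "k < num_weights S" "m < num_weights S"
    and sum: "(\<Sum>j<ndata S. norm_vec (v_part S k j) * norm_vec (v_part S m j)) \<noteq> 0"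
  shows "\<exists>t. iid_samples (ndata S) (sample_prob S k m) c t \<and>
      (\<forall>\<omega>. (\<forall>j. \<omega> j \<in> {0..1}) \<longrightarrow>
         (\<exists>work \<sigma>'. exec \<omega> estimate_prog \<sigma> work \<sigma>' \<and>
            stores_precomputed S \<sigma>' \<and> stores_norms S \<sigma>' \<and>
            scalar \<sigma>' ''estimate'' = estimator S k m c (t \<omega>) \<and>
            real work \<le> (283 + 105 * \<bar>A\<bar>) * (real (ndata S) + real (width S) / \<epsilon>\<^sup>2))) \<and>
      (1 / \<epsilon>\<^sup>2 \<le> real c \<longrightarrow>
         sqrt (\<integral>\<omega>. (estimator S k m c (t \<omega>) - gauss_newton_hessian S $$ (k, m))\<^sup>2 \<partial>draws)
           \<le> \<epsilon> * norm_vec (v_vec S k) * norm_vec (v_vec S m)) \<and>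
      (\<forall>\<delta>::real. 0 < \<delta> \<and> \<delta> < 1 \<and> (1 + sqrt (8 * ln (1 / \<delta>)))\<^sup>2 / \<epsilon>\<^sup>2 \<le> real c \<longrightarrow>
         1 - \<delta> \<le> measure draws {\<omega> \<in> space draws.
           \<bar>estimator S k m c (t \<omega>) - gauss_newton_hessian S $$ (k, m)\<bar>
             \<le> \<epsilon> * norm_vec (v_vec S k) * norm_vec (v_vec S m)})"
proof -
  have total: "norm_total S k m \<noteq> 0"
    using sum by (simp add: norm_total_def)
  have n: "0 < ndata S" "1 \<le> ndata S" "1 \<le> width S"
    using gnh_settingD(1,3)[OF S] by auto
  have "ready S k m c \<sigma>"
    using st by (simp add: ready_def)
  \<comment> \<open>The table must be fixed before \<open>\<omega>\<close>; the preparation draws nothing, so one run serves all \<open>\<omega>\<close>.\<close>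
  from runs_prep_prog[OF this km total, of "\<lambda>_. 0"]
  obtain B \<sigma>1 q al where prep: "exec (\<lambda>_. 0) prep_prog \<sigma> B \<sigma>1" "B \<le> ndata S * 149 + 121"
      "prepared S k m c \<sigma>1" and
    tab: "alias_table (ndata S) (\<lambda>s. real (ndata S) * sample_prob S k m s) q al" "stores_table (ndata S) q al \<sigma>1"
    unfolding runs_def by blast
  \<comment> \<open>The table was obtained from \<open>\<sigma>\<close> without reference to any
    \<open>\<omega>\<close>; the memory may record earlier draws, hence the offset
    \<open>used \<sigma>\<close>.\<close>
  define t where "t \<omega> j = alias_sample (ndata S) q al (\<omega> (used \<sigma> + j))" for \<omega> j
  have iid: "iid_samples (ndata S) (sample_prob S k m) c t"
    using iid_alias_samples[OF tab(1) n(1), of c "used \<sigma>"] n(1) by (simp add: t_def[abs_def])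
  have runs: "\<exists>work \<sigma>'. exec \<omega> estimate_prog \<sigma> work \<sigma>' \<and> stores_precomputed S \<sigma>' \<and> stores_norms S \<sigma>' \<and>
      scalar \<sigma>' ''estimate'' = estimator S k m c (t \<omega>) \<and>
      real work \<le> (283 + 105 * \<bar>A\<bar>) * (real (ndata S) + real (width S) / \<epsilon>\<^sup>2)"
    if \<omega>: "\<forall>j. \<omega> j \<in> {0..1}" for \<omega>
  proof -
    have "runs \<omega> estimate_prog \<sigma> (B + c * (width S * 21 + 84) + 13) (\<lambda>\<sigma>'. ready S k m c \<sigma>' \<and>
        scalar \<sigma>' ''estimate'' = estimator S k m c (\<lambda>j. alias_sample (ndata S) q al (\<omega> (used \<sigma> + j))))"
      using \<omega> by (intro runs_estimate_prog[OF S km tab(2,1) prep(3)] exec_draw_free[OF prep(1)]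
          exec_used[OF prep(1)] prep_prog_draw_free) auto
    then obtain work \<sigma>' where w: "exec \<omega> estimate_prog \<sigma> work \<sigma>'" "work \<le> B + c * (width S * 21 + 84) + 13"
        "ready S k m c \<sigma>'" "scalar \<sigma>' ''estimate'' = estimator S k m c (t \<omega>)"
      unfolding runs_def t_def by blast
    have "work \<le> (ndata S * 149 + 121) + c * (width S * 21 + 84) + 13"
      using w(2) prep(2) by linarith
    from estimate_cost[OF n(2,3) \<epsilon> c(2) this] show ?thesis
      using w(1,3,4) unfolding ready_def by blast
  qed
  show ?thesis
    using iid runs estimator_accuracy[OF S km total c(1) \<epsilon> iid] by blast
qed

theorem theorem3p5:
  shows "\<exists>norm_prog estimate_prog.
    (\<exists>K::real. \<forall>(S::'y network) \<sigma> \<omega>.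
       gnh_setting S \<and> stores_precomputed S \<sigma> \<longrightarrow>
       (\<exists>work \<sigma>'. exec \<omega> norm_prog \<sigma> work \<sigma>' \<and>
          stores_precomputed S \<sigma>' \<and> stores_norms S \<sigma>' \<and>
          real work \<le> K * (real (ndata S) * real (num_weights S)))) \<and>
    (\<forall>A::real. \<exists>K::real. \<forall>(S::'y network) (\<epsilon>::real) c k m \<sigma>.
       gnh_setting S \<and> stores_precomputed S \<sigma> \<and> stores_norms S \<sigma> \<and> stores_query k m c \<sigma> \<and>
       0 < \<epsilon> \<and> \<epsilon> < 1 \<and> 1 \<le> c \<and> real c \<le> A / \<epsilon>\<^sup>2 \<and>
       k < num_weights S \<and> m < num_weights S \<and>
       (\<Sum>j<ndata S. norm_vec (v_part S k j) * norm_vec (v_part S m j)) \<noteq> 0 \<longrightarrow>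
       (\<exists>t. iid_samples (ndata S) (sample_prob S k m) c t \<and>
          (\<forall>\<omega>. (\<forall>j. \<omega> j \<in> {0..1}) \<longrightarrow>
             (\<exists>work \<sigma>'. exec \<omega> estimate_prog \<sigma> work \<sigma>' \<and>
                stores_precomputed S \<sigma>' \<and> stores_norms S \<sigma>' \<and>
                scalar \<sigma>' ''estimate'' = estimator S k m c (t \<omega>) \<and>
                real work \<le> K * (real (ndata S) + real (width S) / \<epsilon>\<^sup>2))) \<and>
          (1 / \<epsilon>\<^sup>2 \<le> real c \<longrightarrow>
             sqrt (\<integral>\<omega>. (estimator S k m c (t \<omega>) - gauss_newton_hessian S $$ (k, m))\<^sup>2 \<partial>draws)
               \<le> \<epsilon> * norm_vec (v_vec S k) * norm_vec (v_vec S m)) \<and>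
          (\<forall>\<delta>::real. 0 < \<delta> \<and> \<delta> < 1 \<and> (1 + sqrt (8 * ln (1 / \<delta>)))\<^sup>2 / \<epsilon>\<^sup>2 \<le> real c \<longrightarrow>
             1 - \<delta> \<le> measure draws {\<omega> \<in> space draws.
               \<bar>estimator S k m c (t \<omega>) - gauss_newton_hessian S $$ (k, m)\<bar>
                 \<le> \<epsilon> * norm_vec (v_vec S k) * norm_vec (v_vec S m)})))"
  apply (rule exI[of _ norm_prog], rule exI[of _ estimate_prog], rule conjI)
  subgoal
    by (intro exI[of _ "105::real"] allI impI, elim conjE) (rule norm_prog_correct)
  apply (rule allI)
  subgoal for A
    by (intro allI impI exI[of _ "283 + 105 * \<bar>A\<bar>"], elim conjE) (rule estimate_prog_correct)
  done

end
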